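(* Let $A_\Gamma$ be a triangle-free $(2,2)$-free Artin group that is not of spherical type. Let $m\geq 1$ be a uniform exponent for the power alternative for $A_\Gamma$. Let $S$ be a generating set of $A_\Gamma$. Then there exist $s,t\in S$ such that $s^m$ and $t^m$ generate a non-abelian free subgroup of $A_\Gamma$. In particular, $A_\Gamma$ has uniform exponential growth.
   Context: An integer $m\ge1$ is a uniform exponent for the power alternative for a group $G$ if for every $g,h\in G$, either $g^m$ and $h^m$ commute or $\langle g^m,h^m\rangle\cong F_2$. A presentation graph is a finite simplicial graph $\Gamma$ with a label $m_{st}\in\{2,3,\dots\}$ on each edge $\{s,t\}$; the Artin group is $A_\Gamma=\langle \mathrm{Vert}(\Gamma)\mid \underbrace{sts\cdots}_{m_{st}}=\underbrace{tst\cdots}_{m_{st}}\text{ for every edge }\{s,t\}\rangle$. $A_\Gamma$ is triangle-free if $\Gamma$ contains no induced $3$-cycle, and $(2,2)$-free if $\Gamma$ does not contain two adjacent edges both labelled $2$. $A_\Gamma$ is of spherical type if the associated Coxeter group $W_\Gamma$, the quotient of $A_\Gamma$ by the normal closure of $\{s^2:s\in\mathrm{Vert}(\Gamma)\}$, is finite. A finitely generated group has uniform exponential growth if the infimum, over all finite generating sets, of the exponential growth rate is strictly greater than $1$. (Such an exponent $m$ is known for these groups: with $m'_{ab}=m_{ab}/2$ if $m_{ab}$ is even and $2m_{ab}$ if $m_{ab}$ is odd, and $N=\operatorname{lcm}\{m'_{ab}\}$ over the edges $\{a,b\}$ of $\Gamma$, one may take $m=N$ if $N\ge3$ and $m=4$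 if $N=2$.) *)

theory Defs
  imports "HOL-Algebra.Elementary_Groups" "HOL-Library.Extended_Real"
begin

text \<open>
  Words over the letters \<open>X \<union> X\<^sup>-\<^sup>1\<close>: the letter \<open>(x, True)\<close> stands for \<open>x\<close>
  and \<open>(x, False)\<close> for \<open>x\<^sup>-\<^sup>1\<close>.  The group \<open>\<langle>X | R\<rangle>\<close>, whose relations
  are given as pairs \<open>(u, v)\<close> meaning \<open>u = v\<close>, is the quotient of the
  monoid of words by the congruence generated by \<open>R\<close> and by free cancellation.
\<close>

type_synonym 'a gword = "('a \<times> bool) list"

definition gwords :: "'a set \<Rightarrow> 'a gword set" where
  "gwords X = lists (X \<times> UNIV)"

inductive pres_cong :: "'a set \<Rightarrow> ('a gword \<times> 'a gword) set \<Rightarrow> 'a gword \<Rightarrow> 'a gword \<Rightarrow> bool"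
  for X R where
  refl: "w \<in> gwords X \<Longrightarrow> pres_cong X R w w"
| sym: "pres_cong X R v w \<Longrightarrow> pres_cong X R w v"
| trans: "pres_cong X R u v \<Longrightarrow> pres_cong X R v w \<Longrightarrow> pres_cong X R u w"
| append: "pres_cong X R u u' \<Longrightarrow> pres_cong X R v v' \<Longrightarrow> pres_cong X R (u @ v) (u' @ v')"
| cancel: "x \<in> X \<Longrightarrow> pres_cong X R [(x, b), (x, \<not> b)] []"
| relation: "(u, v) \<in> R \<Longrightarrow> u \<in> gwords X \<Longrightarrow> v \<in> gwords X \<Longrightarrow> pres_cong X R u v"

definition pres_class :: "'a set \<Rightarrow> ('a gword \<times> 'a gword) set \<Rightarrow> 'a gword \<Rightarrow> 'a gword set" where
  "pres_class X R w = {v. pres_cong X R w v}"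

definition presented_group :: "'a set \<Rightarrow> ('a gword \<times> 'a gword) set \<Rightarrow> 'a gword set monoid" where
  "presented_group X R =
     \<lparr>carrier = pres_class X R ` gwords X,
      mult = (\<lambda>A B. \<Union>u\<in>A. \<Union>v\<in>B. pres_class X R (u @ v)),
      one = pres_class X R []\<rparr>"

definition free_group :: "'a set \<Rightarrow> 'a gword set monoid" where
  "free_group X = presented_group X {}"

text \<open>
  Taking the basis to be a set of elements of the type underlying \<open>G\<close> is no
  restriction, since a basis of a free group is a subset of the group.
\<close>

definition is_free_group :: "('a, 'b) monoid_scheme \<Rightarrow> bool" where
  "is_free_group G \<longleftrightarrow> (\<exists>X :: 'a set. G \<cong> free_group X)"

definition normal_closure :: "('a, 'b) monoid_scheme \<Rightarrow> 'a set \<Rightarrow> 'a set" where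
  "normal_closure G S = \<Inter>{N. N \<lhd> G \<and> S \<subseteq> N}"

definition generates :: "('a, 'b) monoid_scheme \<Rightarrow> 'a set \<Rightarrow> bool" where
  "generates G S \<longleftrightarrow> S \<subseteq> carrier G \<and> generate G S = carrier G"

definition uniform_power_exponent :: "('a, 'b) monoid_scheme \<Rightarrow> nat \<Rightarrow> bool" where
  "uniform_power_exponent G m \<longleftrightarrow> m \<ge> 1 \<and>
     (\<forall>g\<in>carrier G. \<forall>h\<in>carrier G.
        (g [^]\<^bsub>G\<^esub> m) \<otimes>\<^bsub>G\<^esub> (h [^]\<^bsub>G\<^esub> m) = (h [^]\<^bsub>G\<^esub> m) \<otimes>\<^bsub>G\<^esub> (g [^]\<^bsub>G\<^esub> m) \<or>
        subgroup_generated G {g [^]\<^bsub>G\<^esub> m, h [^]\<^bsub>G\<^esub> m} \<cong> free_group (UNIV :: bool set))"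

definition word_ball :: "('a, 'b) monoid_scheme \<Rightarrow> 'a set \<Rightarrow> nat \<Rightarrow> 'a set" where
  "word_ball G S n =
     (\<lambda>ws. foldr (\<otimes>\<^bsub>G\<^esub>) ws \<one>\<^bsub>G\<^esub>) ` {ws \<in> lists (S \<union> m_inv G ` S). length ws \<le> n}"

text \<open>
  The upper limit is in fact a limit, because the cardinalities of the balls are
  submultiplicative in the radius.
\<close>

definition exp_growth_rate :: "('a, 'b) monoid_scheme \<Rightarrow> 'a set \<Rightarrow> ereal" where
  "exp_growth_rate G S = limsup (\<lambda>n. ereal (root n (real (card (word_ball G S n)))))"

definition uniform_exponential_growth :: "('a, 'b) monoid_scheme \<Rightarrow> bool" where
  "uniform_exponential_growth G \<longleftrightarrow>
     (\<exists>S. finite S \<and> generates G S) \<and>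
     1 < (INF S\<in>{S. finite S \<and> generates G S}. exp_growth_rate G S)"

text \<open>Only the values of \<open>lab\<close> on the edges, i.e. on members of \<open>E\<close>, are meaningful.\<close>

definition presentation_graph :: "'v set \<Rightarrow> 'v set set \<Rightarrow> ('v set \<Rightarrow> nat) \<Rightarrow> bool" where
  "presentation_graph V E lab \<longleftrightarrow>
     finite V \<and> (\<forall>e\<in>E. e \<subseteq> V \<and> card e = 2 \<and> lab e \<ge> 2)"

text \<open>In a simplicial graph every 3-cycle is induced.\<close>

definition triangle_free :: "'v set set \<Rightarrow> bool" where
  "triangle_free E \<longleftrightarrow>
     \<not> (\<exists>a b c. distinct [a, b, c] \<and> {a, b} \<in> E \<and> {b, c} \<in> E \<and> {a, c} \<in> E)"

definition two_two_free :: "'v set set \<Rightarrow> ('v set \<Rightarrow> nat) \<Rightarrow> bool" where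
  "two_two_free E lab \<longleftrightarrow>
     \<not> (\<exists>e\<in>E. \<exists>e'\<in>E. e \<noteq> e' \<and> e \<inter> e' \<noteq> {} \<and> lab e = 2 \<and> lab e' = 2)"

definition alternating_word :: "'v \<Rightarrow> 'v \<Rightarrow> nat \<Rightarrow> 'v gword" where
  "alternating_word s t k = map (\<lambda>i. (if even i then s else t, True)) [0..<k]"

definition artin_relations :: "'v set set \<Rightarrow> ('v set \<Rightarrow> nat) \<Rightarrow> ('v gword \<times> 'v gword) set" where
  "artin_relations E lab =
     {(alternating_word s t (lab {s, t}), alternating_word t s (lab {s, t})) | s t. {s, t} \<in> E}"

definition artin_group :: "'v set \<Rightarrow> 'v set set \<Rightarrow> ('v set \<Rightarrow> nat) \<Rightarrow> 'v gword set monoid" where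
  "artin_group V E lab = presented_group V (artin_relations E lab)"

definition artin_gen :: "'v set \<Rightarrow> 'v set set \<Rightarrow> ('v set \<Rightarrow> nat) \<Rightarrow> 'v \<Rightarrow> 'v gword set" where
  "artin_gen V E lab s = pres_class V (artin_relations E lab) [(s, True)]"

definition coxeter_group :: "'v set \<Rightarrow> 'v set set \<Rightarrow> ('v set \<Rightarrow> nat) \<Rightarrow> 'v gword set set monoid" where
  "coxeter_group V E lab =
     artin_group V E lab Mod
       normal_closure (artin_group V E lab)
         {artin_gen V E lab s [^]\<^bsub>artin_group V E lab\<^esub> (2 :: nat) | s. s \<in> V}"

definition spherical_type :: "'v set \<Rightarrow> 'v set set \<Rightarrow> ('v set \<Rightarrow> nat) \<Rightarrow> bool" where
  "spherical_type V E lab \<longleftrightarrow> finite (carrier (coxeter_group V E lab))"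

lemma pres_cong_gwords: "pres_cong X R u v \<Longrightarrow> u \<in> gwords X \<and> v \<in> gwords X"
  by (induction rule: pres_cong.induct) (auto simp: gwords_def)

lemma pres_class_eq_iff:
  assumes "u \<in> gwords X"
  shows "pres_class X R u = pres_class X R v \<longleftrightarrow> pres_cong X R u v"
  using assms unfolding pres_class_def
  by (auto simp: set_eq_iff intro: pres_cong.intros)

lemma presented_group_mult:
  assumes "u \<in> gwords X" "v \<in> gwords X"
  shows "pres_class X R u \<otimes>\<^bsub>presented_group X R\<^esub> pres_class X R v = pres_class X R (u @ v)"
proof -
  have "pres_cong X R (u @ v) w \<longleftrightarrow>
      (\<exists>u' v'. pres_cong X R u u' \<and> pres_cong X R v v' \<and> pres_cong X R (u' @ v') w)" for w
    using assms by (meson pres_cong.refl pres_cong.append pres_cong.trans pres_cong.sym)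
  then show ?thesis
    unfolding presented_group_def by (auto simp: pres_class_def)
qed

lemma presented_group_left_inverse:
  assumes "w \<in> gwords X"
  shows "\<exists>v\<in>gwords X. pres_cong X R (v @ w) []"
  using assms
proof (induction w)
  case Nil
  then show ?case by (auto simp: gwords_def intro!: bexI[of _ "[]"] pres_cong.refl)
next
  case (Cons a w)
  obtain x b where a: "a = (x, b)" by force
  with Cons.prems have x: "x \<in> X" and w: "w \<in> gwords X" by (auto simp: gwords_def)
  from Cons.IH[OF w] obtain v where v: "v \<in> gwords X" "pres_cong X R (v @ w) []" by blast
  have "pres_cong X R ([(x, \<not> b), (x, b)] @ w) ([] @ w)"
    using pres_cong.cancel[OF x, of R "\<not> b"] w by (intro pres_cong.append pres_cong.refl) auto
  then have "pres_cong X R (v @ [(x, \<not> b), (x, b)] @ w) (v @ w)"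
    using v(1) by (auto intro: pres_cong.append pres_cong.refl)
  then have "pres_cong X R ((v @ [(x, \<not> b)]) @ a # w) []"
    using v(2) a by (auto intro: pres_cong.trans)
  moreover have "v @ [(x, \<not> b)] \<in> gwords X" using v x by (auto simp: gwords_def)
  ultimately show ?case by blast
qed

lemma group_presented_group: "group (presented_group X R)"
proof (rule groupI)
  let ?G = "presented_group X R"
  have car: "carrier ?G = pres_class X R ` gwords X" and one: "\<one>\<^bsub>?G\<^esub> = pres_class X R []"
    by (simp_all add: presented_group_def)
  have app: "u @ v \<in> gwords X" if "u \<in> gwords X" "v \<in> gwords X" for u v
    using that by (auto simp: gwords_def)
  have nil: "[] \<in> gwords X" by (simp add: gwords_def)
  show "x \<otimes>\<^bsub>?G\<^esub> y \<in> carrier ?G" if "x \<in> carrier ?G" "y \<in> carrier ?G" for x y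
    using that by (auto simp: car presented_group_mult app)
  show "\<one>\<^bsub>?G\<^esub> \<in> carrier ?G" by (auto simp: car one nil)
  show "x \<otimes>\<^bsub>?G\<^esub> y \<otimes>\<^bsub>?G\<^esub> z = x \<otimes>\<^bsub>?G\<^esub> (y \<otimes>\<^bsub>?G\<^esub> z)"
    if "x \<in> carrier ?G" "y \<in> carrier ?G" "z \<in> carrier ?G" for x y z
    using that by (auto simp: car presented_group_mult app)
  show "\<one>\<^bsub>?G\<^esub> \<otimes>\<^bsub>?G\<^esub> x = x" if "x \<in> carrier ?G" for x
    using that by (auto simp: car one presented_group_mult nil)
  show "\<exists>y\<in>carrier ?G. y \<otimes>\<^bsub>?G\<^esub> x = \<one>\<^bsub>?G\<^esub>" if x: "x \<in> carrier ?G" for x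
  proof -
    obtain w where w: "w \<in> gwords X" "x = pres_class X R w" using x car by auto
    obtain v where "v \<in> gwords X" "pres_cong X R (v @ w) []"
      using presented_group_left_inverse[OF w(1)] by blast
    then show ?thesis
      using w by (intro bexI[of _ "pres_class X R v"])
        (auto simp: car one presented_group_mult pres_class_eq_iff app)
  qed
qed

lemma group_artin_group: "group (artin_group V E lab)"
  unfolding artin_group_def by (rule group_presented_group)

end

theory Submission
  imports Defs "HOL-Algebra.Left_Coset" "HOL-Algebra.Bij" "HOL-Computational_Algebra.Polynomial"
begin

text \<open>
  If every two vertices are adjacent, then triangle-freeness leaves at most two vertices and the
  Coxeter group is finite; so there are non-adjacent vertices \<open>a\<close> and \<open>c\<close>.  Splitting the Artin group
  over the free group on the neighbours of \<open>a\<close> gives an amalgamated product whose edge groups are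
  isolated: \<open>g\<^sup>n \<in> C\<close> implies \<open>g \<in> C\<close>.  Isolation of all standard parabolic subgroups follows by
  induction on the number of vertices from the case of a star, which is an amalgam of dihedral
  groups over the cyclic group of its central vertex; at most one edge there has label 2, and the
  other ones force the free subgroup on the leaves to be isolated.

  Let \<open>S\<close> be a generating set in which the \<open>m\<close>-th powers commute pairwise.  In the action on the
  Bass--Serre tree, isolation forces the whole group to fix a vertex or an end, and in the latter
  case the standard generators, being elliptic, fix a common edge.  Both contradict the
  non-triviality of the splitting.  So some \<open>s\<^sup>m\<close> and \<open>t\<^sup>m\<close> do not commute and generate a free group of
  rank two; being a generating pair, they satisfy no positive relation, which bounds the growth
  rate from below in terms of \<open>m\<close> alone.

  All this takes place in a quotient of the Artin group, in which each dihedral Artin group is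
  replaced by its image in \<open>SL\<^sub>2(\<real>[x]) \<times> \<int>\<close>.
\<close>

text \<open>The hypothesis on \<open>S\<close> speaks about powers, and a power may fix much more of
  the tree than the element itself; isolation of the edge groups turns statements about
  \<open>s^m\<close> back into statements about \<open>s\<close>. Isolation of \<open>C\<close> in
  both factors is inherited by the factors inside the amalgam, so that only stars need a separate
  argument. There a product \<open>z b z'\<close>, with \<open>z\<close>, \<open>z'\<close> in the
  group of the centre and \<open>b \<noteq> 1\<close> in the group of a leaf, must leave the group
  of that leaf unless \<open>z = 1\<close>. For label 2 the two letters commute and this fails; one
  such leaf can be tolerated, in the factor from which the property is not demanded.

  Passing to a quotient is harmless because only non-commutation has to be shown there, and it
  lifts. The matrices alone send the central element \<open>(s t)^p\<close> of a dihedral Artin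
  group to plus or minus the identity; the factor Z, the exponent sum, keeps it of infinite order.

  The tree is never constructed: edges are left cosets, paths are reduced words, and geometric
  arguments become comparisons of prefixes of two reduced words for the same element.\<close>

no_notation (ASCII) subset_mset (infix "<#" 50)

subsection \<open>Amalgamated products\<close>

context group
begin

lemma inv_mult_cancel_left [simp]:
  "x \<in> carrier G \<Longrightarrow> y \<in> carrier G \<Longrightarrow> inv x \<otimes> (x \<otimes> y) = y"
  by (simp add: m_assoc [symmetric])

lemma mult_inv_cancel_left [simp]:
  "x \<in> carrier G \<Longrightarrow> y \<in> carrier G \<Longrightarrow> x \<otimes> (inv x \<otimes> y) = y"
  by (simp add: m_assoc [symmetric])

text \<open>In the action on left cosets, \<open>g\<close> fixes \<open>h <# H\<close> exactly if
  \<open>conj_by h g \<in> H\<close>. Being elliptic, i.e. fixing a vertex of the Bass--Serre tree,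
  is therefore expressed as \<open>conj_by h g \<in> P i\<close>.\<close>

definition conj_by :: "'a \<Rightarrow> 'a \<Rightarrow> 'a" where
  "conj_by h g = inv h \<otimes> g \<otimes> h"

lemma conj_by_closed [simp]:
  "h \<in> carrier G \<Longrightarrow> g \<in> carrier G \<Longrightarrow> conj_by h g \<in> carrier G"
  by (simp add: conj_by_def)

lemma conj_by_mult:
  assumes "h \<in> carrier G" "a \<in> carrier G" "b \<in> carrier G"
  shows "conj_by h (a \<otimes> b) = conj_by h a \<otimes> conj_by h b"
  using assms by (simp add: conj_by_def m_assoc)

lemma conj_by_inv:
  assumes "h \<in> carrier G" "a \<in> carrier G"
  shows "conj_by h (inv a) = inv (conj_by h a)"
  using assms by (simp add: conj_by_def m_assoc inv_mult_group)

lemma conj_by_pow: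
  assumes "h \<in> carrier G" "a \<in> carrier G"
  shows "conj_by h (a [^] (n::nat)) = conj_by h a [^] n"
proof (induction n)
  case 0
  show ?case using assms by (simp add: conj_by_def)
next
  case (Suc n)
  then show ?case using assms by (simp add: conj_by_mult)
qed

lemma conj_by_conj_by:
  assumes "h \<in> carrier G" "k \<in> carrier G" "a \<in> carrier G"
  shows "conj_by h (conj_by k a) = conj_by (k \<otimes> h) a"
  using assms by (simp add: conj_by_def m_assoc inv_mult_group)

lemma conj_by_one [simp]: "a \<in> carrier G \<Longrightarrow> conj_by \<one> a = a"
  by (simp add: conj_by_def)

lemma conj_by_inv_cancel:
  assumes "h \<in> carrier G" "a \<in> carrier G"
  shows "conj_by (inv h) (conj_by h a) = a" "conj_by h (conj_by (inv h) a) = a"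
  using assms by (simp_all add: conj_by_conj_by)

lemma conj_by_mem_subgroup:
  assumes "subgroup H G" "h \<in> H" "a \<in> H"
  shows "conj_by h a \<in> H"
  using assms by (simp add: conj_by_def subgroup.m_closed subgroup.m_inv_closed)

lemma subgroup_conj_by_vimage:
  assumes "subgroup H G" "h \<in> carrier G"
  shows "subgroup {g \<in> carrier G. conj_by h g \<in> H} G"
proof (rule subgroupI)
  show "{g \<in> carrier G. conj_by h g \<in> H} \<noteq> {}"
    using assms by (auto intro!: exI[of _ "\<one>"] simp: conj_by_def subgroup.one_closed)
qed (use assms in \<open>auto simp: conj_by_inv conj_by_mult subgroup.m_closed subgroup.m_inv_closed\<close>)

lemma conj_by_commute_pow:
  assumes "h \<in> carrier G" "a \<in> carrier G" "b \<in> carrier G"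
    and "a [^] (m::nat) \<otimes> b [^] m = b [^] m \<otimes> a [^] m"
  shows "conj_by h a [^] m \<otimes> conj_by h b [^] m = conj_by h b [^] m \<otimes> conj_by h a [^] m"
  using assms by (simp flip: conj_by_pow conj_by_mult)

text \<open>The ambient set \<open>K\<close> is a parameter because an edge group is at first known
  to be isolated only inside the two vertex groups.\<close>

definition isolated_in :: "'a set \<Rightarrow> 'a set \<Rightarrow> bool" where
  "isolated_in K H \<longleftrightarrow> (\<forall>g\<in>K. \<forall>n::nat. n \<ge> 1 \<longrightarrow> g [^] n \<in> H \<longrightarrow> g \<in> H)"

lemma isolated_inD:
  "isolated_in K H \<Longrightarrow> g \<in> K \<Longrightarrow> g [^] (n::nat) \<in> H \<Longrightarrow> n \<ge> 1 \<Longrightarrow> g \<in> H"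
  by (auto simp: isolated_in_def)

definition wprod :: "(bool \<times> 'a) list \<Rightarrow> 'a" where
  "wprod xs = foldr (\<lambda>x y. snd x \<otimes> y) xs \<one>"

lemma wprod_Nil [simp]: "wprod [] = \<one>"
  and wprod_Cons [simp]: "wprod (x # xs) = snd x \<otimes> wprod xs"
  by (simp_all add: wprod_def)

lemma wprod_closed [simp]: "snd ` set xs \<subseteq> carrier G \<Longrightarrow> wprod xs \<in> carrier G"
  by (induction xs) auto

lemma wprod_append:
  "snd ` set xs \<subseteq> carrier G \<Longrightarrow> snd ` set ys \<subseteq> carrier G \<Longrightarrow>
    wprod (xs @ ys) = wprod xs \<otimes> wprod ys"
  by (induction xs) (auto simp: m_assoc)

definition winv :: "(bool \<times> 'a) list \<Rightarrow> (bool \<times> 'a) list" where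
  "winv xs = rev (map (\<lambda>(i, x). (i, inv x)) xs)"

lemma winv_Nil [simp]: "winv [] = []"
  and winv_Cons: "winv (x # xs) = winv xs @ [(fst x, inv (snd x))]"
  and length_winv [simp]: "length (winv xs) = length xs"
  and winv_eq_Nil_iff [simp]: "winv xs = [] \<longleftrightarrow> xs = []"
  by (auto simp: winv_def case_prod_unfold)

lemma hd_winv: "xs \<noteq> [] \<Longrightarrow> fst (hd (winv xs)) = fst (last xs)"
  and last_winv: "xs \<noteq> [] \<Longrightarrow> fst (last (winv xs)) = fst (hd xs)"
  by (auto simp: winv_def hd_rev last_rev last_map hd_map case_prod_unfold)

lemma winv_carrier: "snd ` set xs \<subseteq> carrier G \<Longrightarrow> snd ` set (winv xs) \<subseteq> carrier G"
  by (auto simp: winv_def)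

lemma wprod_winv:
  "snd ` set xs \<subseteq> carrier G \<Longrightarrow> wprod (winv xs) = inv (wprod xs)"
  by (induction xs) (auto simp: winv_Cons wprod_append winv_carrier inv_mult_group)

text \<open>Kept independent of any amalgam: with \<open>C = {\<one>}\<close> the same words serve
  as normal forms for the subgroup generated by two subgroups that meet the edge group
  trivially.\<close>

definition reduced :: "(bool \<Rightarrow> 'a set) \<Rightarrow> 'a set \<Rightarrow> (bool \<times> 'a) list \<Rightarrow> bool" where
  "reduced P C xs \<longleftrightarrow>
     (\<forall>x\<in>set xs. snd x \<in> P (fst x) - C) \<and> successively (\<lambda>x y. fst x \<noteq> fst y) xs"

lemma reduced_Nil [simp]: "reduced P C []"
  by (simp add: reduced_def)

lemma reduced_Cons:
  "reduced P C (x # xs) \<longleftrightarrow>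
     snd x \<in> P (fst x) \<and> snd x \<notin> C \<and> reduced P C xs \<and> (xs \<noteq> [] \<longrightarrow> fst x \<noteq> fst (hd xs))"
  by (auto simp: reduced_def successively_Cons)

lemma reduced_append:
  "reduced P C (xs @ ys) \<longleftrightarrow> reduced P C xs \<and> reduced P C ys \<and>
     (xs \<noteq> [] \<longrightarrow> ys \<noteq> [] \<longrightarrow> fst (last xs) \<noteq> fst (hd ys))"
  by (auto simp: reduced_def successively_append_iff)

lemma reduced_carrier:
  assumes "\<And>i. P i \<subseteq> carrier G" "reduced P C xs"
  shows "snd ` set xs \<subseteq> carrier G"
  using assms by (force simp: reduced_def)

lemma reduced_winv:
  assumes "\<And>i. subgroup (P i) G" "subgroup C G" "reduced P C xs"
  shows "reduced P C (winv xs)"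
  using assms(3)
proof (induction xs)
  case (Cons x xs)
  have "snd x \<in> P (fst x)" "snd x \<notin> C" using Cons.prems by (auto simp: reduced_Cons)
  moreover from this have "inv (snd x) \<notin> C"
    using assms by (metis inv_inv subgroup.m_inv_closed subgroup.mem_carrier)
  ultimately show ?case
    using Cons assms(1)
    by (auto simp: winv_Cons reduced_append reduced_Cons last_winv subgroup.m_inv_closed)
qed simp

lemma reduced_mult_left:
  assumes P: "\<And>i. subgroup (P i) G" and C: "subgroup C G" and CP: "\<And>i. C \<subseteq> P i"
    and xs: "reduced P C xs" and c: "c \<in> C" and p: "p \<in> P i"
  shows "\<exists>ys d. reduced P C ys \<and> d \<in> C \<and> p \<otimes> (wprod xs \<otimes> c) = wprod ys \<otimes> d \<and>
           length ys \<le> Suc (length xs) \<and> (p \<in> C \<longrightarrow> length ys \<le> length xs)"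
  using xs p
proof (induction xs arbitrary: p i)
  case Nil
  have car: "p \<in> carrier G" "c \<in> carrier G"
    using Nil P C c by (auto intro: subgroup.mem_carrier)
  show ?case
  proof (cases "p \<in> C")
    case True
    then show ?thesis using c C car
      by (intro exI[of _ "[]"] exI[of _ "p \<otimes> c"]) (auto simp: subgroup.m_closed)
  next
    case False
    then show ?thesis using c C car Nil
      by (intro exI[of _ "[(i, p)]"] exI[of _ c]) (auto simp: reduced_Cons)
  qed
next
  case (Cons x xs)
  obtain j y where x: "x = (j, y)" by force
  have xs: "reduced P C xs" and y: "y \<in> P j" "y \<notin> C" and hd: "xs \<noteq> [] \<Longrightarrow> j \<noteq> fst (hd xs)"
    using Cons.prems x by (auto simp: reduced_Cons)
  have car: "p \<in> carrier G" "c \<in> carrier G" "y \<in> carrier G"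
    using Cons y P C c by (auto intro: subgroup.mem_carrier)
  have wc: "wprod xs \<in> carrier G"
    using reduced_carrier[OF _ xs] P by (metis subgroup.subset wprod_closed)
  show ?case
  proof (cases "p \<in> P j")
    case pj: True
    show ?thesis
    proof (cases "p \<otimes> y \<in> C")
      case True
      have pC: "p \<notin> C"
      proof
        assume "p \<in> C"
        then have "inv p \<otimes> (p \<otimes> y) \<in> C"
          using True C by (meson subgroup.m_closed subgroup.m_inv_closed)
        then show False using y car by simp
      qed
      obtain ys d where ys: "reduced P C ys" "d \<in> C"
          "(p \<otimes> y) \<otimes> (wprod xs \<otimes> c) = wprod ys \<otimes> d" "length ys \<le> length xs"
        using Cons.IH[OF xs, of "p \<otimes> y" True] True CP by blast
      then show ?thesis using car wc pC x
        by (intro exI[of _ ys] exI[of _ d]) (auto simp: m_assoc)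
    next
      case False
      then show ?thesis using car wc x xs pj y hd P
        by (intro exI[of _ "(j, p \<otimes> y) # xs"] exI[of _ c])
          (auto simp: m_assoc reduced_Cons subgroup.m_closed[OF P] c)
    qed
  next
    case False
    have "i \<noteq> j"
    proof
      assume ij: "i = j"
      show False using Cons.prems(2) False unfolding ij by contradiction
    qed
    have "p \<notin> C" using False CP by blast
    then show ?thesis using car wc x xs y hd Cons.prems \<open>i \<noteq> j\<close>
      by (intro exI[of _ "(i, p) # x # xs"] exI[of _ c])
        (auto simp: m_assoc reduced_Cons c)
  qed
qed

lemma reduced_decomposition:
  assumes P: "\<And>i. subgroup (P i) G" and C: "subgroup C G" and CP: "\<And>i. C \<subseteq> P i"
    and g: "g \<in> generate G (P True \<union> P False)"
  obtains xs c where "reduced P C xs" "c \<in> C" "g = wprod xs \<otimes> c"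
proof -
  have Pc: "P i \<subseteq> carrier G" for i using P by (simp add: subgroup.subset)
  have "\<exists>xs c. reduced P C xs \<and> c \<in> C \<and> g \<otimes> u = wprod xs \<otimes> c"
    if "\<exists>xs c. reduced P C xs \<and> c \<in> C \<and> u = wprod xs \<otimes> c" "u \<in> carrier G" for u
    using g that
  proof (induction g arbitrary: u rule: generate.induct)
    case one
    then show ?case by simp
  next
    case (incl h)
    then obtain i where "h \<in> P i" by blast
    then show ?case using reduced_mult_left[of P C, OF P C CP] incl by blast
  next
    case (inv h)
    then obtain i where "h \<in> P i" by blast
    then have "inv h \<in> P i" using P by (simp add: subgroup.m_inv_closed)
    then show ?case using reduced_mult_left[of P C, OF P C CP] inv by blast
  next
    case (eng h1 h2)
    have h: "h1 \<in> carrier G" "h2 \<in> carrier G"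
      using eng(1,2) generate_in_carrier[of "P True \<union> P False"] Pc by (meson Un_least)+
    have "h2 \<otimes> u \<in> carrier G" using h eng by simp
    then show ?case using eng.IH(1)[OF eng.IH(2)[OF eng.prems]] h eng.prems by (simp add: m_assoc)
  qed
  moreover have "\<exists>xs c. reduced P C xs \<and> c \<in> C \<and> \<one> = wprod xs \<otimes> c"
    using C by (intro exI[of _ "[]"] exI[of _ "\<one>"]) (simp add: subgroup.one_closed)
  ultimately have "\<exists>xs c. reduced P C xs \<and> c \<in> C \<and> g \<otimes> \<one> = wprod xs \<otimes> c"
    by blast
  moreover have "g \<in> carrier G"
    using g generate_in_carrier[of "P True \<union> P False"] Pc by (meson Un_least)
  ultimately show ?thesis using that by auto
qed

end

text \<open>Taking the normal form theorem as an axiom separates the geometry of amalgams from their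
  construction, which is done once for presentations in \<open>amalgam_presented\<close>. That the
  factors meet exactly in \<open>C\<close> is a consequence (\<open>P_inter\<close>).\<close>

locale amalgam = group G for G (structure) +
  fixes P :: "bool \<Rightarrow> 'a set" and C :: "'a set"
  assumes P_subgroup: "\<And>i. subgroup (P i) G"
    and C_subgroup: "subgroup C G"
    and C_sub: "\<And>i. C \<subseteq> P i"
    and gen: "generate G (P True \<union> P False) = carrier G"
    and normal_form: "\<And>xs. reduced P C xs \<Longrightarrow> xs \<noteq> [] \<Longrightarrow> wprod xs \<noteq> \<one>"
begin

abbreviation "red \<equiv> reduced P C"

lemma P_carrier [simp]: "x \<in> P i \<Longrightarrow> x \<in> carrier G"
  using P_subgroup by (rule subgroup.mem_carrier)

lemma C_carrier [simp]: "x \<in> C \<Longrightarrow> x \<in> carrier G"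
  using C_subgroup by (rule subgroup.mem_carrier)

lemma C_P: "x \<in> C \<Longrightarrow> x \<in> P i"
  using C_sub by blast

lemmas P_mult [intro] = subgroup.m_closed[OF P_subgroup]
  and P_inv [intro] = subgroup.m_inv_closed[OF P_subgroup]
  and C_mult [simp, intro] = subgroup.m_closed[OF C_subgroup]
  and C_inv [simp, intro] = subgroup.m_inv_closed[OF C_subgroup]
  and C_one [simp, intro] = subgroup.one_closed[OF C_subgroup]
  and P_one [intro] = subgroup.one_closed[OF P_subgroup]

lemma P_pow [intro]: "x \<in> P i \<Longrightarrow> x [^] (n::nat) \<in> P i"
  by (induction n) auto

lemma C_pow [simp, intro]: "x \<in> C \<Longrightarrow> x [^] (n::nat) \<in> C"
  by (induction n) auto

lemma C_inv_iff [simp]: "x \<in> carrier G \<Longrightarrow> inv x \<in> C \<longleftrightarrow> x \<in> C"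
  by (metis C_inv inv_inv)

lemma C_mult_left_iff [simp]:
  assumes "c \<in> C" "x \<in> carrier G" shows "c \<otimes> x \<in> C \<longleftrightarrow> x \<in> C"
proof
  assume "c \<otimes> x \<in> C"
  then have "inv c \<otimes> (c \<otimes> x) \<in> C" using assms by blast
  then show "x \<in> C" using assms by simp
qed (use assms in blast)

lemma C_mult_right_iff [simp]:
  assumes "c \<in> C" "x \<in> carrier G" shows "x \<otimes> c \<in> C \<longleftrightarrow> x \<in> C"
proof
  assume "x \<otimes> c \<in> C"
  then have "x \<otimes> c \<otimes> inv c \<in> C" using assms by blast
  then show "x \<in> C" using assms by (simp add: m_assoc)
qed (use assms in blast)

lemma red_carrier: "red xs \<Longrightarrow> snd ` set xs \<subseteq> carrier G"
  using reduced_carrier P_subgroup by (metis subgroup.subset)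

lemma wprod_red [simp]: "red xs \<Longrightarrow> wprod xs \<in> carrier G"
  using red_carrier wprod_closed by blast

lemma wprod_red_append: "red xs \<Longrightarrow> red ys \<Longrightarrow> wprod (xs @ ys) = wprod xs \<otimes> wprod ys"
  using red_carrier wprod_append by blast

lemma red_winv: "red xs \<Longrightarrow> red (winv xs)"
  using reduced_winv P_subgroup C_subgroup by blast

lemma wprod_red_winv: "red xs \<Longrightarrow> wprod (winv xs) = inv (wprod xs)"
  using wprod_winv red_carrier by blast

lemma red_absorb_left:
  assumes "red ((i, x) # xs)" "c \<in> C"
  shows "red ((i, c \<otimes> x) # xs)" "wprod ((i, c \<otimes> x) # xs) = c \<otimes> wprod ((i, x) # xs)"
  using assms P_mult[OF C_P[OF assms(2)], of x i] by (auto simp: reduced_Cons m_assoc)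

lemma red_absorb_right:
  assumes "red (xs @ [(i, x)])" "c \<in> C"
  shows "red (xs @ [(i, x \<otimes> c)])" "wprod (xs @ [(i, x \<otimes> c)]) = wprod (xs @ [(i, x)]) \<otimes> c"
proof -
  have *: "red xs" "red [(i, x)]" "red [(i, x \<otimes> c)]" "x \<in> carrier G"
    using assms P_mult[OF _ C_P[OF assms(2)], of x i] by (auto simp: reduced_Cons reduced_append)
  then show "red (xs @ [(i, x \<otimes> c)])" using assms by (auto simp: reduced_append)
  show "wprod (xs @ [(i, x \<otimes> c)]) = wprod (xs @ [(i, x)]) \<otimes> c"
    using * assms(2) by (simp add: wprod_red_append m_assoc)
qed

lemma wprod_red_notin_C:
  assumes "red xs" "xs \<noteq> []"
  shows "wprod xs \<notin> C"
proof
  assume c: "wprod xs \<in> C"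
  obtain i x xs' where xs: "xs = (i, x) # xs'"
    using assms(2) by (metis list.exhaust surj_pair)
  have "wprod ((i, inv (wprod xs) \<otimes> x) # xs') = inv (wprod xs) \<otimes> wprod xs"
    and "red ((i, inv (wprod xs) \<otimes> x) # xs')"
    using red_absorb_left[of i x xs' "inv (wprod xs)"] assms c xs by auto
  then show False using normal_form[of "(i, inv (wprod xs) \<otimes> x) # xs'"] c by simp
qed

lemma P_inter: "P True \<inter> P False = C"
proof
  show "P True \<inter> P False \<subseteq> C"
  proof
    fix x assume x: "x \<in> P True \<inter> P False"
    show "x \<in> C"
    proof (rule ccontr)
      assume "x \<notin> C"
      then have "red [(True, x), (False, inv x)]" using x by (auto simp: reduced_Cons)
      from normal_form[OF this] show False using x by auto
    qed
  qed
qed (use C_sub in blast)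

lemma mem_P_notI: "x \<in> P i \<Longrightarrow> x \<in> P (\<not> i) \<Longrightarrow> x \<in> C"
  using P_inter by (cases i) auto

text \<open>If the first syllables \<open>x\<close> and \<open>y\<close> lay in different factors,
  or in one factor with \<open>inv y \<otimes> c \<otimes> x \<notin> C\<close>, then joining the
  inverse of the one word to the other would give a reduced word with product in \<open>C\<close>.
  So \<open>inv y \<otimes> c \<otimes> x \<in> C\<close>, and it takes the place of
  \<open>c\<close> for the tails. Geometrically, the two paths run through the same edges, the
  cosets of the prefixes.\<close>

lemma red_unique_aux:
  assumes "red xs" "red ys" "c \<in> C" "d \<in> C" "c \<otimes> wprod xs = wprod ys \<otimes> d"
  shows "map fst xs = map fst ys \<and>
     (\<forall>k. \<exists>e\<in>C. c \<otimes> wprod (take k xs) = wprod (take k ys) \<otimes> e)"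
  using assms
proof (induction xs arbitrary: ys c)
  case Nil
  have "ys = []"
  proof (rule ccontr)
    assume "ys \<noteq> []"
    then have "wprod ys \<notin> C" using wprod_red_notin_C Nil by blast
    then show False using Nil.prems by (metis C_carrier C_mult_right_iff r_one wprod_Nil wprod_red)
  qed
  then show ?case using Nil by (auto intro!: bexI[of _ c])
next
  case (Cons a xs)
  obtain i x where a: "a = (i, x)" by force
  have xs: "red xs" and x: "x \<in> P i" "x \<notin> C" and hd: "xs \<noteq> [] \<Longrightarrow> i \<noteq> fst (hd xs)"
    using Cons.prems(1) a by (auto simp: reduced_Cons)
  have "ys \<noteq> []"
  proof
    assume "ys = []"
    then have "c \<otimes> wprod (a # xs) \<in> C" using Cons.prems by simp
    then show False
      using Cons.prems(1,3) wprod_red_notin_C[of "a # xs"] C_mult_left_iff[of c "wprod (a # xs)"]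
        wprod_red[of "a # xs"] by simp
  qed
  then obtain j y ys' where ys: "ys = (j, y) # ys'" by (metis list.exhaust surj_pair)
  have ys': "red ys'" and y: "y \<in> P j" "y \<notin> C" and hd': "ys' \<noteq> [] \<Longrightarrow> j \<noteq> fst (hd ys')"
    using Cons.prems(2) ys by (auto simp: reduced_Cons)
  have car: "x \<in> carrier G" "y \<in> carrier G" "c \<in> carrier G" "d \<in> carrier G"
      "wprod xs \<in> carrier G" "wprod ys' \<in> carrier G"
    using x y Cons.prems(3,4) xs ys' by simp_all
  have eq: "c \<otimes> (x \<otimes> wprod xs) = (y \<otimes> wprod ys') \<otimes> d"
    using Cons.prems ys a by simp
  have iy: "(inv y \<otimes> c \<otimes> x) \<otimes> wprod xs = wprod ys' \<otimes> d"
  proof -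
    have "inv y \<otimes> (c \<otimes> (x \<otimes> wprod xs)) = inv y \<otimes> ((y \<otimes> wprod ys') \<otimes> d)" using eq by simp
    then show ?thesis using car by (simp add: m_assoc)
  qed
  have ij: "i = j"
  proof (rule ccontr)
    assume "i \<noteq> j"
    have r: "red (winv ys @ (i, c \<otimes> x) # xs)"
      using Cons.prems red_winv[of ys] red_absorb_left(1)[of i x xs c] a ys \<open>i \<noteq> j\<close>
      by (auto simp: reduced_append last_winv)
    have rx: "red ((i, c \<otimes> x) # xs)" using red_absorb_left(1) Cons.prems a by blast
    have "wprod (winv ys @ (i, c \<otimes> x) # xs) = inv (wprod ys) \<otimes> (c \<otimes> (x \<otimes> wprod xs))"
      using wprod_red_append[OF red_winv[OF Cons.prems(2)] rx] wprod_red_winv[OF Cons.prems(2)] car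
      by (simp add: m_assoc)
    also have "\<dots> = d" using eq car ys by (simp add: m_assoc inv_mult_group)
    finally show False using wprod_red_notin_C[OF r] Cons.prems by simp
  qed
  have e: "inv y \<otimes> c \<otimes> x \<in> C"
  proof (rule ccontr)
    assume nC: "inv y \<otimes> c \<otimes> x \<notin> C"
    have rx: "red ((i, inv y \<otimes> c \<otimes> x) # xs)"
      using nC xs x y hd ij C_P[OF Cons.prems(3)] by (auto simp: reduced_Cons)
    have r: "red (winv ys' @ (i, inv y \<otimes> c \<otimes> x) # xs)"
      using rx red_winv[OF ys'] hd' ij by (auto simp: reduced_append last_winv)
    have "wprod (winv ys' @ (i, inv y \<otimes> c \<otimes> x) # xs)
        = inv (wprod ys') \<otimes> ((inv y \<otimes> c \<otimes> x) \<otimes> wprod xs)"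
      using wprod_red_append[OF red_winv[OF ys'] rx] wprod_red_winv[OF ys'] by simp
    also have "\<dots> = d" using iy car by simp
    finally show False using wprod_red_notin_C[OF r] Cons.prems by simp
  qed
  have IH: "map fst xs = map fst ys' \<and>
     (\<forall>k. \<exists>f\<in>C. (inv y \<otimes> c \<otimes> x) \<otimes> wprod (take k xs) = wprod (take k ys') \<otimes> f)"
    using Cons.IH[OF xs ys' e Cons.prems(4) iy] .
  have "\<exists>f\<in>C. c \<otimes> wprod (take k (a # xs)) = wprod (take k ys) \<otimes> f" for k
  proof (cases k)
    case 0
    then show ?thesis using Cons.prems by (auto intro!: bexI[of _ c])
  next
    case (Suc k')
    obtain f where f: "f \<in> C" "(inv y \<otimes> c \<otimes> x) \<otimes> wprod (take k' xs) = wprod (take k' ys') \<otimes> f"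
      using IH by blast
    have tc: "wprod (take k' xs) \<in> carrier G" "wprod (take k' ys') \<in> carrier G"
      using red_carrier[OF xs] red_carrier[OF ys'] set_take_subset
      by (meson image_mono order_trans wprod_closed)+
    have "y \<otimes> ((inv y \<otimes> c \<otimes> x) \<otimes> wprod (take k' xs)) = y \<otimes> (wprod (take k' ys') \<otimes> f)"
      using f by simp
    then have "c \<otimes> (x \<otimes> wprod (take k' xs)) = y \<otimes> wprod (take k' ys') \<otimes> f"
      using car tc f(1) by (simp add: m_assoc)
    then show ?thesis using f(1) Suc a ys by auto
  qed
  then show ?case using IH a ys ij by auto
qed

lemma red_unique_types:
  assumes "red xs" "red ys" "c \<in> C" "d \<in> C" "c \<otimes> wprod xs = wprod ys \<otimes> d"
  shows "map fst xs = map fst ys"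
  using red_unique_aux[OF assms] by blast

lemma red_unique_prefix:
  assumes "red xs" "red ys" "c \<in> C" "d \<in> C" "c \<otimes> wprod xs = wprod ys \<otimes> d"
  obtains e where "e \<in> C" "c \<otimes> wprod (take k xs) = wprod (take k ys) \<otimes> e"
  using red_unique_aux[OF assms] by blast

lemma red_unique_length:
  assumes "red xs" "red ys" "c \<in> C" "d \<in> C" "c \<otimes> wprod xs = wprod ys \<otimes> d"
  shows "length xs = length ys"
  using red_unique_types[OF assms] by (metis length_map)

lemma red_exists:
  assumes "g \<in> carrier G"
  obtains xs c where "red xs" "c \<in> C" "g = wprod xs \<otimes> c"
  using reduced_decomposition[of P C g, OF P_subgroup C_subgroup C_sub] assms gen by blast

lemma red_exists':
  assumes "g \<in> carrier G" "g \<notin> C"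
  obtains xs where "red xs" "xs \<noteq> []" "g = wprod xs"
proof -
  obtain xs c where xs: "red xs" "c \<in> C" "g = wprod xs \<otimes> c"
    using red_exists[of g] assms by metis
  then have "xs \<noteq> []" using assms by auto
  then obtain zs i x where "xs = zs @ [(i, x)]" by (metis append_butlast_last_id surj_pair)
  then show ?thesis using that red_absorb_right[of zs i x c] xs by auto
qed

text \<open>The distance in the Bass--Serre tree between the midpoints of the edges \<open>C\<close>
  and \<open>g <# C\<close>.\<close>

definition len :: "'a \<Rightarrow> nat" where
  "len g = (THE n. \<exists>xs c. red xs \<and> c \<in> C \<and> g = wprod xs \<otimes> c \<and> n = length xs)"

lemma len_eq:
  assumes "red xs" "c \<in> C" "g = wprod xs \<otimes> c"
  shows "len g = length xs"
  unfolding len_def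
proof (rule the_equality)
  fix n assume "\<exists>ys d. red ys \<and> d \<in> C \<and> g = wprod ys \<otimes> d \<and> n = length ys"
  then obtain ys d where ys: "red ys" "d \<in> C" "g = wprod ys \<otimes> d" "n = length ys" by blast
  have "\<one> \<otimes> wprod ys = wprod xs \<otimes> (c \<otimes> inv d)"
  proof -
    have "wprod ys = (wprod ys \<otimes> d) \<otimes> inv d" using ys by (simp add: m_assoc)
    also have "\<dots> = (wprod xs \<otimes> c) \<otimes> inv d" using assms ys by simp
    finally show ?thesis using assms ys by (simp add: m_assoc)
  qed
  then show "n = length xs" using red_unique_length[of ys xs \<one> "c \<otimes> inv d"] ys assms by auto
qed (use assms in blast)

lemma len_wprod: "red xs \<Longrightarrow> len (wprod xs) = length xs"
  by (rule len_eq[of xs \<one>]) auto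

lemma len_C: "c \<in> C \<Longrightarrow> len c = 0"
  by (subst len_eq[of "[]" c]) auto

lemma len_P_mult:
  assumes "p \<in> P i" "g \<in> carrier G"
  shows "len (p \<otimes> g) \<le> Suc (len g)"
proof -
  obtain xs c where xs: "red xs" "c \<in> C" "g = wprod xs \<otimes> c"
    using red_exists[of g] assms by metis
  obtain ys d where ys: "red ys" "d \<in> C" "p \<otimes> (wprod xs \<otimes> c) = wprod ys \<otimes> d"
      "length ys \<le> Suc (length xs)"
    using reduced_mult_left[of P C, OF P_subgroup C_subgroup C_sub xs(1,2) assms(1)] by blast
  show ?thesis using len_eq[OF xs] len_eq[OF ys(1,2)] ys xs by simp
qed

lemma len_P: "p \<in> P i \<Longrightarrow> len p \<le> 1"
  using len_P_mult[of p i \<one>] by (simp add: len_C)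

lemma len_mult_C:
  assumes "g \<in> carrier G" "c \<in> C"
  shows "len (g \<otimes> c) = len g"
proof -
  obtain xs d where xs: "red xs" "d \<in> C" "g = wprod xs \<otimes> d"
    using red_exists[of g] assms by metis
  then have "g \<otimes> c = wprod xs \<otimes> (d \<otimes> c)" using assms by (simp add: m_assoc)
  then show ?thesis using len_eq[OF xs] len_eq[of xs "d \<otimes> c"] xs assms by auto
qed

lemma len_wprod_mult:
  assumes "red xs" "g \<in> carrier G"
  shows "len (wprod xs \<otimes> g) \<le> length xs + len g"
  using assms(1)
proof (induction xs)
  case Nil
  then show ?case using assms by simp
next
  case (Cons x xs)
  then have r: "red xs" "snd x \<in> P (fst x)" by (auto simp: reduced_Cons)
  have "len (snd x \<otimes> (wprod xs \<otimes> g)) \<le> Suc (len (wprod xs \<otimes> g))"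
    using len_P_mult r assms by simp
  then show ?case using Cons.IH r assms by (simp add: m_assoc P_carrier[OF r(2)])
qed

lemma len_mult:
  assumes "h \<in> carrier G" "g \<in> carrier G"
  shows "len (h \<otimes> g) \<le> len h + len g"
proof -
  obtain xs c where xs: "red xs" "c \<in> C" "h = wprod xs \<otimes> c"
    using red_exists[of h] assms by metis
  have "len (c \<otimes> g) \<le> len g"
  proof -
    obtain ys d where ys: "red ys" "d \<in> C" "g = wprod ys \<otimes> d"
      using red_exists[of g] assms by metis
    obtain zs e where "red zs" "e \<in> C" "c \<otimes> (wprod ys \<otimes> d) = wprod zs \<otimes> e"
      "length zs \<le> length ys"
      using reduced_mult_left[of P C, OF P_subgroup C_subgroup C_sub ys(1,2), of c True] C_P[OF xs(2)] xs(2)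
      by blast
    then show ?thesis using len_eq ys by metis
  qed
  then have "len (wprod xs \<otimes> (c \<otimes> g)) \<le> length xs + len g"
    using len_wprod_mult[OF xs(1), of "c \<otimes> g"] assms xs(2) by fastforce
  then show ?thesis using len_eq[OF xs] xs assms by (simp add: m_assoc)
qed

end

section \<open>Periodic words; elliptic and hyperbolic elements\<close>

definition wpow :: "nat \<Rightarrow> 'b list \<Rightarrow> 'b list" where
  "wpow k xs = concat (replicate k xs)"

lemma wpow_0 [simp]: "wpow 0 xs = []"
  and wpow_Suc [simp]: "wpow (Suc k) xs = xs @ wpow k xs"
  by (simp_all add: wpow_def)

lemma length_wpow [simp]: "length (wpow k xs) = k * length xs"
  by (induction k) auto

lemma wpow_add: "wpow (k + l) xs = wpow k xs @ wpow l xs"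
  by (induction k) auto

lemma hd_wpow: "k \<ge> 1 \<Longrightarrow> xs \<noteq> [] \<Longrightarrow> hd (wpow k xs) = hd xs"
  by (cases k) auto

lemma wpow_eq_Nil: "wpow k xs = [] \<longleftrightarrow> k = 0 \<or> xs = []"
  by (induction k) auto

lemma last_wpow: "k \<ge> 1 \<Longrightarrow> xs \<noteq> [] \<Longrightarrow> last (wpow k xs) = last xs"
  by (induction k) (auto simp: wpow_eq_Nil last_append Suc_le_eq)

lemma take_wpow_le:
  assumes "i \<le> k * length xs" "k \<le> l"
  shows "take i (wpow l xs) = take i (wpow k xs)"
  using wpow_add[of k "l - k" xs] assms by simp

lemma take_wpow_eq:
  assumes "i \<le> k * length xs" "i \<le> l * length xs"
  shows "take i (wpow l xs) = take i (wpow k xs)"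
  using take_wpow_le[OF assms(1), of l] take_wpow_le[OF assms(2), of k] by (cases "k \<le> l") auto

lemma (in group) commute_inv:
  assumes "x \<in> carrier G" "y \<in> carrier G" "x \<otimes> y = y \<otimes> x"
  shows "inv x \<otimes> y = y \<otimes> inv x"
proof -
  have "inv x \<otimes> y = inv x \<otimes> (y \<otimes> x) \<otimes> inv x" using assms by (simp add: m_assoc)
  also have "\<dots> = inv x \<otimes> (x \<otimes> y) \<otimes> inv x" using assms by simp
  finally show ?thesis using assms(1,2) by simp
qed

context amalgam
begin

definition cyclically_red :: "(bool \<times> 'a) list \<Rightarrow> bool" where
  "cyclically_red xs \<longleftrightarrow> red xs \<and> xs \<noteq> [] \<and> fst (hd xs) \<noteq> fst (last xs)"

lemma cyclically_redD:
  assumes "cyclically_red xs"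
  shows "red xs" "xs \<noteq> []" "fst (last xs) \<longleftrightarrow> \<not> fst (hd xs)" "length xs \<ge> 1"
  using assms by (auto simp: cyclically_red_def Suc_le_eq)

lemma red_wpow: "cyclically_red xs \<Longrightarrow> red (wpow k xs)"
proof (induction k)
  case (Suc k)
  then show ?case using cyclically_redD[OF Suc.prems] hd_wpow[of k xs]
    by (cases k) (auto simp: reduced_append)
qed simp

lemma wprod_wpow:
  assumes "cyclically_red xs" shows "wprod (wpow k xs) = wprod xs [^] k"
proof (induction k)
  case (Suc k)
  have "wprod (wpow (Suc k) xs) = wprod xs \<otimes> wprod xs [^] k"
    using Suc assms cyclically_redD[OF assms] red_wpow[OF assms, of k]
    by (simp add: wprod_red_append)
  then show ?case using cyclically_redD(1)[OF assms] nat_pow_Suc2[of "wprod xs" k] by (metis wprod_red)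
qed simp

lemma cyclically_red_winv:
  "cyclically_red xs \<Longrightarrow> cyclically_red (winv xs)"
  using red_winv by (auto simp: cyclically_red_def hd_winv last_winv)

lemma cyclically_red_wpow:
  "cyclically_red xs \<Longrightarrow> k \<ge> 1 \<Longrightarrow> cyclically_red (wpow k xs)"
  using red_wpow[of xs k] by (auto simp: cyclically_red_def hd_wpow last_wpow wpow_eq_Nil)

text \<open>Cyclic reduction by conjugating with the first syllable, which moves to the end and
  merges with the last one. If the merged syllable lies in \<open>C\<close>, it is absorbed and the
  word gets shorter; otherwise the new word is already cyclically reduced.\<close>

lemma elliptic_or_hyperbolic:
  assumes "g \<in> carrier G"
  shows "(\<exists>h\<in>carrier G. \<exists>i. conj_by h g \<in> P i) \<or>
         (\<exists>h\<in>carrier G. \<exists>xs. cyclically_red xs \<and> conj_by h g = wprod xs)"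
proof (cases "g \<in> C")
  case True
  then have "conj_by \<one> g \<in> P True" using C_P by simp
  then show ?thesis by blast
next
  case False
  then obtain xs where "red xs" "xs \<noteq> []" "g = wprod xs" using red_exists'[of g] assms by metis
  then show ?thesis
  proof (induction "length xs" arbitrary: xs g rule: less_induct)
    case less
    have gc: "g \<in> carrier G" using less by simp
    show ?case
    proof (cases "fst (hd xs) = fst (last xs)")
      case False
      then have "cyclically_red xs" using less by (simp add: cyclically_red_def)
      then show ?thesis using less gc by (intro disjI2 bexI[of _ \<one>]) auto
    next
      case eq: True
      obtain i x tl where xs: "xs = (i, x) # tl" using less(3) by (metis list.exhaust surj_pair)
      have x: "x \<in> P i" using less xs by (auto simp: reduced_Cons)
      show ?thesis
      proof (cases "tl = []")
        case True
        then have "conj_by \<one> g \<in> P i" using less xs x by simp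
        then show ?thesis by blast
      next
        case False
        then obtain mid j y where tl: "tl = mid @ [(j, y)]"
          by (metis append_butlast_last_id surj_pair)
        have ji: "j = i" using eq xs tl by simp
        have r: "red (mid @ [(i, y)])" using less xs tl ji by (simp add: reduced_Cons)
        then have rm: "red mid" and y: "y \<in> P i" by (auto simp: reduced_append reduced_Cons)
        have mid: "mid \<noteq> []"
        proof
          assume "mid = []"
          then have "red [(i, x), (i, y)]" using less xs tl ji by simp
          then show False by (simp add: reduced_Cons)
        qed
        have hdm: "fst (hd mid) \<noteq> i" and lastm: "fst (last mid) \<noteq> i"
          using less(2) xs tl ji mid r by (auto simp: reduced_Cons reduced_append)
        have car: "x \<in> carrier G" "y \<in> carrier G" "wprod mid \<in> carrier G" using x y rm by auto
        have yx: "y \<otimes> x \<in> P i" using x y by blast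
        have wy: "wprod (mid @ [(i, y)]) = wprod mid \<otimes> y"
          using wprod_append[of mid "[(i,y)]"] red_carrier[OF rm] car by simp
        have cj: "conj_by x g = wprod mid \<otimes> (y \<otimes> x)"
          using less(4) xs tl ji wy car by (simp add: conj_by_def m_assoc)
        show ?thesis
        proof (cases "y \<otimes> x \<in> C")
          case True
          obtain mid' l z where m: "mid = mid' @ [(l, z)]"
            using mid by (metis append_butlast_last_id surj_pair)
          let ?ys = "mid' @ [(l, z \<otimes> (y \<otimes> x))]"
          have ys: "red ?ys" "wprod ?ys = conj_by x g"
            using red_absorb_right[of mid' l z "y \<otimes> x"] rm m True cj by auto
          have "(\<exists>h\<in>carrier G. \<exists>i. conj_by h (conj_by x g) \<in> P i) \<or>
            (\<exists>h\<in>carrier G. \<exists>xs. cyclically_red xs \<and> conj_by h (conj_by x g) = wprod xs)"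
            using less(1)[of ?ys "conj_by x g"] ys xs tl m by simp
          then show ?thesis using car gc by (metis conj_by_conj_by m_closed)
        next
          case False
          let ?ys = "mid @ [(i, y \<otimes> x)]"
          have "red ?ys" using rm lastm False yx by (auto simp: reduced_append reduced_Cons)
          then have "cyclically_red ?ys" using hdm mid by (auto simp: cyclically_red_def)
          moreover have "wprod ?ys = conj_by x g"
            using cj wprod_append[of mid "[(i, y \<otimes> x)]"] red_carrier[OF rm] car by simp
          ultimately show ?thesis using car(1) by metis
        qed
      qed
    qed
  qed
qed

lemma hyperbolic_not_elliptic:
  assumes "cyclically_red xs" "h \<in> carrier G" "n \<ge> 1"
  shows "conj_by h (wprod xs [^] (n::nat)) \<notin> P i"
proof
  assume p: "conj_by h (wprod xs [^] n) \<in> P i"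
  \<comment> \<open>An element \<open>h \<otimes> q \<otimes> inv h\<close> with
    \<open>q \<in> P i\<close> has length at most \<open>len h + 1 + len (inv h)\<close>.
    \<open>N\<close> exceeds this by one, while \<open>g [^] N\<close> has length at least
    \<open>N\<close>.\<close>
  define N where "N = len h + len (inv h) + 2"
  define g where "g = wprod xs [^] n"
  have gc: "g \<in> carrier G" using cyclically_redD[OF assms(1)] by (simp add: g_def)
  define q where "q = conj_by h (g [^] N)"
  have q: "q \<in> P i"
    using p gc assms(2) by (auto simp: q_def conj_by_pow g_def)
  have "g [^] N = h \<otimes> (q \<otimes> inv h)"
    using assms gc by (simp add: q_def conj_by_def m_assoc)
  then have "len (g [^] N) \<le> len h + Suc (len (inv h))"
    using len_mult[of h "q \<otimes> inv h"] len_P_mult[OF q, of "inv h"] assms q by simp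
  moreover have "g [^] N = wprod (wpow (n * N) xs)"
    using wprod_wpow[OF assms(1)] cyclically_redD[OF assms(1)] by (simp add: g_def nat_pow_pow)
  then have "len (g [^] N) = n * N * length xs"
    using len_wprod red_wpow[OF assms(1)] by simp
  moreover have "n * N * length xs \<ge> N"
    using assms(3) cyclically_redD(4)[OF assms(1)] 
      mult_le_mono[of 1 n N N] mult_le_mono[of N "n * N" 1 "length xs"] by simp
  ultimately show False by (simp add: N_def)
qed

section \<open>Isolation of vertex and edge groups in the amalgam\<close>

lemma wprod_snoc:
  assumes "red (hs @ [(l, x)])"
  shows "wprod (hs @ [(l, x)]) = wprod hs \<otimes> x" "red hs" "x \<in> P l" "x \<notin> C"
  using assms wprod_red_append[of hs "[(l, x)]"] by (auto simp: reduced_append reduced_Cons)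

lemma conj_by_inv_snoc:
  assumes "red (hs @ [(l, x)])" "r \<in> carrier G"
  shows "conj_by (inv (wprod (hs @ [(l, x)]))) r = conj_by (inv (wprod hs)) (conj_by (inv x) r)"
  using wprod_snoc[OF assms(1)] assms(2) by (simp add: conj_by_conj_by inv_mult_group)

text \<open>The path \<open>hs\<close> to a vertex fixed by the conjugate, a turn by
  \<open>r\<close> there, and the way back; nothing cancels because
  \<open>r \<notin> C\<close>.\<close>

lemma red_conjugate:
  assumes hs: "red hs" "hs \<noteq> [] \<Longrightarrow> fst (last hs) \<noteq> j" and r: "r \<in> P j" "r \<notin> C"
  shows "red (hs @ [(j, r)] @ winv hs)"
    and "wprod (hs @ [(j, r)] @ winv hs) = conj_by (inv (wprod hs)) r"
proof -
  have "red ((j, r) # winv hs)"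
    using red_winv[OF hs(1)] hs(2) r by (auto simp: reduced_Cons hd_winv)
  then show "red (hs @ [(j, r)] @ winv hs)"
    and "wprod (hs @ [(j, r)] @ winv hs) = conj_by (inv (wprod hs)) r"
    using hs r(1) red_winv[OF hs(1)] wprod_red_winv[OF hs(1)]
    by (auto simp: reduced_append wprod_red_append conj_by_def m_assoc)
qed

text \<open>A last syllable of \<open>hs\<close> whose factor contains \<open>r\<close> is absorbed
  into \<open>r\<close>. Once this is impossible, isolation gives \<open>r [^] n \<notin> C\<close>,
  so the power has a reduced word of length \<open>2 * length hs + 1\<close>, too long for an
  element of \<open>P i\<close> if \<open>hs\<close> is not empty.\<close>

lemma elliptic_isolated:
  assumes iso: "\<And>i. isolated_in (P i) C" and "red hs" "r \<in> P j" "n \<ge> 1"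
    and "conj_by (inv (wprod hs)) r [^] (n::nat) \<in> P i"
  shows "conj_by (inv (wprod hs)) r \<in> P i"
  using assms(2-)
proof (induction hs arbitrary: r j rule: rev_induct)
  case Nil
  show ?case
  proof (cases "j = i")
    case True
    then show ?thesis using Nil by simp
  next
    case False
    then have ji: "j = (\<not> i)" by blast
    have "r [^] n \<in> P i" "r [^] n \<in> P (\<not> i)" using Nil ji by auto
    then have "r \<in> C" using mem_P_notI isolated_inD[OF iso] Nil by metis
    then show ?thesis using C_P by simp
  qed
next
  case (snoc a hs)
  obtain l x where a: "a = (l, x)" by force
  have hs: "red (hs @ [(l, x)])" using snoc.prems a by simp
  note x = wprod_snoc[OF hs]
  have rc: "r \<in> carrier G" using snoc.prems by auto
  have eq: "conj_by (inv (wprod (hs @ [a]))) r = conj_by (inv (wprod hs)) (conj_by (inv x) r)"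
    using conj_by_inv_snoc[OF hs rc] a by simp
  have step: ?case if "r \<in> P l"
  proof -
    have "conj_by (inv x) r \<in> P l"
      using that x P_subgroup by (simp add: conj_by_mem_subgroup P_inv)
    then show ?thesis using snoc.IH[OF x(2) _ snoc.prems(3)] snoc.prems eq by simp
  qed
  show ?case
  proof (cases "r \<in> P l")
    case True
    then show ?thesis by (rule step)
  next
    case False
    have lj: "l \<noteq> j"
    proof
      assume "l = j"
      show False using False snoc.prems(2) unfolding \<open>l = j\<close> by contradiction
    qed
    have "r [^] n \<notin> C" using isolated_inD[OF iso snoc.prems(2)] snoc.prems(3) False C_P by metis
    moreover have "r [^] n \<in> P j" using snoc.prems by blast
    ultimately have zs: "red ((hs @ [a]) @ [(j, r [^] n)] @ winv (hs @ [a]))"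
      "wprod ((hs @ [a]) @ [(j, r [^] n)] @ winv (hs @ [a])) = conj_by (inv (wprod (hs @ [a]))) (r [^] n)"
      using red_conjugate[OF snoc.prems(1), of j "r [^] n"] lj a by auto
    have "conj_by (inv (wprod (hs @ [a]))) (r [^] n) \<in> P i"
      using snoc.prems rc by (simp add: conj_by_pow)
    then have "len (wprod ((hs @ [a]) @ [(j, r [^] n)] @ winv (hs @ [a]))) \<le> 1"
      using len_P zs(2) by metis
    then show ?thesis using len_wprod[OF zs(1)] by simp
  qed
qed

text \<open>An element with a power in \<open>P i\<close> is elliptic, since no power of a
  hyperbolic element is; elliptic elements are settled by \<open>elliptic_isolated\<close>.\<close>

lemma P_isolated:
  assumes iso: "\<And>i. isolated_in (P i) C"
  shows "isolated_in (carrier G) (P i)"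
  unfolding isolated_in_def
proof (intro ballI allI impI)
  fix g and n :: nat assume g: "g \<in> carrier G" and n: "n \<ge> 1" and gn: "g [^] n \<in> P i"
  show "g \<in> P i"
  proof (cases "\<exists>h\<in>carrier G. \<exists>j. conj_by h g \<in> P j")
    case True
    then obtain h j where h: "h \<in> carrier G" "conj_by h g \<in> P j" by blast
    obtain hs c where hs: "red hs" "c \<in> C" "h = wprod hs \<otimes> c" using red_exists[of h] h by metis
    define r where "r = conj_by (inv c) (conj_by h g)"
    have r: "r \<in> P j" using h hs C_P P_subgroup by (simp add: r_def conj_by_mem_subgroup)
    have eq: "g = conj_by (inv (wprod hs)) r"
      using g hs by (simp add: r_def conj_by_conj_by m_assoc)
    then show ?thesis using elliptic_isolated[OF iso hs(1) r n, of i] gn by simp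
  next
    case False
    then obtain h xs where h: "h \<in> carrier G" "cyclically_red xs" "conj_by h g = wprod xs"
      using elliptic_or_hyperbolic[OF g] by blast
    then have "conj_by (inv h) (wprod xs [^] n) = g [^] n"
      using g conj_by_pow[OF h(1) g, of n] conj_by_inv_cancel(1)[OF h(1), of "g [^] n"] by simp
    then show ?thesis using hyperbolic_not_elliptic[OF h(2) inv_closed[OF h(1)] n] gn by metis
  qed
qed

lemma C_isolated:
  assumes iso: "\<And>i. isolated_in (P i) C"
  shows "isolated_in (carrier G) C"
  unfolding isolated_in_def
proof (intro ballI allI impI)
  fix g and n :: nat assume g: "g \<in> carrier G" "n \<ge> 1" "g [^] n \<in> C"
  then have "g \<in> P i" for i using isolated_inD[OF P_isolated[OF iso], of g n i] C_P by blast
  then show "g \<in> C" using P_inter by blast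
qed

text \<open>If the word \<open>zs\<close> of \<open>g\<close> began and ended in the same factor,
  one of \<open>ys @ zs\<close> and \<open>zs @ ys\<close> would be reduced, while in the other two
  syllables merge, so the equal products would have different lengths. Thus an element of the
  centraliser outside \<open>C\<close> translates along the axis.\<close>

lemma commute_cyclically_red:
  assumes ys: "cyclically_red ys" and g: "g \<in> carrier G" "g \<notin> C"
    and comm: "g \<otimes> wprod ys = wprod ys \<otimes> g"
  obtains zs where "cyclically_red zs" "g = wprod zs"
proof -
  obtain zs where zs: "red zs" "zs \<noteq> []" "g = wprod zs" using red_exists'[OF g] by metis
  note y = cyclically_redD[OF ys]
  have merge: "len (wprod us \<otimes> wprod vs) < length us + length vs"
    if uv: "red us" "red vs" "us \<noteq> []" "vs \<noteq> []" "fst (last us) = fst (hd vs)" for us vs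
  proof -
    obtain us' i u where us: "us = us' @ [(i, u)]"
      using uv(3) by (metis append_butlast_last_id surj_pair)
    obtain j v vs' where vs: "vs = (j, v) # vs'" using uv(4) by (metis list.exhaust surj_pair)
    have ij: "j = i" using uv(5) us vs by simp
    have r: "red us'" "u \<in> P i" "red vs'" "v \<in> P i"
      using uv us vs ij by (auto simp: reduced_Cons reduced_append)
    have "wprod us \<otimes> wprod vs = wprod us' \<otimes> ((u \<otimes> v) \<otimes> wprod vs')"
      using wprod_snoc(1)[of us' i u] uv(1) us vs ij r by (simp add: m_assoc P_carrier[OF r(2)] P_carrier[OF r(4)])
    also have "len \<dots> \<le> length us' + len ((u \<otimes> v) \<otimes> wprod vs')"
      using len_wprod_mult[OF r(1)] r by (simp add: P_carrier[OF r(2)] P_carrier[OF r(4)])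
    also have "len ((u \<otimes> v) \<otimes> wprod vs') \<le> Suc (length vs')"
      using len_P_mult[of "u \<otimes> v" i "wprod vs'"] r len_wprod[OF r(3)] by (simp add: P_mult)
    finally show ?thesis using us vs by simp
  qed
  have "fst (hd zs) \<noteq> fst (last zs)"
  proof
    assume eq: "fst (hd zs) = fst (last zs)"
    show False
    proof (cases "fst (hd ys) = fst (last zs)")
      case True
      then have "red (ys @ zs)" using y zs eq by (auto simp: reduced_append)
      then have "len (wprod ys \<otimes> wprod zs) = length ys + length zs"
        using len_wprod[of "ys @ zs"] wprod_red_append y zs by simp
      then show False using merge[of zs ys] True y zs comm by simp
    next
      case False
      then have "red (zs @ ys)" using y zs by (auto simp: reduced_append)
      then have "len (wprod zs \<otimes> wprod ys) = length zs + length ys"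
        using len_wprod[of "zs @ ys"] wprod_red_append y zs by simp
      moreover have "fst (last ys) = fst (hd zs)" using False y eq by blast
      ultimately show False using merge[of ys zs] y zs comm by simp
    qed
  qed
  then show ?thesis using that zs by (simp add: cyclically_red_def)
qed

text \<open>
  \<open>ray ys i\<close> is the \<open>i\<close>-th edge of the ray in the Bass--Serre tree that runs along the axis of the
  hyperbolic element \<open>wprod ys\<close>; edges are left cosets of \<open>C\<close>.
\<close>

definition ray :: "(bool \<times> 'a) list \<Rightarrow> nat \<Rightarrow> 'a set" where
  "ray ys i = wprod (take i (wpow i ys)) <# C"

lemma C_subset: "C \<subseteq> carrier G"
  by auto

lemma coset_eqI: "y \<in> carrier G \<Longrightarrow> e \<in> C \<Longrightarrow> x = y \<otimes> e \<Longrightarrow> x <# C = y <# C"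
  using lcos_m_assoc[OF C_subset, of y e] C_subgroup coset_join3[of e C] by simp

lemma coset_eqD:
  assumes "x \<in> carrier G" "y \<in> carrier G" "x <# C = y <# C"
  obtains e where "e \<in> C" "x = y \<otimes> e"
proof -
  have "x \<in> y <# C" using lcos_self[OF assms(1) C_subgroup] assms(3) by simp
  then show ?thesis using that by (auto simp: l_coset_def)
qed

lemma red_take: "red xs \<Longrightarrow> red (take i xs)"
  using reduced_append[of P C "take i xs" "drop i xs"] by simp

text \<open>The definition of \<open>ray\<close> takes \<open>i\<close> copies of \<open>ys\<close>,
  enough because each has at least one syllable; any sufficiently long power yields the same
  prefix.\<close>

lemma ray_eq:
  assumes "cyclically_red ys" "i \<le> k * length ys"
  shows "ray ys i = wprod (take i (wpow k ys)) <# C"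
proof -
  have "i \<le> i * length ys" using cyclically_redD(4)[OF assms(1)] by simp
  then show ?thesis using take_wpow_eq[OF assms(2), of i] by (simp add: ray_def)
qed

lemma ray_carrier: "cyclically_red ys \<Longrightarrow> ray ys i \<subseteq> carrier G"
  using red_take[OF red_wpow, of ys i i] by (auto simp: ray_def l_coset_def)

lemma ray_0: "ray ys 0 = C"
  using lcos_mult_one[OF C_subset] by (simp add: ray_def)

text \<open>In \<open>c \<otimes> wprod ys [^] i = wprod ys [^] i \<otimes> c\<close> both sides use
  the same reduced word, and uniqueness of prefixes says that \<open>c\<close> fixes the edges along
  it.\<close>

lemma C_commute_ray:
  assumes ys: "cyclically_red ys" and c: "c \<in> C" "c \<otimes> wprod ys = wprod ys \<otimes> c"
  shows "c <# ray ys i = ray ys i"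
proof -
  let ?w = "wpow i ys"
  have r: "red ?w" using red_wpow[OF ys] .
  have "c \<otimes> wprod ys [^] i = wprod ys [^] i \<otimes> c"
    using c cyclically_redD[OF ys]
    by (metis C_carrier group_commutes_pow wprod_red)
  then have "c \<otimes> wprod ?w = wprod ?w \<otimes> c" using wprod_wpow[OF ys] by simp
  then obtain e where e: "e \<in> C" "c \<otimes> wprod (take i ?w) = wprod (take i ?w) \<otimes> e"
    using red_unique_prefix[OF r r c(1) c(1)] by metis
  have "c <# ray ys i = (c \<otimes> wprod (take i ?w)) <# C"
    using lcos_m_assoc[OF C_subset] c red_take[OF r] by (simp add: ray_def)
  then show ?thesis using coset_eqI[OF _ e(1,2)] red_take[OF r] by (simp add: ray_def)
qed

text \<open>The words \<open>zs @ wpow k ys\<close> and \<open>wpow k ys @ zs\<close> are both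
  reduced and have the same product, so their prefixes of length \<open>i + length zs\<close> give
  the same edge; \<open>k\<close> is large enough to keep the second prefix inside
  \<open>wpow k ys\<close>.\<close>

lemma ray_shift:
  assumes ys: "cyclically_red ys" and zs: "cyclically_red zs" "fst (hd zs) = fst (hd ys)"
    and comm: "wprod zs \<otimes> wprod ys = wprod ys \<otimes> wprod zs"
  shows "wprod zs <# ray ys i = ray ys (i + length zs)"
proof -
  define k where "k = i + length zs"
  have y: "length ys \<ge> 1" "ys \<noteq> []" "red ys" using cyclically_redD[OF ys] by auto
  have z: "length zs \<ge> 1" "zs \<noteq> []" "red zs" using cyclically_redD[OF zs(1)] by auto
  have kl: "i + length zs \<le> k * length ys" "i \<le> k * length ys"
    using y(1) by (auto simp: k_def intro: order.trans[OF _ mult_le_mono2[OF y(1)]])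
  have k1: "k \<ge> 1" using z by (simp add: k_def)
  let ?w = "wpow k ys"
  have w: "red ?w" "?w \<noteq> []" "hd ?w = hd ys" "last ?w = last ys"
    using red_wpow[OF ys] hd_wpow[OF k1 y(2)] last_wpow[OF k1 y(2)] k1 y by (auto simp: wpow_eq_Nil)
  have r1: "red (zs @ ?w)"
    using w z cyclically_redD(3)[OF zs(1)] zs(2) by (auto simp: reduced_append)
  have r2: "red (?w @ zs)"
    using w z cyclically_redD(3)[OF ys] zs(2) by (auto simp: reduced_append)
  have "wprod zs \<otimes> wprod ys [^] k = wprod ys [^] k \<otimes> wprod zs"
    using comm y z by (metis group_commutes_pow wprod_red)
  then have "\<one> \<otimes> wprod (zs @ ?w) = wprod (?w @ zs) \<otimes> \<one>"
    using wprod_red_append w z wprod_wpow[OF ys] y by simp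
  then obtain e where e: "e \<in> C"
      "\<one> \<otimes> wprod (take (i + length zs) (zs @ ?w)) = wprod (take (i + length zs) (?w @ zs)) \<otimes> e"
    using red_unique_prefix[OF r1 r2 C_one C_one] by metis
  have t1: "wprod (take (i + length zs) (zs @ ?w)) = wprod zs \<otimes> wprod (take i ?w)"
    using wprod_red_append[OF z(3) red_take[OF w(1)]] by simp
  have t2: "take (i + length zs) (?w @ zs) = take (i + length zs) ?w" using kl by simp
  have car: "wprod (take j ?w) \<in> carrier G" for j using red_take[OF w(1)] by simp
  have "wprod zs <# ray ys i = (wprod zs \<otimes> wprod (take i ?w)) <# C"
    using lcos_m_assoc[OF C_subset] z car ray_eq[OF ys kl(2)] by simp
  also have "\<dots> = wprod (take (i + length zs) ?w) <# C"
    using coset_eqI[OF car e(1)] e(2) t1 t2 z car by simp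
  finally show ?thesis using ray_eq[OF ys kl(1)] by simp
qed

text \<open>By iterating \<open>ray_shift\<close>, \<open>wprod zs [^] i\<close> carries the edge
  \<open>C\<close> to the edge of \<open>ray ys\<close> with index \<open>i * length zs\<close>.
  Hence \<open>wpow i zs\<close> and a long prefix of the periodic word of \<open>ys\<close>
  represent the same coset, and their shorter prefixes agree modulo \<open>C\<close>.\<close>

lemma ray_unique:
  assumes ys: "cyclically_red ys" and zs: "cyclically_red zs" "fst (hd zs) = fst (hd ys)"
    and comm: "wprod zs \<otimes> wprod ys = wprod ys \<otimes> wprod zs"
  shows "ray zs i = ray ys i"
proof -
  have z: "wprod zs \<in> carrier G" "length zs \<ge> 1" using cyclically_redD[OF zs(1)] by auto
  have y: "length ys \<ge> 1" using cyclically_redD[OF ys] by auto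
  have "wprod zs [^] k <# ray ys 0 = ray ys (k * length zs)" for k
  proof (induction k)
    case 0
    then show ?case using lcos_mult_one[OF ray_carrier[OF ys]] by simp
  next
    case (Suc k)
    have "wprod zs [^] Suc k <# ray ys 0 = wprod zs <# (wprod zs [^] k <# ray ys 0)"
      using lcos_m_assoc[OF ray_carrier[OF ys], of "wprod zs" "wprod zs [^] k"] z
      by (simp only: nat_pow_Suc2 nat_pow_closed)
    then show ?case using Suc ray_shift[OF assms, of "k * length zs"] by (simp add: add.commute)
  qed
  from this[of i] have eq: "wprod (wpow i zs) <# C = ray ys (i * length zs)"
    using wprod_wpow[OF zs(1)] by (simp add: ray_0)
  define L where "L = i * length zs"
  let ?w = "wpow L ys"
  have iL: "i \<le> L" using z(2) by (simp add: L_def)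
  have Lk: "L \<le> L * length ys" using y by simp
  have r: "red (wpow i zs)" "red ?w" using red_wpow ys zs by auto
  obtain e where e: "e \<in> C" "wprod (wpow i zs) = wprod (take L ?w) \<otimes> e"
    using coset_eqD[of "wprod (wpow i zs)" "wprod (take L ?w)"] eq ray_eq[OF ys Lk] r
      red_take[OF r(2), of L] by (auto simp: L_def)
  have "\<one> \<otimes> wprod (wpow i zs) = wprod (take L ?w) \<otimes> e"
    using e(2) wprod_red[OF r(1)] l_one by metis
  then obtain f where f: "f \<in> C"
    "\<one> \<otimes> wprod (take i (wpow i zs)) = wprod (take i (take L ?w)) \<otimes> f"
    using red_unique_prefix[OF r(1) red_take[OF r(2), of L] C_one e(1), of i] by metis
  have "take i (take L ?w) = take i ?w" using iL by (simp add: min_def)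
  then have "wprod (take i (wpow i zs)) <# C = wprod (take i ?w) <# C"
    using coset_eqI[OF _ f(1)] f(2) red_take[OF r(1), of i] red_take[OF r(2), of i] by simp
  then show ?thesis using ray_eq[OF ys, of i L] iL Lk by (simp add: ray_def)
qed

text \<open>The stabiliser of the end of the ray: the offsets \<open>p\<close> and \<open>q\<close>
  discard an initial segment and allow a translation along the ray.\<close>

definition end_stab :: "(bool \<times> 'a) list \<Rightarrow> 'a set" where
  "end_stab ys = {g \<in> carrier G. \<exists>p q. \<forall>i. g <# ray ys (i + p) = ray ys (i + q)}"

lemma inv_lcoset_eq:
  assumes "g \<in> carrier G" "A \<subseteq> carrier G" "g <# A = B"
  shows "inv g <# B = A"
  using lcos_m_assoc[OF assms(2), of "inv g" g] assms lcos_mult_one[OF assms(2)] by auto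

lemma end_stab_subgroup:
  assumes "cyclically_red ys"
  shows "subgroup (end_stab ys) G"
proof (rule subgroupI)
  note rc = ray_carrier[OF assms]
  have "\<one> \<in> end_stab ys" using lcos_mult_one[OF rc] by (auto simp: end_stab_def)
  then show "end_stab ys \<noteq> {}" by blast
  show "end_stab ys \<subseteq> carrier G" by (auto simp: end_stab_def)
  show "inv g \<in> end_stab ys" if "g \<in> end_stab ys" for g
  proof -
    obtain p q where g: "g \<in> carrier G" "\<And>i. g <# ray ys (i + p) = ray ys (i + q)"
      using \<open>g \<in> end_stab ys\<close> by (auto simp: end_stab_def)
    have "inv g <# ray ys (i + q) = ray ys (i + p)" for i
      using inv_lcoset_eq[OF g(1) rc g(2)] .
    then show ?thesis using g(1) by (auto simp: end_stab_def)
  qed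
  show "g \<otimes> h \<in> end_stab ys" if "g \<in> end_stab ys" "h \<in> end_stab ys" for g h
  proof -
    obtain p q where g: "g \<in> carrier G" "\<And>i. g <# ray ys (i + p) = ray ys (i + q)"
      using \<open>g \<in> end_stab ys\<close> by (auto simp: end_stab_def)
    obtain p' q' where h: "h \<in> carrier G" "\<And>i. h <# ray ys (i + p') = ray ys (i + q')"
      using \<open>h \<in> end_stab ys\<close> by (auto simp: end_stab_def)
    have "(g \<otimes> h) <# ray ys (i + (p + p')) = ray ys (i + (q' + q))" for i
    proof -
      have "(g \<otimes> h) <# ray ys (i + (p + p')) = g <# (h <# ray ys ((i + p) + p'))"
        using lcos_m_assoc[OF rc g(1) h(1)] by (simp add: add.assoc)
      also have "\<dots> = g <# ray ys ((i + q') + p)" using h(2)[of "i + p"] by (simp add: ac_simps)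
      also have "\<dots> = ray ys (i + (q' + q))" using g(2)[of "i + q'"] by (simp add: ac_simps)
      finally show ?thesis .
    qed
    then show ?thesis using g h unfolding end_stab_def by blast
  qed
qed

text \<open>Either \<open>g\<close> lies in \<open>C\<close> and fixes the ray, or it translates
  along the axis. If it translates away from the end, its word starts in the other factor, and the
  inverse is used instead.\<close>

lemma commute_mem_end_stab:
  assumes ys: "cyclically_red ys" and g: "g \<in> carrier G" "g \<otimes> wprod ys = wprod ys \<otimes> g"
  shows "g \<in> end_stab ys"
proof (cases "g \<in> C")
  case True
  then have "\<forall>i. g <# ray ys (i + 0) = ray ys (i + 0)" using C_commute_ray[OF ys True g(2)] by simp
  then show ?thesis using g unfolding end_stab_def by blast
next
  case False
  obtain zs where zs: "cyclically_red zs" "g = wprod zs"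
    using commute_cyclically_red[OF ys g(1) False g(2)] by metis
  note y = cyclically_redD[OF ys] and z = cyclically_redD[OF zs(1)]
  show ?thesis
  proof (cases "fst (hd zs) = fst (hd ys)")
    case True
    then have "\<forall>i. g <# ray ys (i + 0) = ray ys (i + length zs)"
      using ray_shift[OF ys zs(1) True] g zs by simp
    then show ?thesis using g unfolding end_stab_def by blast
  next
    case False
    have wi: "wprod (winv zs) = inv g" using zs wprod_red_winv z by simp
    have "wprod (winv zs) \<otimes> wprod ys = wprod ys \<otimes> wprod (winv zs)"
      using commute_inv[OF g(1) _ g(2)] y by (simp add: wi)
    moreover have "fst (hd (winv zs)) = fst (hd ys)" using False z hd_winv[OF z(2)] by blast
    ultimately have "\<forall>i. inv g <# ray ys (i + 0) = ray ys (i + length zs)"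
      using ray_shift[OF ys cyclically_red_winv[OF zs(1)]] wi by simp
    then have "inv g \<in> end_stab ys" using g unfolding end_stab_def by blast
    then have "inv (inv g) \<in> end_stab ys"
      using end_stab_subgroup[OF ys] by (rule subgroup.m_inv_closed[rotated])
    then show ?thesis using g by simp
  qed
qed

text \<open>If \<open>t [^] m \<in> C\<close>, this power fixes the ray, and by isolation
  \<open>t\<close> fixes each of its edges. Otherwise \<open>t [^] m\<close> or its inverse is
  hyperbolic with the same ray as \<open>ys\<close>, and \<open>t\<close> preserves the end because
  it commutes with its own power.\<close>

lemma commute_pow_mem_end_stab:
  assumes iso: "\<And>i. isolated_in (P i) C"
    and ys: "cyclically_red ys" and t: "t \<in> carrier G" and m: "m \<ge> 1"
    and comm: "t [^] (m::nat) \<otimes> wprod ys = wprod ys \<otimes> t [^] m"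
  shows "t \<in> end_stab ys"
proof -
  note y = cyclically_redD[OF ys]
  have main: "t \<in> end_stab ys"
    if t: "t \<in> carrier G" and comm: "t [^] m \<otimes> wprod ys = wprod ys \<otimes> t [^] m"
      and zs: "cyclically_red zs" "t [^] m = wprod zs" "fst (hd zs) = fst (hd ys)" for t zs
  proof -
    have "t \<otimes> wprod zs = wprod zs \<otimes> t"
      using t zs(2) by (metis nat_pow_Suc nat_pow_Suc2)
    then have "t \<in> end_stab zs" using commute_mem_end_stab zs(1) t by blast
    moreover have "ray zs i = ray ys i" for i
      using ray_unique[OF ys zs(1,3)] comm zs(2) by simp
    ultimately show ?thesis by (simp add: end_stab_def)
  qed
  show ?thesis
  proof (cases "t [^] m \<in> C")
    case True
    have "t <# ray ys i = ray ys i" for i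
    proof -
      define h where "h = wprod (take i (wpow i ys))"
      have h: "h \<in> carrier G" using red_take[OF red_wpow[OF ys]] by (simp add: h_def)
      have "(t [^] m \<otimes> h) <# C = h <# C"
        using C_commute_ray[OF ys True comm, of i] lcos_m_assoc[OF C_subset] h t
        by (simp add: ray_def flip: h_def)
      then obtain e where e: "e \<in> C" "t [^] m \<otimes> h = h \<otimes> e"
        using coset_eqD[of "t [^] m \<otimes> h" h] h t by auto
      then have "conj_by h (t [^] m) = e" using h t by (simp add: conj_by_def m_assoc)
      then have "conj_by h t [^] m \<in> C" using e(1) h t by (simp add: conj_by_pow)
      then have f: "conj_by h t \<in> C"
        by (rule isolated_inD[OF C_isolated[OF iso] conj_by_closed[OF h t] _ m])
      have "t \<otimes> h = h \<otimes> conj_by h t" using h t by (simp add: conj_by_def m_assoc)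
      then have "(t \<otimes> h) <# C = h <# C" using coset_eqI[OF h f] by simp
      then show ?thesis using lcos_m_assoc[OF C_subset] h t by (simp add: ray_def flip: h_def)
    qed
    then have "\<forall>i. t <# ray ys (i + 0) = ray ys (i + 0)" by simp
    then show ?thesis using t unfolding end_stab_def by blast
  next
    case False
    obtain zs where zs: "cyclically_red zs" "t [^] m = wprod zs"
      using commute_cyclically_red[OF ys _ False comm] t by auto
    note z = cyclically_redD[OF zs(1)]
    show ?thesis
    proof (cases "fst (hd zs) = fst (hd ys)")
      case True
      then show ?thesis using main[OF t comm zs] by blast
    next
      case False
      have wi: "inv t [^] m = wprod (winv zs)"
        using zs z t by (simp add: wprod_red_winv nat_pow_inv)
      have "inv t [^] m \<otimes> wprod ys = wprod ys \<otimes> inv t [^] m"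
        using commute_inv[OF _ _ comm] t y by (simp add: nat_pow_inv)
      moreover have "fst (hd (winv zs)) = fst (hd ys)" using False z hd_winv[OF z(2)] by blast
      ultimately have "inv t \<in> end_stab ys"
        using main[OF _ _ cyclically_red_winv[OF zs(1)] wi] t by simp
      then have "inv (inv t) \<in> end_stab ys"
        using end_stab_subgroup[OF ys] by (rule subgroup.m_inv_closed[rotated])
      then show ?thesis using t by simp
    qed
  qed
qed

end

context group
begin

text \<open>
  For the cyclic groups on the two generators of a dihedral Artin group this holds unless the label
  is 2, which is where (2,2)-freeness enters.
\<close>

definition separated :: "'a set \<Rightarrow> 'a set \<Rightarrow> bool" where
  "separated Z B \<longleftrightarrow>
     (\<forall>z\<in>Z. \<forall>z'\<in>Z. \<forall>b\<in>B. b \<noteq> \<one> \<longrightarrow> z \<otimes> b \<otimes> z' \<in> B \<longrightarrow> z = \<one>)"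

end

section \<open>Common fixed vertices and fixed ends of elements with commuting powers\<close>

context amalgam
begin

lemma elliptic_form:
  assumes "g \<in> carrier G" "h \<in> carrier G" "conj_by h g \<in> P j"
  obtains hs r where "red hs" "r \<in> P j" "g = conj_by (inv (wprod hs)) r"
proof -
  obtain hs c where hs: "red hs" "c \<in> C" "h = wprod hs \<otimes> c" using red_exists[of h] assms by metis
  define r where "r = conj_by (inv c) (conj_by h g)"
  have "r \<in> P j" using assms hs C_P P_subgroup by (simp add: r_def conj_by_mem_subgroup)
  moreover have "g = conj_by (inv (wprod hs)) r"
    using assms hs by (simp add: r_def conj_by_conj_by m_assoc)
  ultimately show ?thesis using that hs by blast
qed

text \<open>\<open>S\<close> fixes the vertex \<open>P i\<close>, and \<open>hs\<close> leads to a
  vertex fixed by \<open>t\<close>. Unless these can be made equal at once, \<open>t [^] m\<close>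
  is a reduced word whose first syllable has some tag \<open>k\<close>. Commutation with the
  elements \<open>s [^] m\<close> gives first \<open>S \<subseteq> P k\<close> and then that
  \<open>S\<close> fixes the edge \<open>x <# C\<close> for the first syllable \<open>x\<close> of
  \<open>hs\<close>. Conjugating by \<open>x\<close> moves \<open>S\<close> into \<open>C\<close>
  and shortens the path.\<close>

lemma elliptic_common_aux:
  assumes iso: "\<And>i. isolated_in (P i) C" and m: "m \<ge> 1"
    and "S \<subseteq> P i" "red hs" "r \<in> P j" "t = conj_by (inv (wprod hs)) r"
    and "\<And>s. s \<in> S \<Longrightarrow> s [^] (m::nat) \<otimes> t [^] m = t [^] m \<otimes> s [^] m"
  shows "\<exists>h\<in>carrier G. \<exists>k. \<forall>s\<in>insert t S. conj_by h s \<in> P k"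
  using assms(3-)
proof (induction "length hs" arbitrary: hs S i r j t rule: less_induct)
  case less
  note S = less.prems(1) and hs = less.prems(2) and r = less.prems(3) and t = less.prems(4)
    and comm = less.prems(5)
  have rc: "r \<in> carrier G" using r by simp
  have tc: "t \<in> carrier G" using t hs rc by simp
  have Sc: "s \<in> carrier G" if "s \<in> S" for s using S that by auto
  have trivial: ?case if "S \<subseteq> P k" "t \<in> P k" for k
    using that tc Sc by (intro bexI[of _ \<one>] exI[of _ k]) auto
  show ?case
  proof (cases "hs \<noteq> [] \<and> r \<in> P (fst (last hs))")
    case True
    then obtain hs' l x where h: "hs = hs' @ [(l, x)]" by (metis append_butlast_last_id surj_pair)
    have rl: "r \<in> P l" using True h by simp
    have red: "red (hs' @ [(l, x)])" using hs h by simp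
    note x = wprod_snoc[OF red]
    have "conj_by (inv x) r \<in> P l"
      using rl x P_subgroup by (simp add: conj_by_mem_subgroup P_inv)
    moreover have "t = conj_by (inv (wprod hs')) (conj_by (inv x) r)"
      using conj_by_inv_snoc[OF red rc] t h by simp
    ultimately show ?thesis using less.hyps[of hs' S i "conj_by (inv x) r" l t] S comm x(2) h by simp
  next
    case nabs: False
    show ?thesis
    proof (cases "hs = [] \<and> r \<in> P i")
      case True
      then show ?thesis using trivial[of i] S t rc by simp
    next
      case ntriv: False
      \<comment> \<open>For empty \<open>hs\<close> the path ends where it starts, at the vertex
        fixed by \<open>S\<close>; hence the default \<open>i\<close>.\<close>
      define l where "l = (if hs = [] then i else fst (last hs))"
      have rl: "r \<notin> P l" using nabs ntriv by (auto simp: l_def)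
      have lj: "l \<noteq> j"
      proof
        assume "l = j"
        show False using rl r unfolding \<open>l = j\<close> by contradiction
      qed
      define b where "b = r [^] m"
      have b: "b \<in> P j" "b \<in> carrier G" using r rc by (auto simp: b_def)
      have bC: "b \<notin> C" using isolated_inD[OF iso r, of m] m rl C_P unfolding b_def by metis
      define zs where "zs = hs @ [(j, b)] @ winv hs"
      have lastj: "hs \<noteq> [] \<Longrightarrow> fst (last hs) \<noteq> j" using lj by (simp add: l_def)
      have zs: "red zs" "wprod zs = t [^] m"
        using red_conjugate[OF hs lastj b(1) bC] t hs rc by (auto simp: zs_def b_def conj_by_pow)
      define k where "k = fst (hd zs)"
      have lastzs: "fst (last zs) = k"
        by (cases hs) (auto simp: zs_def k_def last_winv)
      have zne: "zs \<noteq> []" by (simp add: zs_def)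
      have Sk: "S \<subseteq> P k"
      proof (cases "k = i")
        case True
        then show ?thesis using S by simp
      next
        case False
        show ?thesis
        proof
          fix s assume s: "s \<in> S"
          have a: "s [^] m \<in> P i" using S s by blast
          \<comment> \<open>Otherwise \<open>s [^] m\<close> could be put on either side of
            \<open>zs\<close>, giving two reduced words for one element that begin in different
            factors.\<close>
          have "s [^] m \<in> C"
          proof (rule ccontr)
            assume nC: "s [^] m \<notin> C"
            have i1: "red [(i, s [^] m)]" using a nC by (simp add: reduced_Cons)
            have r1: "red ((i, s [^] m) # zs)" using a nC zs False zne by (auto simp: reduced_Cons k_def)
            have r2: "red (zs @ [(i, s [^] m)])"
              using i1 zs False lastzs by (auto simp: reduced_append)
            have "\<one> \<otimes> wprod ((i, s [^] m) # zs) = wprod (zs @ [(i, s [^] m)]) \<otimes> \<one>"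
              using comm[OF s] zs wprod_red_append[OF zs(1) i1] tc Sc[OF s] by simp
            from red_unique_types[OF r1 r2 C_one C_one this]
            have "i = fst (hd zs)" using zne by (cases zs) auto
            then show False using False by (simp add: k_def)
          qed
          then have "s \<in> C" using isolated_inD[OF iso, of s i m] S s m by blast
          then show "s \<in> P k" using C_P by simp
        qed
      qed
      show ?thesis
      proof (cases hs)
        case Nil
        then have "k = j" by (simp add: k_def zs_def)
        then show ?thesis using trivial[OF Sk] t Nil r rc by simp
      next
        case (Cons a hs')
        then obtain x where h: "hs = (k, x) # hs'"
          by (cases a) (simp add: k_def zs_def)
        have x: "x \<in> P k" "red hs'" and hd': "hs' \<noteq> [] \<Longrightarrow> k \<noteq> fst (hd hs')"
          using hs h by (auto simp: reduced_Cons)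
        have xc: "x \<in> carrier G" "wprod hs' \<in> carrier G" using x by auto
        have lastj': "hs' \<noteq> [] \<Longrightarrow> fst (last hs') \<noteq> j" using lastj h by auto
        have conjC: "conj_by x s \<in> C" if s: "s \<in> S" for s
        proof -
          define a where "a = s [^] m"
          have a: "a \<in> P k" "a \<in> carrier G" using Sk s by (auto simp: a_def)
          have inv1: "a \<otimes> (t [^] m \<otimes> inv a) = t [^] m"
          proof -
            have "a \<otimes> (t [^] m \<otimes> inv a) = (a \<otimes> t [^] m) \<otimes> inv a" using a tc by (simp add: m_assoc)
            also have "\<dots> = (t [^] m \<otimes> a) \<otimes> inv a" using comm[OF s] by (simp add: a_def)
            finally show ?thesis using a tc by (simp add: m_assoc)
          qed
          have tm: "t [^] m = wprod hs \<otimes> (b \<otimes> inv (wprod hs))"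
            using conj_by_pow[of "inv (wprod hs)" r m] t hs rc b
            by (simp add: conj_by_def m_assoc flip: b_def)
          \<comment> \<open>With \<open>a \<otimes> x \<in> C\<close>, conjugation by
            \<open>a\<close> would shorten \<open>t [^] m\<close>, but it leaves this element
            unchanged.\<close>
          have ax: "a \<otimes> x \<notin> C"
          proof
            assume c: "a \<otimes> x \<in> C"
            define u where "u = wprod (hs' @ [(j, b)] @ winv hs')"
            have u: "red (hs' @ [(j, b)] @ winv hs')" "u = conj_by (inv (wprod hs')) b"
              using red_conjugate[OF x(2) lastj' b(1) bC] by (auto simp: u_def)
            have uc: "u \<in> carrier G" using u b x by simp
            have "t [^] m = (a \<otimes> x) \<otimes> (u \<otimes> inv (a \<otimes> x))"
            proof -
              have "t [^] m = a \<otimes> ((wprod hs \<otimes> (b \<otimes> inv (wprod hs))) \<otimes> inv a)"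
                using inv1 tm by simp
              also have "\<dots> = (a \<otimes> x) \<otimes> (u \<otimes> inv (a \<otimes> x))"
                using h a xc b by (simp add: u conj_by_def m_assoc inv_mult_group)
              finally show ?thesis .
            qed
            then have "len (t [^] m) \<le> len (a \<otimes> x) + len (u \<otimes> inv (a \<otimes> x))"
              using len_mult[of "a \<otimes> x" "u \<otimes> inv (a \<otimes> x)"] a xc uc by simp
            also have "\<dots> = len u" using len_C[OF c] len_mult_C[OF uc C_inv[OF c]] by simp
            also have "\<dots> = 2 * length hs' + 1" using len_wprod[OF u(1)] by (simp add: u_def)
            finally have "len (t [^] m) \<le> 2 * length hs' + 1" .
            moreover have "len (t [^] m) = 2 * length hs + 1"
              using len_wprod[OF zs(1)] zs(2) by (simp add: zs_def)
            ultimately show False using h by simp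
          qed
          let ?h2 = "(k, a \<otimes> x) # hs'"
          have h2: "red ?h2" using ax a x hd' by (auto simp: reduced_Cons)
          have l2: "?h2 \<noteq> [] \<Longrightarrow> fst (last ?h2) \<noteq> j" using lastj h by (auto split: if_splits)
          note z2 = red_conjugate[OF h2 l2 b(1) bC]
          have "conj_by (inv (wprod ?h2)) b = t [^] m"
            using inv1 tm h a xc b by (simp add: conj_by_def m_assoc inv_mult_group)
          then have "\<one> \<otimes> wprod (?h2 @ [(j, b)] @ winv ?h2) = wprod zs \<otimes> \<one>"
            using z2(2) zs tc by simp
          then obtain e where "e \<in> C"
              "\<one> \<otimes> wprod (take 1 (?h2 @ [(j, b)] @ winv ?h2)) = wprod (take 1 zs) \<otimes> e"
            using red_unique_prefix[OF z2(1) zs(1) C_one C_one] by metis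
          then have e: "e \<in> C" "a \<otimes> x = x \<otimes> e" using h a xc by (auto simp: zs_def)
          have "conj_by x a = inv x \<otimes> (a \<otimes> x)" using a xc by (simp add: conj_by_def m_assoc)
          also have "\<dots> = e" using e xc by simp
          finally have "conj_by x s [^] m \<in> C"
            using e(1) xc Sc[OF s] by (simp add: a_def conj_by_pow)
          then show ?thesis
            by (rule isolated_inD[OF C_isolated[OF iso] conj_by_closed[OF xc(1) Sc[OF s]] _ m])
        qed
        have tx: "conj_by x t = conj_by (inv (wprod hs')) r"
          using t h xc rc by (simp add: conj_by_conj_by inv_mult_group m_assoc)
        have "\<exists>h\<in>carrier G. \<exists>k. \<forall>s\<in>insert (conj_by x t) (conj_by x ` S). conj_by h s \<in> P k"
        \<comment> \<open>The tag \<open>True\<close> is an arbitrary choice: the conjugated set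
          lies in \<open>C\<close> and so in both factors.\<close>
        proof (rule less.hyps[of hs' "conj_by x ` S" True r j])
          show "length hs' < length hs" using h by simp
          show "conj_by x ` S \<subseteq> P True" using conjC C_P by blast
          show "s [^] m \<otimes> conj_by x t [^] m = conj_by x t [^] m \<otimes> s [^] m" if "s \<in> conj_by x ` S" for s
            using that conj_by_commute_pow[OF xc(1) Sc tc comm] by blast
        qed (use x r tx in auto)
        then obtain h k where hk: "h \<in> carrier G"
            "\<forall>s\<in>insert (conj_by x t) (conj_by x ` S). conj_by h s \<in> P k" by blast
        then have "\<forall>s\<in>insert t S. conj_by (x \<otimes> h) s \<in> P k"
          using conj_by_conj_by[OF hk(1) xc(1)] tc Sc by force
        then show ?thesis using hk(1) xc(1) by blast
      qed
    qed
  qed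
qed

text \<open>A Helly property: pairwise commutation of powers suffices for a common fixed vertex. In
  the induction the vertex already found for \<open>S\<close> is moved to a base vertex by
  conjugation.\<close>

lemma elliptic_common:
  assumes iso: "\<And>i. isolated_in (P i) C" and m: "m \<ge> 1" and "finite S" "S \<subseteq> carrier G"
    and "\<And>s. s \<in> S \<Longrightarrow> \<exists>h\<in>carrier G. \<exists>j. conj_by h s \<in> P j"
    and "\<And>s t. s \<in> S \<Longrightarrow> t \<in> S \<Longrightarrow> s [^] (m::nat) \<otimes> t [^] m = t [^] m \<otimes> s [^] m"
  shows "\<exists>h\<in>carrier G. \<exists>k. \<forall>s\<in>S. conj_by h s \<in> P k"
  using assms(3-)
proof (induction S rule: finite_induct)
  case empty
  then show ?case by blast
next
  case (insert t S)
  obtain h k where h: "h \<in> carrier G" "\<forall>s\<in>S. conj_by h s \<in> P k" using insert by auto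
  have tc: "t \<in> carrier G" and Sc: "\<And>s. s \<in> S \<Longrightarrow> s \<in> carrier G" using insert by auto
  obtain h1 j where h1: "h1 \<in> carrier G" "conj_by h1 t \<in> P j"
    using insert.prems(2)[OF insertI1] by blast
  have "conj_by (inv h \<otimes> h1) (conj_by h t) = conj_by h1 t"
    using h h1 tc by (simp add: conj_by_conj_by)
  then obtain hs r where hs: "red hs" "r \<in> P j" "conj_by h t = conj_by (inv (wprod hs)) r"
    using elliptic_form[of "conj_by h t" "inv h \<otimes> h1" j] h(1) h1 tc
    by (metis conj_by_closed inv_closed m_closed)
  have "\<exists>h'\<in>carrier G. \<exists>k. \<forall>s\<in>insert (conj_by h t) (conj_by h ` S). conj_by h' s \<in> P k"
  proof (rule elliptic_common_aux[OF iso m _ hs])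
    show "conj_by h ` S \<subseteq> P k" using h by blast
    show "s [^] m \<otimes> conj_by h t [^] m = conj_by h t [^] m \<otimes> s [^] m" if "s \<in> conj_by h ` S" for s
      using that conj_by_commute_pow[OF h(1) Sc tc] insert.prems(3) by blast
  qed
  then obtain h' k' where h': "h' \<in> carrier G"
      "\<forall>s\<in>insert (conj_by h t) (conj_by h ` S). conj_by h' s \<in> P k'" by blast
  then have "\<forall>s\<in>insert t S. conj_by (h \<otimes> h') s \<in> P k'"
    using conj_by_conj_by[OF h'(1) h(1)] tc Sc by force
  then show ?case using h'(1) h(1) by blast
qed

lemma len_ray:
  assumes "cyclically_red ys" "g \<in> ray ys i"
  shows "len g = i"
proof -
  have r: "red (take i (wpow i ys))" using red_take red_wpow assms by blast
  obtain c where "c \<in> C" "g = wprod (take i (wpow i ys)) \<otimes> c"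
    using assms(2) by (auto simp: ray_def l_coset_def)
  then have "len g = length (take i (wpow i ys))" using len_eq[OF r] by blast
  also have "\<dots> = i" using mult_le_mono2[OF cyclically_redD(4)[OF assms(1)], of i] by simp
  finally show ?thesis .
qed

text \<open>A vertex stabiliser does not translate: the square of \<open>v\<close> would move along
  the ray by \<open>2 * (q - p)\<close>, whereas an element of \<open>P j\<close> increases the
  length by at most one. The square is taken because \<open>v\<close> alone would still allow
  \<open>q = p + 1\<close>.\<close>

lemma P_not_shift:
  assumes ys: "cyclically_red ys" and v: "v \<in> P j"
    and shift: "\<And>i. v <# ray ys (i + p) = ray ys (i + q)"
  shows "\<not> p < q"
proof
  assume pq: "p < q"
  note rc = ray_carrier[OF ys]
  define g where "g = wprod (take p (wpow p ys))"
  have gc: "g \<in> carrier G" using red_take[OF red_wpow[OF ys]] by (simp add: g_def)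
  have gr: "g \<in> ray ys p" using lcos_self[OF gc C_subgroup] by (simp add: ray_def g_def)
  have "(v \<otimes> v) <# ray ys p = v <# (v <# ray ys (0 + p))"
    using lcos_m_assoc[OF rc] v by simp
  also have "\<dots> = v <# ray ys ((q - p) + p)" using shift[of 0] pq by simp
  also have "\<dots> = ray ys (2 * q - p)" using shift[of "q - p"] pq by (simp add: mult_2)
  finally have "(v \<otimes> v) \<otimes> g \<in> ray ys (2 * q - p)" using gr by (auto simp: l_coset_def)
  then have "len ((v \<otimes> v) \<otimes> g) = 2 * q - p" using len_ray[OF ys] by blast
  moreover have "len ((v \<otimes> v) \<otimes> g) \<le> Suc (len g)" using len_P_mult[OF P_mult[OF v v] gc] .
  moreover have "len g = p" using len_ray[OF ys gr] .
  ultimately show False using pq by linarith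
qed

text \<open>\<open>P_not_shift\<close> for \<open>v\<close> and for its inverse forces the two
  offsets to be equal.\<close>

lemma P_end_stab:
  assumes ys: "cyclically_red ys" and v: "v \<in> P j" "v \<in> end_stab ys"
  shows "\<exists>p. \<forall>i\<ge>p. v <# ray ys i = ray ys i"
proof -
  obtain p q where pq: "\<And>i. v <# ray ys (i + p) = ray ys (i + q)"
    using v by (auto simp: end_stab_def)
  have "inv v <# ray ys (i + q) = ray ys (i + p)" for i
    using inv_lcoset_eq[OF _ ray_carrier[OF ys] pq] v by simp
  then have "p = q" using P_not_shift[OF ys v(1) pq] P_not_shift[OF ys P_inv[OF v(1)], of q p] by simp
  then have "v <# ray ys i = ray ys i" if "i \<ge> p" for i using pq[of "i - p"] that by simp
  then show ?thesis by blast
qed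

text \<open>
  In the action on the Bass--Serre tree, isolation of the edge groups means that a power of \<open>s\<close>
  fixes an edge only if \<open>s\<close> does.  If all elements of \<open>S\<close> are elliptic they fix a common vertex;
  otherwise the axis of a hyperbolic one has an end which the whole group fixes, so that the
  elliptic generators in \<open>V\<close> fix a common edge.
\<close>

theorem no_generating_set_with_commuting_powers:
  assumes iso: "\<And>i. isolated_in (P i) C" and proper: "\<And>i. P i \<noteq> carrier G"
    and V: "finite V" "V \<subseteq> P True \<union> P False" "generate G V = carrier G"
    and S: "finite S" "S \<subseteq> carrier G" "generate G S = carrier G" and m: "m \<ge> 1"
    and comm: "\<And>s t. s \<in> S \<Longrightarrow> t \<in> S \<Longrightarrow> s [^] (m::nat) \<otimes> t [^] m = t [^] m \<otimes> s [^] m"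
  shows False
proof (cases "\<forall>s\<in>S. \<exists>h\<in>carrier G. \<exists>j. conj_by h s \<in> P j")
  case True
  then obtain h k where h: "h \<in> carrier G" "\<forall>s\<in>S. conj_by h s \<in> P k"
    using elliptic_common[OF iso m S(1,2) _ comm] by blast
  have "carrier G \<subseteq> {g \<in> carrier G. conj_by h g \<in> P k}"
    using generate_subgroup_incl[OF _ subgroup_conj_by_vimage[OF P_subgroup h(1)], of S k] h S by auto
  then have "conj_by h (conj_by (inv h) g) \<in> P k" if "g \<in> carrier G" for g
    using conj_by_closed[OF inv_closed[OF h(1)] that] by blast
  then have "carrier G \<subseteq> P k" using conj_by_inv_cancel(2)[OF h(1)] by force
  then show False using proper[of k] P_carrier by blast
next
  case False
  then obtain s where s: "s \<in> S" "\<not> (\<exists>h\<in>carrier G. \<exists>j. conj_by h s \<in> P j)" by blast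
  then obtain h xs where h: "h \<in> carrier G" "cyclically_red xs" "conj_by h s = wprod xs"
    using elliptic_or_hyperbolic[of s] subsetD[OF S(2) s(1)] by metis
  \<comment> \<open>With the \<open>m\<close>-th power of the word, \<open>wprod ys\<close> is the
    \<open>m\<close>-th power of the conjugate of \<open>s\<close>, and this is what the hypothesis
    \<open>comm\<close> controls.\<close>
  define ys where "ys = wpow m xs"
  have ys: "cyclically_red ys" "wprod ys = conj_by h s [^] m"
    using cyclically_red_wpow[OF h(2) m] wprod_wpow[OF h(2)] h(3) by (simp_all add: ys_def)
  have "conj_by h t \<in> end_stab ys" if "t \<in> S" for t
  proof (rule commute_pow_mem_end_stab[OF iso ys(1) _ m])
    show "conj_by h t [^] m \<otimes> wprod ys = wprod ys \<otimes> conj_by h t [^] m"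
      using conj_by_commute_pow[OF h(1) subsetD[OF S(2) that] subsetD[OF S(2) s(1)]
          comm[OF that s(1)]] ys(2) by simp
  qed (use that S h in auto)
  then have "carrier G \<subseteq> {g \<in> carrier G. conj_by h g \<in> end_stab ys}"
    using generate_subgroup_incl[OF _ subgroup_conj_by_vimage[OF end_stab_subgroup[OF ys(1)] h(1)], of S] S
    by auto
  then have "conj_by h (conj_by (inv h) g) \<in> end_stab ys" if "g \<in> carrier G" for g
    using conj_by_closed[OF inv_closed[OF h(1)] that] by blast
  then have all: "carrier G \<subseteq> end_stab ys" using conj_by_inv_cancel(2)[OF h(1)] by force
  \<comment> \<open>Finiteness of \<open>V\<close> yields one index from which on all generators fix
    the ray. The edge at this index is then fixed by the whole group, which after conjugation is
    \<open>C\<close>, against properness.\<close>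
  have "\<exists>p. \<forall>v\<in>V. \<forall>i\<ge>p. v <# ray ys i = ray ys i"
    using V(1,2)
  proof (induction V rule: finite_induct)
    case (insert v V)
    obtain p where p: "\<forall>v\<in>V. \<forall>i\<ge>p. v <# ray ys i = ray ys i" using insert by auto
    obtain j where "v \<in> P j" using insert by auto
    then obtain q where q: "\<forall>i\<ge>q. v <# ray ys i = ray ys i"
      using P_end_stab[OF ys(1)] all P_carrier by blast
    show ?case using p q by (intro exI[of _ "max p q"]) auto
  qed auto
  then obtain p where p: "\<And>v. v \<in> V \<Longrightarrow> v <# ray ys p = ray ys p" by blast
  note rc = ray_carrier[OF ys(1), of p]
  have "subgroup {g \<in> carrier G. g <# ray ys p = ray ys p} G"
  proof (rule subgroupI)
    show "{g \<in> carrier G. g <# ray ys p = ray ys p} \<noteq> {}"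
      using lcos_mult_one[OF rc] by blast
  qed (use inv_lcoset_eq[OF _ rc] in \<open>auto simp flip: lcos_m_assoc[OF rc]\<close>)
  moreover have "V \<subseteq> {g \<in> carrier G. g <# ray ys p = ray ys p}"
    using p V(2) P_carrier by blast
  ultimately have fixed: "carrier G \<subseteq> {g \<in> carrier G. g <# ray ys p = ray ys p}"
    using generate_subgroup_incl V(3) by metis
  define w where "w = wprod (take p (wpow p ys))"
  have w: "w \<in> carrier G" using red_take[OF red_wpow[OF ys(1)]] by (simp add: w_def)
  have "g \<in> C" if g: "g \<in> carrier G" for g
  proof -
    have g': "conj_by (inv w) g \<in> carrier G" using g w by simp
    have "(conj_by (inv w) g \<otimes> w) <# C = w <# C"
      using fixed g' lcos_m_assoc[OF C_subset g' w] by (auto simp: ray_def w_def)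
    then obtain e where "e \<in> C" "conj_by (inv w) g \<otimes> w = w \<otimes> e"
      using coset_eqD[of "conj_by (inv w) g \<otimes> w" w] g' w by auto
    then show ?thesis using g w by (simp add: conj_by_def m_assoc)
  qed
  then show False using proper[of True] C_P P_carrier by blast
qed

section \<open>Subgroups generated by one subgroup of each factor\<close>

lemma red_of_sub:
  assumes "\<And>i. B i \<subseteq> P i" "\<And>i. B i \<inter> C = {\<one>}" "reduced B {\<one>} xs"
  shows "red xs"
  using assms unfolding reduced_def by blast

lemma sub_decomposition:
  assumes B: "\<And>i. subgroup (B i) G" and h: "h \<in> generate G (B True \<union> B False)"
  obtains xs where "reduced B {\<one>} xs" "h = wprod xs"
proof -
  obtain xs c where xs: "reduced B {\<one>} xs" "c \<in> {\<one>}" "h = wprod xs \<otimes> c"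
    using reduced_decomposition[of B "{\<one>}" h, OF B triv_subgroup _ h] B
    by (metis empty_subsetI insert_subset subgroup.one_closed)
  have "wprod xs \<in> carrier G"
    using reduced_carrier[OF _ xs(1)] B by (metis subgroup.subset wprod_closed)
  then show ?thesis using that xs by simp
qed

lemma wprod_mem_generate:
  assumes "\<forall>x\<in>set xs. snd x \<in> B (fst x)"
  shows "wprod xs \<in> generate G (B True \<union> B False)"
  using assms
proof (induction xs)
  case (Cons x xs)
  have "snd x \<in> B True \<union> B False" using Cons.prems by (cases "fst x") auto
  then show ?case using Cons by (auto intro: generate.eng generate.incl)
qed (simp add: generate.one)

text \<open>A non-empty reduced word in the \<open>B i\<close> is also reduced in the amalgam, so
  its product is outside \<open>C\<close>.\<close>

lemma sub_inter_C:
  assumes B: "\<And>i. subgroup (B i) G" and BP: "\<And>i. B i \<subseteq> P i" and BC: "\<And>i. B i \<inter> C = {\<one>}"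
  shows "generate G (B True \<union> B False) \<inter> C = {\<one>}"
proof -
  have "h = \<one>" if h: "h \<in> generate G (B True \<union> B False)" "h \<in> C" for h
  proof -
    obtain xs where xs: "reduced B {\<one>} xs" "h = wprod xs" using sub_decomposition[OF B h(1)] by metis
    then have "xs = []" using wprod_red_notin_C[OF red_of_sub[OF BP BC xs(1)]] h by blast
    then show ?thesis using xs by simp
  qed
  then show ?thesis using generate.one by auto
qed

text \<open>The first syllables of the words for \<open>h\<close> and
  \<open>z \<otimes> h \<otimes> z'\<close> satisfy \<open>z \<otimes> x = y \<otimes> e\<close>
  with \<open>e \<in> C\<close>, so separation within a single factor already forces
  \<open>z = \<one>\<close>.\<close>

lemma sub_separated:
  assumes B: "\<And>i. subgroup (B i) G" and BP: "\<And>i. B i \<subseteq> P i" and BC: "\<And>i. B i \<inter> C = {\<one>}"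
    and sep: "\<And>i. separated C (B i)"
  shows "separated C (generate G (B True \<union> B False))"
  unfolding separated_def
proof (intro ballI impI)
  fix z z' h assume z: "z \<in> C" "z' \<in> C" and h: "h \<in> generate G (B True \<union> B False)" "h \<noteq> \<one>"
    and zhz: "z \<otimes> h \<otimes> z' \<in> generate G (B True \<union> B False)"
  obtain xs where xs: "reduced B {\<one>} xs" "h = wprod xs" using sub_decomposition[OF B h(1)] by metis
  obtain ys where ys: "reduced B {\<one>} ys" "z \<otimes> h \<otimes> z' = wprod ys"
    using sub_decomposition[OF B zhz] by metis
  have r: "red xs" "red ys" using red_of_sub[OF BP BC] xs ys by auto
  have hc: "h \<in> carrier G" using xs r by simp
  have "z \<otimes> wprod xs = wprod ys \<otimes> inv z'" using xs(2) ys(2)[symmetric] z hc by (simp add: m_assoc)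
  note u = red_unique_aux[OF r z(1) C_inv[OF z(2)] this]
  obtain i x xs' where x: "xs = (i, x) # xs'" using h xs by (metis list.exhaust surj_pair wprod_Nil)
  then obtain y ys' where y: "ys = (i, y) # ys'" using u by (cases ys) auto
  obtain e where "e \<in> C" "z \<otimes> wprod (take 1 xs) = wprod (take 1 ys) \<otimes> e" using u by blast
  then have e: "e \<in> C" "z \<otimes> x = y \<otimes> e" using x y r by (auto simp: reduced_Cons)
  have xy: "x \<in> B i" "x \<noteq> \<one>" "y \<in> B i" using xs ys x y by (auto simp: reduced_Cons)
  have car: "x \<in> carrier G" "y \<in> carrier G" using subgroup.mem_carrier[OF B] xy by simp_all
  have "z \<otimes> x \<otimes> inv e = y" using e car by (simp add: m_assoc)
  then have "z \<otimes> x \<otimes> inv e \<in> B i" using xy(3) by simp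
  then show "z = \<one>" using sep[of i] xy(1,2) z(1) C_inv[OF e(1)] unfolding separated_def by blast
qed

text \<open>The essential case is a cyclically reduced power \<open>g [^] n = wprod ys\<close> with
  \<open>n \<ge> 2\<close>. Then \<open>g\<close> is the prefix of \<open>ys\<close> of its own
  length \<open>l\<close>, times some \<open>d \<in> C\<close>. One syllable further, where the
  period starts again, comparison of prefixes gives
  \<open>d \<otimes> y \<otimes> c \<in> B True\<close> for the first syllable \<open>y\<close> of
  \<open>ys\<close> and some \<open>c \<in> C\<close>, hence \<open>d = \<one>\<close>. A rotation
  of \<open>ys\<close> brings its first syllable into \<open>B True\<close>; this is why separation
  is asked of one factor only.\<close>

lemma sub_isolated:
  assumes B: "\<And>i. subgroup (B i) G" and BP: "\<And>i. B i \<subseteq> P i" and BC: "\<And>i. B i \<inter> C = {\<one>}"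
    and iso: "\<And>i. isolated_in (P i) C" and isoB: "\<And>i. isolated_in (P i) (B i)"
    and sep: "separated C (B True)"
  shows "isolated_in (carrier G) (generate G (B True \<union> B False))"
proof -
  let ?H = "generate G (B True \<union> B False)"
  have Bc: "B i \<subseteq> carrier G" for i using B by (simp add: subgroup.subset)
  then have H: "subgroup ?H G" by (intro generate_is_subgroup) auto
  have BH: "b \<in> ?H" if "b \<in> B i" for b i using that by (cases i) (auto intro: generate.incl)
  have conj_back: "g \<in> ?H" if "b \<in> B i" "g \<in> carrier G" "conj_by b g \<in> ?H" for b i g
  proof -
    have "inv b \<in> ?H" using BH[OF that(1)] H by (simp add: subgroup.m_inv_closed)
    then have "conj_by (inv b) (conj_by b g) \<in> ?H" using conj_by_mem_subgroup[OF H] that(3) by blast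
    then show ?thesis using conj_by_inv_cancel(1)[of b g] that subsetD[OF Bc that(1)] by simp
  qed
  have key: "g \<in> ?H"
    if ys: "reduced B {\<one>} ys" "cyclically_red ys" "fst (hd ys)"
      and g: "g \<in> carrier G" "n \<ge> 1" "g [^] (n::nat) = wprod ys" for g n ys
  proof -
    have ry: "red ys" using ys(2) cyclically_redD by blast
    have "g \<otimes> wprod ys = wprod ys \<otimes> g" using g by (metis nat_pow_Suc nat_pow_Suc2)
    moreover have "g \<notin> C"
      using g(3) wprod_red_notin_C[OF ry] cyclically_redD(2)[OF ys(2)] C_pow by metis
    ultimately obtain zs where zs: "cyclically_red zs" "g = wprod zs"
      using commute_cyclically_red[OF ys(2) g(1)] by metis
    define l where "l = length zs"
    have l: "l \<ge> 1" "zs \<noteq> []" "red zs" using cyclically_redD[OF zs(1)] by (auto simp: l_def)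
    have rz: "red (wpow n zs)" using red_wpow[OF zs(1)] .
    have "\<one> \<otimes> wprod (wpow n zs) = wprod ys \<otimes> \<one>"
      using wprod_wpow[OF zs(1)] zs(2) g ry by simp
    note u = red_unique_aux[OF rz ry C_one C_one this]
    have len: "length ys = n * l" using u by (metis length_map length_wpow l_def)
    show ?thesis
    proof (cases "n = 1")
      case True
      then show ?thesis using g ys(1) wprod_mem_generate[of ys B] by (auto simp: reduced_def)
    next
      case False
      \<comment> \<open>The syllable with index \<open>l\<close> exists only if there is a second
        period; \<open>n = 1\<close> has been dealt with.\<close>
      then obtain n' where n: "n = Suc (Suc n')" using g(2)
        by (metis One_nat_def Suc_le_D old.nat.exhaust)
      have c: "wprod (take k ys) \<in> carrier G" for k using red_take[OF ry] by simp
      obtain d where d: "d \<in> C" "\<one> \<otimes> wprod (take l (wpow n zs)) = wprod (take l ys) \<otimes> d"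
        using u by blast
      have gd: "g = wprod (take l ys) \<otimes> d" using d n zs(2) l by (simp add: l_def)
      obtain i x zs' where z: "zs = (i, x) # zs'" using l(2) by (metis list.exhaust surj_pair)
      obtain i' y ys' where y: "ys = (i', y) # ys'"
        using cyclically_redD(2)[OF ys(2)] by (metis list.exhaust surj_pair)
      have i': "i' = True" using ys(3) y by simp
      have "map fst (wpow n zs) \<noteq> []" "hd (map fst (wpow n zs)) = i" using n z by auto
      then have i: "i = True" using u y i' by auto
      have x: "x \<in> P True" and xc: "x \<in> carrier G" using l(3) z i by (auto simp: reduced_Cons)
      have yB: "y \<in> B True" "y \<noteq> \<one>" and yc: "y \<in> carrier G"
        using ys(1) y i' Bc by (auto simp: reduced_Cons)
      obtain e where "e \<in> C" "\<one> \<otimes> wprod (take 1 (wpow n zs)) = wprod (take 1 ys) \<otimes> e"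
        using u by blast
      then have e: "e \<in> C" "x = y \<otimes> e" using z y xc yc n by auto
      obtain f where f: "f \<in> C"
          "\<one> \<otimes> wprod (take (Suc l) (wpow n zs)) = wprod (take (Suc l) ys) \<otimes> f"
        using u by blast
      have "take (Suc l) (wpow n zs) = zs @ [(i, x)]" using n z by (simp add: l_def)
      moreover have "red (zs @ [(i, x)])"
        using calculation red_take[OF rz, of "Suc l"] by simp
      ultimately have gx: "g \<otimes> x = wprod (take (Suc l) ys) \<otimes> f"
        using f zs(2) wprod_snoc(1)[of zs i x] g(1) xc by simp
      have "l < length ys" using len n l by simp
      then have tk: "take (Suc l) ys = take l ys @ [ys ! l]" by (rule take_Suc_conv_app_nth)
      obtain i2 y2 where y2: "ys ! l = (i2, y2)" by force
      have yl: "y2 \<in> B i2" using ys(1) \<open>l < length ys\<close> y2 by (metis reduced_def DiffD1 fst_conv nth_mem snd_conv)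
      have y2c: "y2 \<in> carrier G" using yl Bc by blast
      have "i2 = fst (wpow n zs ! l)"
        using u \<open>l < length ys\<close> y2 len by (metis fst_conv l_def length_wpow nth_map)
      also have "\<dots> = i" using n z by (simp add: l_def nth_append)
      finally have i2: "i2 = True" using i by simp
      have "wprod (take (Suc l) ys) = wprod (take l ys) \<otimes> y2"
        using wprod_snoc(1)[of "take l ys" i2 y2] red_take[OF ry, of "Suc l"] tk y2 by simp
      then have "wprod (take l ys) \<otimes> (d \<otimes> (y \<otimes> e)) = wprod (take l ys) \<otimes> (y2 \<otimes> f)"
        using gx gd e(2) c d(1) e(1) f(1) yc y2c by (simp add: m_assoc)
      then have "inv (wprod (take l ys)) \<otimes> (wprod (take l ys) \<otimes> (d \<otimes> (y \<otimes> e)))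
          = inv (wprod (take l ys)) \<otimes> (wprod (take l ys) \<otimes> (y2 \<otimes> f))" by simp
      then have "d \<otimes> (y \<otimes> e) = y2 \<otimes> f"
        using c d(1) e(1) f(1) yc y2c by simp
      then have "d \<otimes> y \<otimes> (e \<otimes> inv f) = y2"
        using d(1) e(1) f(1) yc y2c by (simp flip: m_assoc) (simp add: m_assoc)
      then have "d \<otimes> y \<otimes> (e \<otimes> inv f) \<in> B True" using yl i2 by simp
      moreover have "e \<otimes> inv f \<in> C" using e(1) f(1) by simp
      ultimately have "d = \<one>" using sep yB d(1) unfolding separated_def by blast
      then have "g = wprod (take l ys)" using gd c by simp
      moreover have "\<forall>x\<in>set (take l ys). snd x \<in> B (fst x)"
        using ys(1) by (auto simp: reduced_def dest: in_set_takeD)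
      ultimately show ?thesis using wprod_mem_generate by blast
    qed
  qed
  have main: "g \<in> ?H" if "reduced B {\<one>} ys" "g \<in> carrier G" "n \<ge> 1" "g [^] (n::nat) = wprod ys" for g n ys
    using that
  proof (induction "length ys" arbitrary: ys g rule: less_induct)
    case less
    note ys = less.prems(1) and g = less.prems(2-4)
    have ry: "red ys" using red_of_sub[OF BP BC ys] .
    show ?case
    proof (cases "length ys \<le> 1")
      case True
      have "\<exists>i. g [^] n \<in> B i"
      proof (cases ys)
        case Nil
        then show ?thesis using g subgroup.one_closed[OF B] by auto
      next
        case (Cons a ys')
        then have "ys = [a]" using True by simp
        then show ?thesis using ys g(3) Bc by (force simp: reduced_Cons)
      qed
      then obtain i where i: "g [^] n \<in> B i" by blast
      then have "g \<in> P i" using isolated_inD[OF P_isolated[OF iso] g(1)] g(2) BP by blast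
      then show ?thesis using isolated_inD[OF isoB _ i g(2)] BH by blast
    next
      case long: False
      then obtain i b tl where y: "ys = (i, b) # tl" by (cases ys) auto
      have "tl \<noteq> []" using long y by auto
      then obtain mid j b' where tl: "tl = mid @ [(j, b')]" by (metis append_butlast_last_id surj_pair)
      have rB: "reduced B {\<one>} mid" "b \<in> B i" "b' \<in> B j" "b \<noteq> \<one>"
        "reduced B {\<one>} (mid @ [(j, b')])" "i \<noteq> fst (hd (mid @ [(j, b')]))"
        using ys y tl by (auto simp: reduced_Cons reduced_append)
      have car: "b \<in> carrier G" "b' \<in> carrier G" using rB Bc by blast+
      have rm: "red mid" using red_of_sub[OF BP BC rB(1)] .
      have cm: "snd ` set mid \<subseteq> carrier G" using red_carrier[OF rm] .
      have cj: "conj_by b g [^] n = wprod (mid @ [(j, b')]) \<otimes> b"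
      proof -
        have "conj_by b g [^] n = inv b \<otimes> wprod ys \<otimes> b"
          using conj_by_pow[OF car(1) g(1), of n] g(3) by (simp add: conj_by_def)
        also have "\<dots> = wprod (mid @ [(j, b')]) \<otimes> b"
          using y tl car cm wprod_append[of mid "[(j, b')]"] by (simp add: m_assoc)
        finally show ?thesis .
      qed
      have gb: "conj_by b g \<in> carrier G" using g car by simp
      show ?thesis
      proof (cases "i = j")
        case True
        have cj': "conj_by b g [^] n = wprod mid \<otimes> (b' \<otimes> b)"
          using cj wprod_append[OF cm, of "[(j, b')]"] car wprod_red[OF rm] by (simp add: m_assoc)
        have bb: "b' \<otimes> b \<in> B j" using rB True B by (simp add: subgroup.m_closed)
        have "conj_by b g \<in> ?H"
        proof (cases "b' \<otimes> b = \<one>")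
          case t: True
          then show ?thesis using less.hyps[of mid "conj_by b g"] y tl rB(1) gb g(2) cj' wprod_red[OF rm] by simp
        next
          case False
          have "reduced B {\<one>} (mid @ [(j, b' \<otimes> b)])"
            using rB bb False by (auto simp: reduced_append reduced_Cons)
          moreover have "wprod (mid @ [(j, b' \<otimes> b)]) = conj_by b g [^] n"
            using cj' wprod_append[OF cm, of "[(j, b' \<otimes> b)]"] car by simp
          ultimately show ?thesis using less.hyps[of "mid @ [(j, b' \<otimes> b)]" "conj_by b g"] y tl gb g(2) by simp
        qed
        then show ?thesis using conj_back rB g(1) by blast
      next
        case False
        have cyc: "cyclically_red ys" using ry y tl False by (simp add: cyclically_red_def)
        show ?thesis
        proof (cases i)
          case True
          then show ?thesis using key[OF ys cyc _ g] y by simp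
        next
          case iF: False
          \<comment> \<open>Conjugation by the first syllable rotates the word so that it starts in
            \<open>B True\<close>.\<close>
          let ?w = "mid @ [(j, b')] @ [(i, b)]"
          have rw: "reduced B {\<one>} ?w"
            using rB False by (auto simp: reduced_append reduced_Cons)
          have "fst (hd ?w)" using rB(6) iF by (cases mid) auto
          moreover have "cyclically_red ?w"
            using red_of_sub[OF BP BC rw] calculation iF by (simp add: cyclically_red_def)
          moreover have "conj_by b g [^] n = wprod ?w"
            using cj wprod_append[of "mid @ [(j, b')]" "[(i, b)]"] cm car by simp
          ultimately have "conj_by b g \<in> ?H" using key[OF rw _ _ gb g(2)] by blast
          then show ?thesis using conj_back rB g(1) by blast
        qed
      qed
    qed
  qed
  show ?thesis
    unfolding isolated_in_def
  proof (intro ballI allI impI)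
    fix g and n :: nat assume g: "g \<in> carrier G" "n \<ge> 1" and gn: "g [^] n \<in> ?H"
    obtain ys where "reduced B {\<one>} ys" "g [^] n = wprod ys" using sub_decomposition[OF B gn] by metis
    then show "g \<in> ?H" using main g by blast
  qed
qed

end

subsection \<open>Evaluation of words and homomorphisms out of presented groups\<close>

definition gw_eval :: "('g, 'm) monoid_scheme \<Rightarrow> ('a \<Rightarrow> 'g) \<Rightarrow> 'a gword \<Rightarrow> 'g" where
  "gw_eval G f w =
     foldr (\<lambda>a y. (if snd a then f (fst a) else inv\<^bsub>G\<^esub> (f (fst a))) \<otimes>\<^bsub>G\<^esub> y) w \<one>\<^bsub>G\<^esub>"

lemma gw_eval_Nil [simp]: "gw_eval G f [] = \<one>\<^bsub>G\<^esub>"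
  and gw_eval_Cons [simp]: "gw_eval G f ((x, b) # w) =
    (if b then f x else inv\<^bsub>G\<^esub> (f x)) \<otimes>\<^bsub>G\<^esub> gw_eval G f w"
  by (simp_all add: gw_eval_def)

definition gw_inv :: "'a gword \<Rightarrow> 'a gword" where
  "gw_inv w = rev (map (\<lambda>(x, b). (x, \<not> b)) w)"

lemma gw_inv_Nil [simp]: "gw_inv [] = []"
  and gw_inv_Cons: "gw_inv ((x, b) # w) = gw_inv w @ [(x, \<not> b)]"
  by (simp_all add: gw_inv_def)

lemma gwords_Nil [simp]: "[] \<in> gwords X"
  and gwords_Cons [simp]: "(x, b) # w \<in> gwords X \<longleftrightarrow> x \<in> X \<and> w \<in> gwords X"
  and gwords_append [simp]: "u @ v \<in> gwords X \<longleftrightarrow> u \<in> gwords X \<and> v \<in> gwords X"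
  by (auto simp: gwords_def)

lemma gw_inv_gwords [simp]: "gw_inv w \<in> gwords X \<longleftrightarrow> w \<in> gwords X"
  by (induction w) (auto simp: gw_inv_Cons)

lemma gwords_mono: "X \<subseteq> Y \<Longrightarrow> gwords X \<subseteq> gwords Y"
  by (auto simp: gwords_def)

lemma gwords_iff: "w \<in> gwords X \<longleftrightarrow> fst ` set w \<subseteq> X"
  by (auto simp: gwords_def)

lemma gw_eval_cong:
  "w \<in> gwords X \<Longrightarrow> (\<And>x. x \<in> X \<Longrightarrow> f x = g x) \<Longrightarrow> gw_eval G f w = gw_eval G g w"
  by (induction w) auto

context group
begin

lemma gw_eval_closed [simp]:
  "w \<in> gwords X \<Longrightarrow> f \<in> X \<rightarrow> carrier G \<Longrightarrow> gw_eval G f w \<in> carrier G"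
proof (induction w)
  case (Cons a w)
  then show ?case by (cases a) (auto simp: Pi_iff)
qed simp

lemma gw_eval_append:
  assumes "u \<in> gwords X" "v \<in> gwords X" "f \<in> X \<rightarrow> carrier G"
  shows "gw_eval G f (u @ v) = gw_eval G f u \<otimes> gw_eval G f v"
  using assms(1)
proof (induction u)
  case Nil
  then show ?case using assms by simp
next
  case (Cons a u)
  obtain x b where a: "a = (x, b)" by force
  have "gw_eval G f u \<in> carrier G" "gw_eval G f v \<in> carrier G" "f x \<in> carrier G"
    using assms Cons.prems a by (auto simp: Pi_iff)
  then show ?case using Cons a by (simp add: m_assoc)
qed

lemma gw_eval_inv:
  assumes "w \<in> gwords X" "f \<in> X \<rightarrow> carrier G"
  shows "gw_eval G f (gw_inv w) = inv (gw_eval G f w)"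
  using assms(1)
proof (induction w)
  case (Cons a w)
  obtain x b where a: "a = (x, b)" by force
  have "gw_eval G f w \<in> carrier G" "f x \<in> carrier G" and w: "w \<in> gwords X" "x \<in> X"
    using assms Cons.prems a by (auto simp: Pi_iff)
  then show ?case
    using Cons a gw_eval_append[of "gw_inv w" X "[(x, \<not> b)]" f] assms
    by (simp add: gw_inv_Cons inv_mult_group)
qed simp

lemma gw_eval_hom:
  assumes "group H" "h \<in> hom G H" "w \<in> gwords X" "f \<in> X \<rightarrow> carrier G"
  shows "gw_eval H (\<lambda>x. h (f x)) w = h (gw_eval G f w)"
  using assms(3)
proof (induction w)
  interpret h: group_hom G H h
    using assms(1,2) by (simp add: group_hom_def group_hom_axioms_def group_axioms)
  {
    case Nil
    then show ?case by simp
  next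
    case (Cons a w)
    obtain x b where a: "a = (x, b)" by force
    have "gw_eval G f w \<in> carrier G" "f x \<in> carrier G"
      using assms Cons.prems a by (auto simp: Pi_iff)
    then show ?case using Cons a by simp
  }
qed

lemma pres_cong_gw_eval:
  assumes f: "f \<in> X \<rightarrow> carrier G"
    and rel: "\<And>u v. (u, v) \<in> R \<Longrightarrow> u \<in> gwords X \<Longrightarrow> v \<in> gwords X \<Longrightarrow> gw_eval G f u = gw_eval G f v"
    and "pres_cong X R u v"
  shows "gw_eval G f u = gw_eval G f v"
  using assms(3)
proof (induction rule: pres_cong.induct)
  case (append u u' v v')
  then show ?case using pres_cong_gwords gw_eval_append f by metis
next
  case (cancel x b)
  then have "f x \<in> carrier G" using f by blast
  then show ?case by simp
qed (use rel in auto)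

lemma gw_eval_single:
  assumes "w \<in> gwords {x}" "f x \<in> carrier G"
  shows "gw_eval G f w = f x [^] (\<Sum>a\<leftarrow>w. if snd a then 1 else - 1 :: int)"
  using assms(1)
proof (induction w)
  case (Cons a w)
  obtain b where a: "a = (x, b)" using Cons.prems by (cases a) auto
  have "gw_eval G f w = f x [^] (\<Sum>a\<leftarrow>w. if snd a then 1 else - 1 :: int)" using Cons a by simp
  moreover have "f x [^] (1 + n) = f x \<otimes> f x [^] (n::int)" for n
    using int_pow_mult[OF assms(2), of 1 n] assms(2) by simp
  moreover have "f x [^] (- 1 + n) = inv (f x) \<otimes> f x [^] (n::int)" for n
    using int_pow_mult[OF assms(2), of "- 1" n] assms(2) by (simp add: int_pow_neg)
  ultimately show ?case using a by simp
qed simp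

end

lemma carrier_presented: "carrier (presented_group X R) = pres_class X R ` gwords X"
  and one_presented: "\<one>\<^bsub>presented_group X R\<^esub> = pres_class X R []"
  by (simp_all add: presented_group_def)

lemma pres_class_closed [simp]:
  "w \<in> gwords X \<Longrightarrow> pres_class X R w \<in> carrier (presented_group X R)"
  by (simp add: carrier_presented)

lemma pres_cong_cancel_inv:
  "w \<in> gwords X \<Longrightarrow> pres_cong X R (w @ gw_inv w) []"
proof (induction w)
  case Nil
  then show ?case by (simp add: pres_cong.refl)
next
  case (Cons a w)
  obtain x b where a: "a = (x, b)" by force
  have x: "x \<in> X" "w \<in> gwords X" using Cons.prems a by auto
  have "pres_cong X R ([(x, b)] @ (w @ gw_inv w) @ [(x, \<not> b)]) ([(x, b)] @ [] @ [(x, \<not> b)])"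
    using x Cons.IH by (intro pres_cong.append pres_cong.refl) auto
  then have "pres_cong X R (a # w @ gw_inv (a # w)) [(x, b), (x, \<not> b)]"
    using a by (simp add: gw_inv_Cons)
  then show ?case using pres_cong.cancel[OF x(1)] pres_cong.trans by fastforce
qed

lemma inv_pres_class:
  assumes "w \<in> gwords X"
  shows "inv\<^bsub>presented_group X R\<^esub> (pres_class X R w) = pres_class X R (gw_inv w)"
proof -
  interpret Q: group "presented_group X R" by (rule group_presented_group)
  have "pres_class X R w \<otimes>\<^bsub>presented_group X R\<^esub> pres_class X R (gw_inv w) = \<one>\<^bsub>presented_group X R\<^esub>"
    using assms pres_cong_cancel_inv[OF assms]
    by (simp add: presented_group_mult one_presented pres_class_eq_iff)
  from Q.inv_equality[OF Q.inv_comm[OF this]] show ?thesis using assms by simp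
qed

lemma pres_cong_iff_inv:
  assumes "u \<in> gwords X" "v \<in> gwords X"
  shows "pres_cong X R u v \<longleftrightarrow> pres_cong X R (gw_inv v @ u) []"
proof -
  interpret Q: group "presented_group X R" by (rule group_presented_group)
  have c: "pres_class X R u \<in> carrier (presented_group X R)"
    "pres_class X R v \<in> carrier (presented_group X R)" using assms by auto
  have "pres_cong X R (gw_inv v @ u) [] \<longleftrightarrow>
      inv\<^bsub>presented_group X R\<^esub> (pres_class X R v) \<otimes>\<^bsub>presented_group X R\<^esub> pres_class X R u
        = \<one>\<^bsub>presented_group X R\<^esub>"
    using assms by (simp add: inv_pres_class presented_group_mult one_presented pres_class_eq_iff)
  also have "\<dots> \<longleftrightarrow> pres_class X R u = pres_class X R v"
    using c Q.inv_solve_left[of "\<one>\<^bsub>presented_group X R\<^esub>" "pres_class X R v" "pres_class X R u"]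
    by (metis Q.inv_solve_left Q.one_closed Q.r_one)
  finally show ?thesis using assms by (simp add: pres_class_eq_iff)
qed

lemma gw_eval_pres_class:
  assumes "w \<in> gwords U" "U \<subseteq> X"
  shows "gw_eval (presented_group X R) (\<lambda>x. pres_class X R [(x, True)]) w = pres_class X R w"
  using assms(1)
proof (induction w)
  case Nil
  then show ?case by (simp add: one_presented)
next
  case (Cons a w)
  obtain x b where a: "a = (x, b)" by force
  have x: "x \<in> X" "w \<in> gwords X" using Cons.prems a assms(2) gwords_mono by auto
  have "(if b then pres_class X R [(x, True)]
        else inv\<^bsub>presented_group X R\<^esub> (pres_class X R [(x, True)])) = pres_class X R [(x, b)]"
    using x by (simp add: inv_pres_class gw_inv_Cons)
  then show ?case
    using Cons a x presented_group_mult[of "[(x, b)]" X w R] by simp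
qed

lemma wpow_gwords: "w \<in> gwords X \<Longrightarrow> wpow n w \<in> gwords X"
  by (induction n) auto

lemma pres_class_pow:
  assumes "w \<in> gwords X"
  shows "pres_class X R w [^]\<^bsub>presented_group X R\<^esub> (n::nat) = pres_class X R (wpow n w)"
proof (induction n)
  case 0
  then show ?case by (simp add: one_presented)
next
  case (Suc n)
  interpret Q: group "presented_group X R" by (rule group_presented_group)
  show ?case
    using Suc assms Q.nat_pow_Suc2[of "pres_class X R w" n]
    by (simp add: presented_group_mult wpow_gwords del: Q.nat_pow_Suc nat_pow_Suc)
qed

lemma presented_lift:
  assumes "group G" and f: "f \<in> X \<rightarrow> carrier G"
    and rel: "\<And>u v. (u, v) \<in> R \<Longrightarrow> u \<in> gwords X \<Longrightarrow> v \<in> gwords X \<Longrightarrow> gw_eval G f u = gw_eval G f v"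
  obtains h where "h \<in> hom (presented_group X R) G"
    "\<And>w. w \<in> gwords X \<Longrightarrow> h (pres_class X R w) = gw_eval G f w"
proof -
  interpret G: group G by fact
  define h where "h A = gw_eval G f (SOME w. w \<in> A)" for A
  have h: "h (pres_class X R w) = gw_eval G f w" if "w \<in> gwords X" for w
  proof -
    have "w \<in> pres_class X R w" using that by (simp add: pres_class_def pres_cong.refl)
    then have "(SOME v. v \<in> pres_class X R w) \<in> pres_class X R w" by (rule someI)
    then show ?thesis
      using G.pres_cong_gw_eval[OF f rel] by (auto simp: h_def pres_class_def)
  qed
  moreover have "h \<in> hom (presented_group X R) G"
    using h G.gw_eval_append[OF _ _ f] G.gw_eval_closed[OF _ f]
    by (auto simp: hom_def carrier_presented presented_group_mult)
  ultimately show ?thesis using that by blast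
qed

lemma pres_cong_mono:
  assumes "pres_cong U R u v" "U \<subseteq> W"
  shows "pres_cong W R u v"
  using assms(1)
  by (induction rule: pres_cong.induct)
    (use assms(2) gwords_mono[OF assms(2)] in \<open>auto intro: pres_cong.intros\<close>)

subsection \<open>Van der Waerden's action on normal forms\<close>

locale amalgam_data =
  fixes K :: "('k, 'z) monoid_scheme" and G :: "bool \<Rightarrow> ('g, 'y) monoid_scheme"
    and f :: "bool \<Rightarrow> 'k \<Rightarrow> 'g"
  assumes K: "group K" and G: "\<And>i. group (G i)"
    and hom: "\<And>i. f i \<in> hom K (G i)" and inj: "\<And>i. inj_on (f i) (carrier K)"
begin

definition img :: "bool \<Rightarrow> 'g set" where "img i = f i ` carrier K"

definition pre :: "bool \<Rightarrow> 'g \<Rightarrow> 'k" where "pre i = inv_into (carrier K) (f i)"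

definition cst :: "bool \<Rightarrow> 'g \<Rightarrow> 'g set" where "cst i g = img i #>\<^bsub>G i\<^esub> g"

definition rep :: "'g set \<Rightarrow> 'g" where "rep Y = (SOME y. y \<in> Y)"

definition forms :: "(bool \<times> 'g set) list set" where
  "forms = {l. (\<forall>x\<in>set l. \<exists>g\<in>carrier (G (fst x)) - img (fst x). snd x = cst (fst x) g) \<and>
     successively (\<lambda>x y. fst x \<noteq> fst y) l}"

text \<open>The pair \<open>(k, l)\<close> stands for \<open>k\<close> times the product of the
  representatives of the cosets in \<open>l\<close>, the normal form of an element of the amalgam;
  cosets are right cosets because the factor from \<open>K\<close> is on the left.\<close>

definition Om :: "('k \<times> (bool \<times> 'g set) list) set" where
  "Om = carrier K \<times> forms"

definition tails :: "bool \<Rightarrow> (bool \<times> 'g set) list set" where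
  "tails i = {l \<in> forms. l \<noteq> [] \<longrightarrow> fst (hd l) \<noteq> i}"

text \<open>\<open>join i\<close> and \<open>split i\<close> are mutually inverse bijections between
  \<open>carrier (G i) \<times> tails i\<close> and \<open>Om\<close>. Thus \<open>G i\<close> can
  act by left multiplication on the first coordinate, and the laws of an action need no case
  distinction on cancellation.\<close>

definition join :: "bool \<Rightarrow> 'g \<times> (bool \<times> 'g set) list \<Rightarrow> 'k \<times> (bool \<times> 'g set) list" where
  "join i = (\<lambda>(g, l). if g \<in> img i then (pre i g, l)
     else (pre i (g \<otimes>\<^bsub>G i\<^esub> inv\<^bsub>G i\<^esub> (rep (cst i g))), (i, cst i g) # l))"

definition split :: "bool \<Rightarrow> 'k \<times> (bool \<times> 'g set) list \<Rightarrow> 'g \<times> (bool \<times> 'g set) list" where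
  "split i = (\<lambda>(k, l). if l \<noteq> [] \<and> fst (hd l) = i then (f i k \<otimes>\<^bsub>G i\<^esub> rep (snd (hd l)), tl l)
     else (f i k, l))"

definition act :: "bool \<Rightarrow> 'g \<Rightarrow> 'k \<times> (bool \<times> 'g set) list \<Rightarrow> 'k \<times> (bool \<times> 'g set) list" where
  "act i p w = join i (p \<otimes>\<^bsub>G i\<^esub> fst (split i w), snd (split i w))"

lemma img_subgroup: "subgroup (img i) (G i)"
proof -
  interpret group_hom K "G i" "f i" using K G hom by (simp add: group_hom_def group_hom_axioms_def)
  show ?thesis unfolding img_def by (rule img_is_subgroup)
qed

lemma f_closed: "k \<in> carrier K \<Longrightarrow> f i k \<in> carrier (G i)"
  using hom by (auto simp: hom_def)

lemma f_img: "k \<in> carrier K \<Longrightarrow> f i k \<in> img i"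
  by (simp add: img_def)

lemma pre_f [simp]: "k \<in> carrier K \<Longrightarrow> pre i (f i k) = k"
  using inj by (simp add: pre_def)

lemma f_pre [simp]: "g \<in> img i \<Longrightarrow> f i (pre i g) = g"
  by (simp add: img_def pre_def f_inv_into_f)

lemma pre_closed: "g \<in> img i \<Longrightarrow> pre i g \<in> carrier K"
  by (simp add: img_def pre_def inv_into_into)

lemma rep_cst:
  assumes "g \<in> carrier (G i)"
  shows "\<exists>x\<in>img i. rep (cst i g) = x \<otimes>\<^bsub>G i\<^esub> g"
proof -
  interpret Gi: group "G i" by (rule G)
  have "g \<in> cst i g" unfolding cst_def using Gi.rcos_self[OF assms img_subgroup] .
  then have "rep (cst i g) \<in> cst i g" unfolding rep_def by (rule someI)
  then show ?thesis by (auto simp: cst_def r_coset_def)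
qed

lemma cst_mult_img:
  assumes "g \<in> carrier (G i)" "x \<in> img i"
  shows "cst i (x \<otimes>\<^bsub>G i\<^esub> g) = cst i g"
proof -
  interpret Gi: group "G i" by (rule G)
  have s: "img i \<subseteq> carrier (G i)" using img_subgroup by (rule subgroup.subset)
  then show ?thesis unfolding cst_def
    using assms Gi.coset_mult_assoc[OF s, of x g] Gi.coset_join2[OF _ img_subgroup assms(2)] by auto
qed

lemma img_mult_iff:
  assumes "g \<in> carrier (G i)" "x \<in> img i"
  shows "x \<otimes>\<^bsub>G i\<^esub> g \<in> img i \<longleftrightarrow> g \<in> img i"
proof -
  interpret Gi: group "G i" by (rule G)
  have xc: "x \<in> carrier (G i)" using img_subgroup assms(2) by (rule subgroup.mem_carrier)
  show ?thesis
  proof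
    assume "x \<otimes>\<^bsub>G i\<^esub> g \<in> img i"
    then have "inv\<^bsub>G i\<^esub> x \<otimes>\<^bsub>G i\<^esub> (x \<otimes>\<^bsub>G i\<^esub> g) \<in> img i"
      using assms img_subgroup by (meson subgroup.m_closed subgroup.m_inv_closed)
    then show "g \<in> img i" using assms xc by simp
  qed (use assms img_subgroup subgroup.m_closed in metis)
qed

lemma split_mem:
  assumes "w \<in> Om"
  shows "fst (split i w) \<in> carrier (G i)" "snd (split i w) \<in> tails i"
proof -
  interpret Gi: group "G i" by (rule G)
  obtain k l where w: "w = (k, l)" "k \<in> carrier K" "l \<in> forms" using assms by (auto simp: Om_def)
  show "fst (split i w) \<in> carrier (G i)"
  proof (cases "l \<noteq> [] \<and> fst (hd l) = i")
    case True
    then obtain g where g: "g \<in> carrier (G i)" "snd (hd l) = cst i g"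
      using w(3) by (auto simp: forms_def dest!: bspec[of _ _ "hd l"])
    then have "rep (snd (hd l)) \<in> carrier (G i)"
      using rep_cst[OF g(1)] img_subgroup subgroup.mem_carrier by fastforce
    then show ?thesis using True w f_closed by (simp add: split_def)
  next
    case False
    then show ?thesis using w f_closed by (auto simp: split_def)
  qed
  show "snd (split i w) \<in> tails i"
    using w by (cases l) (auto simp: split_def tails_def forms_def successively_Cons)
qed

lemma join_mem:
  assumes "g \<in> carrier (G i)" "l \<in> tails i"
  shows "join i (g, l) \<in> Om"
proof -
  interpret Gi: group "G i" by (rule G)
  obtain x where x: "x \<in> img i" "rep (cst i g) = x \<otimes>\<^bsub>G i\<^esub> g" using rep_cst[OF assms(1)] by blast
  have xc: "x \<in> carrier (G i)" using img_subgroup x(1) by (rule subgroup.mem_carrier)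
  have "g \<otimes>\<^bsub>G i\<^esub> inv\<^bsub>G i\<^esub> (rep (cst i g)) = inv\<^bsub>G i\<^esub> x"
    using x xc assms by (simp add: Gi.inv_mult_group)
  moreover have "inv\<^bsub>G i\<^esub> x \<in> img i" using x img_subgroup by (simp add: subgroup.m_inv_closed)
  ultimately show ?thesis using assms
    by (auto simp: join_def Om_def tails_def forms_def successively_Cons pre_closed)
qed

lemma split_join:
  assumes "g \<in> carrier (G i)" "l \<in> tails i"
  shows "split i (join i (g, l)) = (g, l)"
proof -
  interpret Gi: group "G i" by (rule G)
  obtain x where x: "x \<in> img i" "rep (cst i g) = x \<otimes>\<^bsub>G i\<^esub> g" using rep_cst[OF assms(1)] by blast
  have xc: "x \<in> carrier (G i)" using img_subgroup x(1) by (rule subgroup.mem_carrier)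
  have "g \<otimes>\<^bsub>G i\<^esub> inv\<^bsub>G i\<^esub> (rep (cst i g)) = inv\<^bsub>G i\<^esub> x"
    using x xc assms by (simp add: Gi.inv_mult_group)
  moreover have "inv\<^bsub>G i\<^esub> x \<in> img i" using x img_subgroup by (simp add: subgroup.m_inv_closed)
  ultimately show ?thesis using assms x xc
    by (auto simp: join_def split_def tails_def)
qed

lemma join_split:
  assumes "w \<in> Om"
  shows "join i (split i w) = w"
proof -
  interpret Gi: group "G i" by (rule G)
  obtain k l where w: "w = (k, l)" "k \<in> carrier K" "l \<in> forms" using assms by (auto simp: Om_def)
  show ?thesis
  proof (cases "l \<noteq> [] \<and> fst (hd l) = i")
    case True
    then obtain g where g: "g \<in> carrier (G i)" "g \<notin> img i" "snd (hd l) = cst i g"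
      using w(3) by (auto simp: forms_def dest!: bspec[of _ _ "hd l"])
    obtain x where x: "x \<in> img i" "rep (cst i g) = x \<otimes>\<^bsub>G i\<^esub> g" using rep_cst[OF g(1)] by blast
    have xc: "x \<in> carrier (G i)" using img_subgroup x(1) by (rule subgroup.mem_carrier)
    let ?h = "f i k \<otimes>\<^bsub>G i\<^esub> (x \<otimes>\<^bsub>G i\<^esub> g)"
    have h: "?h \<notin> img i" "cst i ?h = cst i g"
      using x xc g f_img[OF w(2)] by (simp_all add: img_mult_iff cst_mult_img)
    have "?h \<otimes>\<^bsub>G i\<^esub> inv\<^bsub>G i\<^esub> (rep (cst i ?h)) = f i k"
      using h x xc g f_closed[OF w(2), of i] by (simp add: Gi.m_assoc)
    then have "join i (?h, tl l) = (k, (i, cst i g) # tl l)"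
      using h w(2) by (simp add: join_def)
    moreover have "hd l = (i, cst i g)" by (rule prod_eqI) (use True g(3) in simp_all)
    then have "(i, cst i g) # tl l = l" using True list.collapse[of l] by simp
    moreover have "split i w = (f i k \<otimes>\<^bsub>G i\<^esub> rep (snd (hd l)), tl l)"
      unfolding w(1) split_def prod.case if_P[OF True] ..
    then have "split i w = (?h, tl l)" unfolding g(3) x(2) .
    ultimately show ?thesis unfolding w(1) by simp
  next
    case False
    then show ?thesis using w f_img by (auto simp: split_def join_def)
  qed
qed

lemma act_mem:
  assumes "p \<in> carrier (G i)" "w \<in> Om"
  shows "act i p w \<in> Om"
proof -
  interpret Gi: group "G i" by (rule G)
  show ?thesis using join_mem split_mem[OF assms(2)] assms(1) by (simp add: act_def)
qed

lemma act_mult: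
  assumes "p \<in> carrier (G i)" "q \<in> carrier (G i)" "w \<in> Om"
  shows "act i (p \<otimes>\<^bsub>G i\<^esub> q) w = act i p (act i q w)"
proof -
  interpret Gi: group "G i" by (rule G)
  show ?thesis using split_join split_mem[OF assms(3)] assms(1,2) by (simp add: act_def Gi.m_assoc)
qed

lemma act_one:
  assumes "w \<in> Om" shows "act i \<one>\<^bsub>G i\<^esub> w = w"
proof -
  interpret Gi: group "G i" by (rule G)
  show ?thesis using split_mem[OF assms] join_split[OF assms] by (simp add: act_def)
qed

text \<open>Restricted to \<open>Om\<close> because the elements of \<open>BijGroup Om\<close> are
  extensional functions.\<close>

definition act_hom :: "bool \<Rightarrow> 'g \<Rightarrow> 'k \<times> (bool \<times> 'g set) list \<Rightarrow> 'k \<times> (bool \<times> 'g set) list" where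
  "act_hom i p = restrict (act i p) Om"

lemma act_hom: "act_hom i \<in> hom (G i) (BijGroup Om)"
proof -
  interpret Gi: group "G i" by (rule G)
  have bij: "act_hom i p \<in> Bij Om" if p: "p \<in> carrier (G i)" for p
  proof -
    have "bij_betw (act i p) Om Om"
    proof (rule bij_betw_byWitness[of _ "act i (inv\<^bsub>G i\<^esub> p)"])
      show "\<forall>w\<in>Om. act i (inv\<^bsub>G i\<^esub> p) (act i p w) = w" "\<forall>w\<in>Om. act i p (act i (inv\<^bsub>G i\<^esub> p) w) = w"
        using p act_mult[symmetric] act_one by simp_all
    qed (use p act_mem in auto)
    then show ?thesis by (simp add: Bij_def act_hom_def bij_betw_cong[of Om "restrict (act i p) Om"])
  qed
  moreover have "act_hom i (p \<otimes>\<^bsub>G i\<^esub> q) = compose Om (act_hom i p) (act_hom i q)"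
    if "p \<in> carrier (G i)" "q \<in> carrier (G i)" for p q
    using that by (auto simp: act_hom_def compose_def fun_eq_iff act_mult act_mem)
  ultimately show ?thesis by (auto simp: hom_def BijGroup_def)
qed

text \<open>The formula does not depend on \<open>i\<close>, so the actions of the two factors agree
  on \<open>K\<close> and fit together to an action of the amalgam.\<close>

lemma act_f:
  assumes "k0 \<in> carrier K" "k \<in> carrier K" "l \<in> forms"
  shows "act i (f i k0) (k, l) = (k0 \<otimes>\<^bsub>K\<^esub> k, l)"
proof -
  interpret K: group K by (rule K)
  interpret Gi: group "G i" by (rule G)
  have w: "(k0 \<otimes>\<^bsub>K\<^esub> k, l) \<in> Om" using assms by (simp add: Om_def)
  have w0: "(k, l) \<in> Om" using assms by (simp add: Om_def)
  have "(f i k0 \<otimes>\<^bsub>G i\<^esub> fst (split i (k, l)), snd (split i (k, l))) = split i (k0 \<otimes>\<^bsub>K\<^esub> k, l)"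
  proof (cases "l \<noteq> [] \<and> fst (hd l) = i")
    case True
    then obtain g where g: "g \<in> carrier (G i)" "snd (hd l) = cst i g"
      using assms(3) by (auto simp: forms_def dest!: bspec[of _ _ "hd l"])
    then have "rep (snd (hd l)) \<in> carrier (G i)"
      using rep_cst[OF g(1)] img_subgroup subgroup.mem_carrier by fastforce
    then show ?thesis using True assms f_closed by (simp add: split_def Gi.m_assoc hom_mult[OF hom])
  next
    case False
    then show ?thesis using assms by (auto simp: split_def hom_mult[OF hom])
  qed
  then show ?thesis using join_split[OF w] by (simp add: act_def)
qed

lemma act_hom_agree: "k \<in> carrier K \<Longrightarrow> act_hom i (f i k) = act_hom j (f j k)"
  by (auto simp: act_hom_def fun_eq_iff Om_def act_f)

lemma base_mem: "(\<one>\<^bsub>K\<^esub>, []) \<in> Om"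
  using K by (simp add: Om_def forms_def group.is_monoid monoid.one_closed)

text \<open>The image of the base point under \<open>g\<close> is \<open>join i (g, [])\<close>,
  from which \<open>split i\<close> recovers \<open>g\<close>. This yields injectivity of each
  factor into the amalgam.\<close>

lemma act_hom_base_faithful:
  assumes "g \<in> carrier (G i)" "act_hom i g (\<one>\<^bsub>K\<^esub>, []) = (\<one>\<^bsub>K\<^esub>, [])"
  shows "g = \<one>\<^bsub>G i\<^esub>"
proof -
  interpret K: group K by (rule K)
  interpret Gi: group "G i" by (rule G)
  have f1: "f i \<one>\<^bsub>K\<^esub> = \<one>\<^bsub>G i\<^esub>" using hom K G by (simp add: hom_one)
  have s: "split i (\<one>\<^bsub>K\<^esub>, []) = (\<one>\<^bsub>G i\<^esub>, [])" using f1 by (simp add: split_def)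
  have "join i (g, []) = (\<one>\<^bsub>K\<^esub>, [])"
    using assms base_mem s by (simp add: act_hom_def act_def)
  moreover have "[] \<in> tails i" by (simp add: tails_def forms_def)
  ultimately show ?thesis using split_join[OF assms(1)] s by (metis fst_conv)
qed

text \<open>Applied syllable by syllable to the base point, this shows that non-empty reduced words
  act non-trivially.\<close>

lemma act_hom_lengthens:
  assumes "g \<in> carrier (G i) - img i" "(k, l) \<in> Om" "l \<noteq> [] \<longrightarrow> fst (hd l) \<noteq> i"
  shows "\<exists>k' Y. act_hom i g (k, l) = (k', (i, Y) # l)"
proof -
  interpret Gi: group "G i" by (rule G)
  have k: "k \<in> carrier K" using assms by (simp add: Om_def)
  have "g \<otimes>\<^bsub>G i\<^esub> f i k \<notin> img i"
  proof
    assume "g \<otimes>\<^bsub>G i\<^esub> f i k \<in> img i"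
    then have "g \<otimes>\<^bsub>G i\<^esub> f i k \<otimes>\<^bsub>G i\<^esub> inv\<^bsub>G i\<^esub> (f i k) \<in> img i"
      using img_subgroup f_img[OF k] by (meson subgroup.m_closed subgroup.m_inv_closed)
    then show False using assms f_closed[OF k, of i] by (simp add: Gi.m_assoc)
  qed
  then show ?thesis using assms(2,3) by (auto simp: act_hom_def act_def split_def join_def)
qed

end

subsection \<open>Presented groups as amalgams\<close>

definition parab :: "('a gword \<times> 'a gword) set \<Rightarrow> 'a set \<Rightarrow> 'a set \<Rightarrow> 'a gword set set" where
  "parab R W U = pres_class W R ` gwords U"

text \<open>Injectivity of the natural map from the group on \<open>U\<close> to the group on
  \<open>W\<close>. One set \<open>R\<close> serves all sets of letters, because
  \<open>pres_cong U R\<close> uses only those relations of which both sides are words over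
  \<open>U\<close>.\<close>

definition embeds :: "('a gword \<times> 'a gword) set \<Rightarrow> 'a set \<Rightarrow> 'a set \<Rightarrow> bool" where
  "embeds R U W \<longleftrightarrow> (\<forall>w\<in>gwords U. pres_cong W R w [] \<longrightarrow> pres_cong U R w [])"

lemma parab_mono: "U \<subseteq> U' \<Longrightarrow> parab R W U \<subseteq> parab R W U'"
  using gwords_mono[of U U'] by (auto simp: parab_def)

lemma parab_self: "parab R W W = carrier (presented_group W R)"
  by (simp add: parab_def carrier_presented)

lemma parab_subgroup:
  assumes "U \<subseteq> W"
  shows "subgroup (parab R W U) (presented_group W R)"
proof -
  interpret Q: group "presented_group W R" by (rule group_presented_group)
  have s: "w \<in> gwords W" if "w \<in> gwords U" for w using that gwords_mono[OF assms] by blast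
  show ?thesis
  proof (rule Q.subgroupI)
    show "parab R W U \<subseteq> carrier (presented_group W R)" using s by (auto simp: parab_def)
    show "parab R W U \<noteq> {}" using gwords_Nil[of U] unfolding parab_def by blast
    show "inv\<^bsub>presented_group W R\<^esub> a \<in> parab R W U" if "a \<in> parab R W U" for a
      using that s by (auto simp: parab_def inv_pres_class)
    show "a \<otimes>\<^bsub>presented_group W R\<^esub> b \<in> parab R W U" if "a \<in> parab R W U" "b \<in> parab R W U" for a b
      using that s by (auto simp: parab_def presented_group_mult)
  qed
qed

lemma generate_letters:
  assumes "U \<subseteq> W"
  shows "generate (presented_group W R) ((\<lambda>x. pres_class W R [(x, True)]) ` U) = parab R W U"
proof
  interpret Q: group "presented_group W R" by (rule group_presented_group)
  let ?g = "(\<lambda>x. pres_class W R [(x, True)]) ` U"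
  show "generate (presented_group W R) ?g \<subseteq> parab R W U"
  proof (rule Q.generate_subgroup_incl[OF _ parab_subgroup[OF assms]])
    show "?g \<subseteq> parab R W U" by (auto simp: parab_def)
  qed
  show "parab R W U \<subseteq> generate (presented_group W R) ?g"
  proof
    fix a assume "a \<in> parab R W U"
    then obtain w where w: "w \<in> gwords U" "a = pres_class W R w" by (auto simp: parab_def)
    have "gw_eval (presented_group W R) (\<lambda>x. pres_class W R [(x, True)]) w
        \<in> generate (presented_group W R) ?g"
      using w(1)
    proof (induction w)
      case Nil
      then show ?case by (simp add: generate.one)
    next
      case (Cons b w)
      then show ?case by (cases b) (auto intro!: generate.eng intro: generate.incl generate.inv)
    qed
    then show "a \<in> generate (presented_group W R) ?g"
      using w gw_eval_pres_class[OF w(1) assms] by simp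
  qed
qed

lemma generate_parab:
  assumes "U1 \<union> U2 \<subseteq> W"
  shows "generate (presented_group W R) (parab R W U1 \<union> parab R W U2) = parab R W (U1 \<union> U2)"
proof
  interpret Q: group "presented_group W R" by (rule group_presented_group)
  show "generate (presented_group W R) (parab R W U1 \<union> parab R W U2) \<subseteq> parab R W (U1 \<union> U2)"
    using parab_mono[of _ "U1 \<union> U2" R W]
    by (intro Q.generate_subgroup_incl[OF _ parab_subgroup[OF assms]]) auto
  have "(\<lambda>x. pres_class W R [(x, True)]) ` (U1 \<union> U2) \<subseteq> parab R W U1 \<union> parab R W U2"
    by (auto simp: parab_def)
  then show "parab R W (U1 \<union> U2) \<subseteq> generate (presented_group W R) (parab R W U1 \<union> parab R W U2)"
    using Q.mono_generate generate_letters[OF assms] by metis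
qed

lemma incl_hom:
  assumes "U \<subseteq> W"
  obtains h where "h \<in> hom (presented_group U R) (presented_group W R)"
    "\<And>w. w \<in> gwords U \<Longrightarrow> h (pres_class U R w) = pres_class W R w"
proof (rule presented_lift[OF group_presented_group, of "\<lambda>x. pres_class W R [(x, True)]" U W R R])
  show "(\<lambda>x. pres_class W R [(x, True)]) \<in> U \<rightarrow> carrier (presented_group W R)"
    using assms by auto
next
  fix u v assume uv: "(u, v) \<in> R" "u \<in> gwords U" "v \<in> gwords U"
  then have "pres_cong W R u v" using assms gwords_mono by (blast intro: pres_cong.relation)
  then have "pres_class W R u = pres_class W R v"
    using pres_class_eq_iff[of u W R v] pres_cong_gwords by blast
  then show "gw_eval (presented_group W R) (\<lambda>x. pres_class W R [(x, True)]) u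
     = gw_eval (presented_group W R) (\<lambda>x. pres_class W R [(x, True)]) v"
    using uv assms by (simp add: gw_eval_pres_class)
next
  fix h assume "h \<in> hom (presented_group U R) (presented_group W R)"
    "\<And>w. w \<in> gwords U \<Longrightarrow> h (pres_class U R w) = gw_eval (presented_group W R) (\<lambda>x. pres_class W R [(x, True)]) w"
  then show thesis using that assms by (simp add: gw_eval_pres_class)
qed

lemma embedsD:
  assumes "embeds R U W" "U \<subseteq> W" "u \<in> gwords U" "v \<in> gwords U" "pres_class W R u = pres_class W R v"
  shows "pres_class U R u = pres_class U R v"
proof -
  have w: "u \<in> gwords W" "v \<in> gwords W" using assms(3,4) gwords_mono[OF assms(2)] by blast+
  then have "pres_cong W R (gw_inv v @ u) []"
    using assms(5) pres_class_eq_iff[OF w(1)] pres_cong_iff_inv[OF w] by metis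
  then have "pres_cong U R (gw_inv v @ u) []" using assms(1,3,4) by (simp add: embeds_def)
  then show ?thesis using pres_class_eq_iff[OF assms(3)] pres_cong_iff_inv[OF assms(3,4)] by metis
qed

lemma pres_class_mono:
  assumes "U \<subseteq> W" "u \<in> gwords U" "pres_class U R u = pres_class U R v"
  shows "pres_class W R u = pres_class W R v"
  using assms pres_cong_mono[of U R u v W] pres_class_eq_iff[of u W R v] pres_class_eq_iff[of u U R v]
    pres_cong_gwords by blast

lemma embeds_trans:
  assumes "embeds R U U'" "embeds R U' W" "U \<subseteq> U'"
  shows "embeds R U W"
  using assms gwords_mono[OF assms(3)] by (auto simp: embeds_def)

text \<open>The letters act on the normal forms through the two actions of
  \<open>amalgam_data\<close>, and each relation is respected because it already holds in one
  factor. The image of the base point detects non-trivial elements of each factor as well as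
  non-empty reduced words.\<close>

theorem amalgam_presented:
  fixes R :: "('a gword \<times> 'a gword) set"
  assumes W: "W = W1 \<union> W2"
    and rel: "\<And>u v. (u, v) \<in> R \<Longrightarrow> u \<in> gwords W \<Longrightarrow> v \<in> gwords W \<Longrightarrow>
      u \<in> gwords W1 \<and> v \<in> gwords W1 \<or> u \<in> gwords W2 \<and> v \<in> gwords W2"
    and emb: "embeds R (W1 \<inter> W2) W1" "embeds R (W1 \<inter> W2) W2"
  shows "amalgam (presented_group W R) (\<lambda>i. parab R W (if i then W1 else W2)) (parab R W (W1 \<inter> W2))"
    and "embeds R W1 W" "embeds R W2 W"
proof -
  define U where "U i = (if i then W1 else W2)" for i
  define W0 where "W0 = W1 \<inter> W2"
  have U0: "W0 \<subseteq> U i" and UW: "U i \<subseteq> W" for i using W by (auto simp: U_def W0_def)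
  have emb0: "embeds R W0 (U i)" for i using emb by (simp add: U_def W0_def)
  have "\<exists>h. h \<in> hom (presented_group W0 R) (presented_group (U i) R) \<and>
    (\<forall>w\<in>gwords W0. h (pres_class W0 R w) = pres_class (U i) R w)" for i
    using incl_hom[OF U0] by metis
  then obtain f where f: "\<And>i. f i \<in> hom (presented_group W0 R) (presented_group (U i) R)"
    "\<And>i w. w \<in> gwords W0 \<Longrightarrow> f i (pres_class W0 R w) = pres_class (U i) R w" by metis
  have inj: "inj_on (f i) (carrier (presented_group W0 R))" for i
  proof (rule inj_onI)
    fix x y assume x: "x \<in> carrier (presented_group W0 R)" and y: "y \<in> carrier (presented_group W0 R)"
      and eq: "f i x = f i y"
    obtain u where u: "u \<in> gwords W0" "x = pres_class W0 R u" using x by (auto simp: carrier_presented)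
    obtain v where v: "v \<in> gwords W0" "y = pres_class W0 R v" using y by (auto simp: carrier_presented)
    have "pres_class (U i) R u = pres_class (U i) R v"
      using eq unfolding u(2) v(2) f(2)[OF u(1)] f(2)[OF v(1)] .
    from embedsD[OF emb0 U0 u(1) v(1) this] show "x = y" unfolding u(2) v(2) .
  qed
  interpret D: amalgam_data "presented_group W0 R" "\<lambda>i. presented_group (U i) R" f
    by (intro amalgam_data.intro group_presented_group f(1) inj)
  interpret Q: group "presented_group W R" by (rule group_presented_group)
  define B where "B = BijGroup D.Om"
  interpret B: group B unfolding B_def by (rule group_BijGroup)
  \<comment> \<open>On the letters of \<open>W1 \<inter> W2\<close> both choices give the same
    permutation, by \<open>act_hom_agree\<close>.\<close>
  define F where "F x = (if x \<in> W1 then D.act_hom True (pres_class W1 R [(x, True)])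
     else D.act_hom False (pres_class W2 R [(x, True)]))" for x
  have F: "F x = D.act_hom i (pres_class (U i) R [(x, True)])" if "x \<in> U i" for x i
  proof (cases "x \<in> W0")
    case True
    then have "[(x, True)] \<in> gwords W0" by simp
    then have "D.act_hom j (pres_class (U j) R [(x, True)]) = D.act_hom i (pres_class (U i) R [(x, True)])" for j
      using D.act_hom_agree[of "pres_class W0 R [(x, True)]" j i] f(2) by simp
    from this[of True] show ?thesis using True by (simp add: F_def U_def W0_def)
  next
    case False
    then show ?thesis using that by (cases i) (auto simp: F_def U_def W0_def)
  qed
  have Fc: "F \<in> W \<rightarrow> carrier B"
  proof
    fix x assume "x \<in> W"
    then have "x \<in> U True \<or> x \<in> U False" using W by (auto simp: U_def)
    then obtain i where "x \<in> U i" by blast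
    then have "F x = D.act_hom i (pres_class (U i) R [(x, True)])"
      "pres_class (U i) R [(x, True)] \<in> carrier (presented_group (U i) R)"
      using F[of x i] by simp_all
    then show "F x \<in> carrier B" using D.act_hom[of i] by (auto simp: hom_def B_def)
  qed
  have ev: "gw_eval B F w = D.act_hom i (pres_class (U i) R w)" if w: "w \<in> gwords (U i)" for w i
  proof -
    interpret Ui: group "presented_group (U i) R" by (rule group_presented_group)
    have "gw_eval B F w = gw_eval B (\<lambda>x. D.act_hom i (pres_class (U i) R [(x, True)])) w"
      using w F by (rule gw_eval_cong)
    also have "\<dots> = D.act_hom i (gw_eval (presented_group (U i) R) (\<lambda>x. pres_class (U i) R [(x, True)]) w)"
      by (rule Ui.gw_eval_hom[OF B.group_axioms _ w]) (use D.act_hom[of i] in \<open>auto simp: B_def\<close>)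
    finally show ?thesis using gw_eval_pres_class[OF w] by simp
  qed
  have relF: "gw_eval B F u = gw_eval B F v" if uv: "(u, v) \<in> R" "u \<in> gwords W" "v \<in> gwords W" for u v
  proof -
    have "\<exists>i. u \<in> gwords (U i) \<and> v \<in> gwords (U i)"
    proof (cases "u \<in> gwords W1 \<and> v \<in> gwords W1")
      case True
      then show ?thesis by (intro exI[of _ True]) (simp add: U_def)
    next
      case False
      then show ?thesis using rel[OF uv] by (intro exI[of _ False]) (auto simp: U_def)
    qed
    then obtain i where i: "u \<in> gwords (U i)" "v \<in> gwords (U i)" by blast
    then have "pres_class (U i) R u = pres_class (U i) R v"
      using uv by (simp add: pres_class_eq_iff pres_cong.relation)
    then show ?thesis using ev i by simp
  qed
  obtain T where T: "T \<in> hom (presented_group W R) B"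
      "\<And>w. w \<in> gwords W \<Longrightarrow> T (pres_class W R w) = gw_eval B F w"
    using presented_lift[OF B.group_axioms Fc relF] by metis
  have oneB: "\<one>\<^bsub>B\<^esub> (\<one>\<^bsub>presented_group W0 R\<^esub>, []) = (\<one>\<^bsub>presented_group W0 R\<^esub>, [])"
    using D.base_mem by (simp add: B_def BijGroup_def)
  have multB: "(a \<otimes>\<^bsub>B\<^esub> b) w = a (b w)" if "a \<in> carrier B" "b \<in> carrier B" "w \<in> D.Om" for a b w
    using that by (simp add: B_def BijGroup_def compose_def)
  have embi: "embeds R (U i) W" for i
    unfolding embeds_def
  proof (intro ballI impI)
    fix w assume w: "w \<in> gwords (U i)" "pres_cong W R w []"
    then have "gw_eval B F w = \<one>\<^bsub>B\<^esub>"
      using B.pres_cong_gw_eval[OF Fc relF w(2)] by simp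
    then have "D.act_hom i (pres_class (U i) R w) (\<one>\<^bsub>presented_group W0 R\<^esub>, []) = (\<one>\<^bsub>presented_group W0 R\<^esub>, [])"
      using ev[OF w(1)] oneB by simp
    then have "pres_class (U i) R w = \<one>\<^bsub>presented_group (U i) R\<^esub>"
      using D.act_hom_base_faithful[of "pres_class (U i) R w" i] w(1) by simp
    then show "pres_cong (U i) R w []" using w(1) by (simp add: one_presented pres_class_eq_iff)
  qed
  show "embeds R W1 W" using embi[of True] by (simp add: U_def)
  show "embeds R W2 W" using embi[of False] by (simp add: U_def)
  have nf: "\<exists>k l. (k, l) \<in> D.Om \<and> T (Q.wprod xs) (\<one>\<^bsub>presented_group W0 R\<^esub>, []) = (k, l) \<and>
      length l = length xs \<and> (l \<noteq> [] \<longrightarrow> fst (hd l) = fst (hd xs))"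
    if "Q.reduced (\<lambda>i. parab R W (U i)) (parab R W W0) xs" for xs
    using that
  proof (induction xs)
    case Nil
    have "T \<one>\<^bsub>presented_group W R\<^esub> = \<one>\<^bsub>B\<^esub>" using hom_one[OF T(1)] Q.group_axioms B.group_axioms by simp
    then show ?case using oneB D.base_mem by auto
  next
    case (Cons x xs)
    obtain i g where x: "x = (i, g)" by force
    have xs: "Q.reduced (\<lambda>i. parab R W (U i)) (parab R W W0) xs"
      and g: "g \<in> parab R W (U i)" "g \<notin> parab R W W0" and hd: "xs \<noteq> [] \<Longrightarrow> i \<noteq> fst (hd xs)"
      using Cons.prems x by (auto simp: Q.reduced_Cons)
    obtain k l where kl: "(k, l) \<in> D.Om" "T (Q.wprod xs) (\<one>\<^bsub>presented_group W0 R\<^esub>, []) = (k, l)"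
      "length l = length xs" "l \<noteq> [] \<longrightarrow> fst (hd l) = fst (hd xs)" using Cons.IH[OF xs] by blast
    obtain w where w: "w \<in> gwords (U i)" "g = pres_class W R w" using g by (auto simp: parab_def)
    have wW: "w \<in> gwords W" using w gwords_mono[OF UW] by blast
    have "pres_class (U i) R w \<notin> D.img i"
    proof
      assume "pres_class (U i) R w \<in> D.img i"
      then obtain u where u: "u \<in> gwords W0" "pres_class (U i) R w = pres_class (U i) R u"
        using f(2) by (auto simp: D.img_def carrier_presented)
      then have "g = pres_class W R u" using pres_class_mono[OF UW w(1)] w by simp
      then show False using g u by (simp add: parab_def)
    qed
    then have "\<exists>k' Y. D.act_hom i (pres_class (U i) R w) (k, l) = (k', (i, Y) # l)"
    proof (intro D.act_hom_lengthens)
      show "l \<noteq> [] \<longrightarrow> fst (hd l) \<noteq> i"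
      proof
        assume "l \<noteq> []"
        then have "xs \<noteq> []" using kl(3) by auto
        then show "fst (hd l) \<noteq> i" using hd kl(4) \<open>l \<noteq> []\<close> by blast
      qed
    qed (use kl(1) w(1) in auto)
    then obtain k' Y where k': "T g (k, l) = (k', (i, Y) # l)"
      using T(2)[OF wW] w(2) ev[OF w(1)] by auto
    have gc: "g \<in> carrier (presented_group W R)" using w wW by simp
    have wc: "Q.wprod xs \<in> carrier (presented_group W R)"
      using Q.reduced_carrier[OF subgroup.subset[OF parab_subgroup[OF UW]] xs] by simp
    have Tc: "T g \<in> carrier B" "T (Q.wprod xs) \<in> carrier B" using T(1) gc wc by (auto simp: hom_def)
    have "T (Q.wprod (x # xs)) = T g \<otimes>\<^bsub>B\<^esub> T (Q.wprod xs)" using x T(1) gc wc by (simp add: hom_mult)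
    then have e: "T (Q.wprod (x # xs)) (\<one>\<^bsub>presented_group W0 R\<^esub>, []) = (k', (i, Y) # l)"
      using multB[OF Tc D.base_mem] kl k' by simp
    have "T g \<in> Bij D.Om" using Tc by (simp add: B_def BijGroup_def)
    then have "T g (k, l) \<in> D.Om" using kl(1) Bij_imp_funcset by blast
    then show ?case using e k' kl x by auto
  qed
  have "amalgam (presented_group W R) (\<lambda>i. parab R W (U i)) (parab R W W0)"
  proof (intro amalgam.intro amalgam_axioms.intro Q.group_axioms)
    show "subgroup (parab R W (U i)) (presented_group W R)" for i using parab_subgroup[OF UW] .
    show "subgroup (parab R W W0) (presented_group W R)" using parab_subgroup[of W0 W R] U0[of True] UW[of True] by simp
    show "parab R W W0 \<subseteq> parab R W (U i)" for i using parab_mono[OF U0] .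
    show "generate (presented_group W R) (parab R W (U True) \<union> parab R W (U False)) = carrier (presented_group W R)"
      using generate_parab[of W1 W2 W R] W parab_self[of R W] by (simp add: U_def)
    fix xs assume xs: "Q.reduced (\<lambda>i. parab R W (U i)) (parab R W W0) xs" "xs \<noteq> []"
    show "Q.wprod xs \<noteq> \<one>\<^bsub>presented_group W R\<^esub>"
    proof
      assume one: "Q.wprod xs = \<one>\<^bsub>presented_group W R\<^esub>"
      have "T \<one>\<^bsub>presented_group W R\<^esub> = \<one>\<^bsub>B\<^esub>" using hom_one[OF T(1)] Q.group_axioms B.group_axioms by simp
      then show False using nf[OF xs(1)] one oneB xs(2) by auto
    qed
  qed
  then show "amalgam (presented_group W R) (\<lambda>i. parab R W (if i then W1 else W2)) (parab R W (W1 \<inter> W2))"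
    unfolding U_def W0_def .
qed

subsection \<open>Two by two matrices\<close>

type_synonym 'a mat2 = "'a \<times> 'a \<times> 'a \<times> 'a"

fun mat_mult :: "'a::comm_ring_1 mat2 \<Rightarrow> 'a mat2 \<Rightarrow> 'a mat2" where
  "mat_mult (a, b, c, d) (e, f, g, h) = (a * e + b * g, a * f + b * h, c * e + d * g, c * f + d * h)"

fun mat_det :: "'a::comm_ring_1 mat2 \<Rightarrow> 'a" where
  "mat_det (a, b, c, d) = a * d - b * c"

definition SL2 :: "'a::comm_ring_1 mat2 monoid" where
  "SL2 = \<lparr>carrier = {M. mat_det M = 1}, monoid.mult = mat_mult, one = (1, 0, 0, 1)\<rparr>"

lemma SL2_simps [simp]:
  "(a, b, c, d) \<in> carrier SL2 \<longleftrightarrow> a * d - b * c = 1"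
  "(a, b, c, d) \<otimes>\<^bsub>SL2\<^esub> (e, f, g, h) = (a * e + b * g, a * f + b * h, c * e + d * g, c * f + d * h)"
  "\<one>\<^bsub>SL2\<^esub> = (1, 0, 0, 1)"
  by (simp_all add: SL2_def)

lemma group_SL2: "group (SL2 :: 'a::comm_ring_1 mat2 monoid)"
proof (rule groupI)
  fix x y z :: "'a mat2"
  obtain a b c d where x: "x = (a, b, c, d)" by (metis prod_cases4)
  obtain e f g h where y: "y = (e, f, g, h)" by (metis prod_cases4)
  obtain k l m n where z: "z = (k, l, m, n)" by (metis prod_cases4)
  show "x \<otimes>\<^bsub>SL2\<^esub> y \<otimes>\<^bsub>SL2\<^esub> z = x \<otimes>\<^bsub>SL2\<^esub> (y \<otimes>\<^bsub>SL2\<^esub> z)"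
    by (simp add: x y z algebra_simps)
  show "\<one>\<^bsub>SL2\<^esub> \<otimes>\<^bsub>SL2\<^esub> x = x" by (simp add: x)
  {
    assume "x \<in> carrier SL2" "y \<in> carrier SL2"
    then have "(a * d - b * c) * (e * h - f * g) = 1" by (simp add: x y)
    then show "x \<otimes>\<^bsub>SL2\<^esub> y \<in> carrier SL2" by (simp add: x y algebra_simps)
  }
  {
    assume "x \<in> carrier SL2"
    then show "\<exists>y\<in>carrier SL2. y \<otimes>\<^bsub>SL2\<^esub> x = \<one>\<^bsub>SL2\<^esub>"
      by (intro bexI[of _ "(d, - b, - c, a)"]) (auto simp: x algebra_simps)
  }
qed (simp add: SL2_def)

interpretation SL2: group "SL2 :: 'a::comm_ring_1 mat2 monoid"
  by (rule group_SL2)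

lemma inv_SL2 [simp]:
  assumes "(a, b, c, d) \<in> carrier SL2"
  shows "inv\<^bsub>SL2\<^esub> (a, b, c, d) = (d, - b, - c, a)"
  using assms by (intro SL2.inv_equality) (auto simp: algebra_simps)

text \<open>\<open>cheb t k\<close> is the Chebyshev polynomial of the second kind of index
  \<open>k - 1\<close>, evaluated at \<open>t / 2\<close>. By Cayley--Hamilton these are the
  coefficients in the powers of a matrix of determinant 1 and trace \<open>t\<close>
  (\<open>SL2_pow\<close>).\<close>

fun cheb :: "'a::comm_ring_1 \<Rightarrow> nat \<Rightarrow> 'a" where
  "cheb t 0 = 0"
| "cheb t (Suc 0) = 1"
| "cheb t (Suc (Suc k)) = t * cheb t (Suc k) - cheb t k"

lemma SL2_pow:
  assumes "(a, b, c, d) \<in> carrier SL2"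
  shows "(a, b, c, d) [^]\<^bsub>SL2\<^esub> Suc k = (cheb (a + d) (Suc k) * a - cheb (a + d) k,
    cheb (a + d) (Suc k) * b, cheb (a + d) (Suc k) * c, cheb (a + d) (Suc k) * d - cheb (a + d) k)"
proof (induction k)
  case 0
  then show ?case using assms by simp
next
  case (Suc k)
  define u v where "u = cheb (a + d) (Suc k)" and "v = cheb (a + d) k"
  have det: "a * d - b * c = 1" using assms by simp
  have e1: "(u * a - v) * a + u * b * c = ((a + d) * u - v) * a - u * (a * d - b * c)"
    by (simp add: algebra_simps)
  have e2: "(u * a - v) * b + u * b * d = ((a + d) * u - v) * b" by (simp add: algebra_simps)
  have e3: "u * c * a + (u * d - v) * c = ((a + d) * u - v) * c" by (simp add: algebra_simps)
  have e4: "u * c * b + (u * d - v) * d = ((a + d) * u - v) * d - u * (a * d - b * c)"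
    by (simp add: algebra_simps)
  have "(a, b, c, d) [^]\<^bsub>SL2\<^esub> Suc (Suc k) = (a, b, c, d) [^]\<^bsub>SL2\<^esub> Suc k \<otimes>\<^bsub>SL2\<^esub> (a, b, c, d)"
    by (rule SL2.nat_pow_Suc)
  then show ?case
    unfolding Suc u_def[symmetric] v_def[symmetric] cheb.simps by (simp only: SL2_simps e1 e2 e3 e4 det mult_1_right)
qed

text \<open>The leading contribution is \<open>t ^ k\<close>; in particular the coefficient of
  \<open>M\<close> in \<open>SL2_pow\<close> is non-zero if the trace is not constant.\<close>

lemma degree_cheb:
  fixes t :: "real poly"
  assumes "degree t \<ge> 1"
  shows "cheb t (Suc k) \<noteq> 0 \<and> degree (cheb t (Suc k)) = k * degree t"
proof (induction k rule: less_induct)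
  case (less k)
  consider "k = 0" | "k = 1" | j where "k = Suc (Suc j)" by (metis One_nat_def not0_implies_Suc)
  then show ?case
  proof cases
    case 1
    then show ?thesis by simp
  next
    case 2
    then show ?thesis using assms by auto
  next
    case 3
    have a: "cheb t (Suc (Suc j)) \<noteq> 0" "degree (cheb t (Suc (Suc j))) = Suc j * degree t"
      and b: "degree (cheb t (Suc j)) = j * degree t"
      using less[of "Suc j"] less[of j] 3 by auto
    have m: "degree (t * cheb t (Suc (Suc j))) = k * degree t"
      using a assms 3 by (subst degree_mult_eq) auto
    have "degree (cheb t (Suc j)) < degree (t * cheb t (Suc (Suc j)))"
      using b m assms 3 by simp
    then have "degree (cheb t (Suc k)) = k * degree t"
      using m 3 degree_add_eq_left[of "- cheb t (Suc j)" "t * cheb t (Suc (Suc j))"] by simp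
    moreover have "k * degree t \<noteq> 0" using 3 assms by simp
    ultimately show ?thesis by force
  qed
qed

lemma cheb_two: "cheb 2 k = of_nat k"
  by (induction "2 :: 'a::comm_ring_1" k rule: cheb.induct) (auto simp: algebra_simps)

lemma poly_cheb: "poly (cheb t k) x = cheb (poly t x) k"
  by (induction t k rule: cheb.induct) auto

text \<open>The classical identity with \<open>sin (k \<theta>) / sin \<theta>\<close>, stated for
  constant polynomials since the matrices live over \<open>real poly\<close>.\<close>

lemma cheb_sin: "cheb [:2 * cos \<theta>:] k * [:sin \<theta>:] = [:sin (real k * \<theta>):]"
proof (induction "[:2 * cos \<theta>:]" k rule: cheb.induct)
  case (3 k)
  have "sin (real (Suc (Suc k)) * \<theta>) = sin (real (Suc k) * \<theta> + \<theta>)"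
    "sin (real k * \<theta>) = sin (real (Suc k) * \<theta> - \<theta>)"
    by (simp_all add: algebra_simps)
  then have "sin (real (Suc (Suc k)) * \<theta>) = 2 * cos \<theta> * sin (real (Suc k) * \<theta>) - sin (real k * \<theta>)"
    by (simp only: sin_add sin_diff) (simp add: algebra_simps)
  then have "[:sin (real (Suc (Suc k)) * \<theta>):]
      = [:2 * cos \<theta>:] * [:sin (real (Suc k) * \<theta>):] - [:sin (real k * \<theta>):]" by simp
  then show ?case using 3 by (simp only: cheb.simps left_diff_distrib mult.assoc)
qed auto

text \<open>By \<open>SL2_pow\<close>, \<open>M [^] n\<close> is \<open>u M - v\<close> with scalars
  \<open>u \<noteq> 0\<close> and \<open>v\<close>. Commuting with it means commuting with
  \<open>u M\<close>, and \<open>u\<close> cancels in an integral domain.\<close>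

lemma SL2_commute_pow:
  fixes M N :: "real poly mat2"
  assumes M: "M \<in> carrier SL2" "M = (a, b, c, d)" "degree (a + d) \<ge> 1"
    and N: "N \<in> carrier SL2" and "n \<ge> 1"
    and comm: "N \<otimes>\<^bsub>SL2\<^esub> M [^]\<^bsub>SL2\<^esub> (n::nat) = M [^]\<^bsub>SL2\<^esub> n \<otimes>\<^bsub>SL2\<^esub> N"
  shows "N \<otimes>\<^bsub>SL2\<^esub> M = M \<otimes>\<^bsub>SL2\<^esub> N"
proof -
  obtain k where k: "n = Suc k" using \<open>n \<ge> 1\<close> by (metis Suc_le_D One_nat_def)
  obtain e f g h where n: "N = (e, f, g, h)" by (metis prod_cases4)
  define u where "u = cheb (a + d) (Suc k)"
  have u: "u \<noteq> 0" using degree_cheb[OF M(3)] by (simp add: u_def)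
  have eqs: "N \<otimes>\<^bsub>SL2\<^esub> (u * a - cheb (a + d) k, u * b, u * c, u * d - cheb (a + d) k)
      = (u * a - cheb (a + d) k, u * b, u * c, u * d - cheb (a + d) k) \<otimes>\<^bsub>SL2\<^esub> N"
    using comm SL2_pow[of a b c d k] M k by (simp add: u_def)
  have "u * (f * c) = u * (b * g)" "u * (e * b + f * d) = u * (a * f + b * h)"
    "u * (g * a + h * c) = u * (c * e + d * g)" "u * (g * b) = u * (c * f)"
    using eqs unfolding n by (auto simp: algebra_simps)
  then have "f * c = b * g" "e * b + f * d = a * f + b * h"
    "g * a + h * c = c * e + d * g" "g * b = c * f"
    unfolding mult_left_cancel[OF u] by blast+
  then show ?thesis unfolding n M(2) by (simp add: algebra_simps)
qed

text \<open>
  The trace of a torsion element is constant, since otherwise its powers have traces of growing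
  degree.
\<close>

lemma SL2_torsion_trivial:
  fixes M :: "real poly mat2"
  assumes M: "M \<in> carrier SL2" "M = (a, b, c, d)" "poly (a + d) 0 = 2"
    and "n \<ge> 1" "M [^]\<^bsub>SL2\<^esub> (n::nat) = \<one>\<^bsub>SL2\<^esub>"
  shows "M = \<one>\<^bsub>SL2\<^esub>"
proof -
  obtain k where k: "n = Suc k" using \<open>n \<ge> 1\<close> by (metis Suc_le_D One_nat_def)
  define u where "u = cheb (a + d) (Suc k)"
  define v where "v = cheb (a + d) k"
  have eqs: "u * a - v = 1" "u * b = 0" "u * c = 0" "u * d - v = 1"
    using SL2_pow[of a b c d k] M k assms(5) by (simp_all add: u_def v_def)
  have det: "a * d - b * c = 1" using M by simp
  \<comment> \<open>If the trace were not constant, then \<open>u \<noteq> 0\<close>, so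
    \<open>M\<close> would be scalar with \<open>a * a = 1\<close>; but then \<open>a\<close>, and
    with it the trace, is constant.\<close>
  have "degree (a + d) = 0"
  proof (rule ccontr)
    assume "degree (a + d) \<noteq> 0"
    then have dg: "degree (a + d) \<ge> 1" by simp
    then have u: "u \<noteq> 0" using degree_cheb by (simp add: u_def)
    have "u * a = u * d" using eqs(1,4) by (simp add: algebra_simps)
    then have "b = 0" "c = 0" "a = d" using eqs(2,3) u by auto
    then have "a * a = 1" using det by simp
    then have "a \<noteq> 0" "degree (a * a) = 0" by auto
    then have "degree a = 0" by (simp add: degree_mult_eq)
    then show False using dg \<open>a = d\<close> degree_add_le[of a 0 d] by simp
  qed
  then obtain r where r: "a + d = [:r:]" by (rule degree_eq_zeroE)
  then have t: "a + d = 2" using M(3) by (simp add: numeral_poly)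
  have uv: "u = of_nat (Suc k)" "v = of_nat k"
    unfolding u_def v_def t cheb_two by simp_all
  have "of_nat (Suc k) * (a - 1) = 0" "of_nat (Suc k) * (d - 1) = 0"
    using eqs(1,4) unfolding uv by (simp_all add: algebra_simps)
  moreover have "(of_nat (Suc k) :: real poly) \<noteq> 0" by (simp del: of_nat_Suc)
  ultimately show ?thesis using eqs(2,3) M(2) uv by auto
qed

subsection \<open>A linear quotient of the dihedral Artin groups\<close>

text \<open>
  \<open>dih_a p\<close> and \<open>dih_b p\<close> are \<open>q J\<^sup>-\<^sup>1\<close> and \<open>J\<^sup>-\<^sup>1 q\<close> for the quarter turn \<open>J\<close> and the conjugate \<open>q\<close>
  of the rotation by \<open>\<pi>/p\<close> by the unipotent matrix with parameter \<open>x\<close>.  Since \<open>J\<^sup>2 = q\<^sup>p = -1\<close>, they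
  satisfy the braid relation of length \<open>p\<close>.  At \<open>x = 0\<close> they coincide.
\<close>

definition dih_a :: "nat \<Rightarrow> real poly mat2" where
  "dih_a p = (let s = sin (pi / p); c = cos (pi / p) in ([:s, 0, s:], [:c, s:], [:- c, s:], [:s:]))"

definition dih_b :: "nat \<Rightarrow> real poly mat2" where
  "dih_b p = (let s = sin (pi / p); c = cos (pi / p) in ([:s:], [:c, - s:], [:- c, - s:], [:s, 0, s:]))"

definition quarter_turn :: "real poly mat2" where
  "quarter_turn = (0, - 1, 1, 0)"

lemma dih_closed [simp]: "dih_a p \<in> carrier SL2" "dih_b p \<in> carrier SL2"
  using sin_cos_squared_add3[of "pi / p"]
  by (auto simp: dih_a_def dih_b_def Let_def one_pCons algebra_simps)

lemma quarter_turn_closed [simp]: "quarter_turn \<in> carrier SL2"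
  by (simp add: quarter_turn_def)

lemma quarter_turn_swap:
  "dih_b p \<otimes>\<^bsub>SL2\<^esub> quarter_turn = quarter_turn \<otimes>\<^bsub>SL2\<^esub> dih_a p"
  "dih_a p \<otimes>\<^bsub>SL2\<^esub> quarter_turn = quarter_turn \<otimes>\<^bsub>SL2\<^esub> dih_b p"
  by (simp_all add: dih_a_def dih_b_def quarter_turn_def Let_def)

lemma sin_pi_div_pos:
  assumes "p \<ge> 2" shows "sin (pi / real p) > 0"
proof -
  have "pi / real p > 0" "pi / real p < pi"
    using assms by (auto simp: divide_less_eq)
  then show ?thesis by (rule sin_gt_zero)
qed

text \<open>The coefficients in \<open>SL2_pow\<close> are \<open>sin pi / sin (pi / p) = 0\<close>
  and \<open>sin (pi - pi / p) / sin (pi / p) = 1\<close>.\<close>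

lemma trace_cos_pow:
  fixes M :: "real poly mat2"
  assumes p: "p \<ge> 2"
    and M: "M \<in> carrier SL2" "M = (a, b, c, d)" "a + d = [:2 * cos (pi / real p):]"
  shows "M [^]\<^bsub>SL2\<^esub> p = (- 1, 0, 0, - 1)"
proof -
  obtain k where k: "p = Suc k" using p by (metis Suc_le_D numeral_2_eq_2)
  define \<theta> where "\<theta> = pi / real p"
  have s: "sin \<theta> > 0" using sin_pi_div_pos[OF p] by (simp add: \<theta>_def)
  have pt: "real p * \<theta> = pi" using p by (simp add: \<theta>_def)
  have "cheb (a + d) p * [:sin \<theta>:] = 0"
    using cheb_sin[of \<theta> p] M(3) pt by (simp add: \<theta>_def)
  then have c1: "cheb (a + d) (Suc k) = 0" using s k by simp
  have "real k * \<theta> = pi - \<theta>" using pt k by (simp add: algebra_simps)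
  then have "cheb (a + d) k * [:sin \<theta>:] = 1 * [:sin \<theta>:]"
    using cheb_sin[of \<theta> k] M(3) by (simp add: \<theta>_def)
  then have c2: "cheb (a + d) k = 1" using s by (subst (asm) mult_right_cancel) auto
  show ?thesis using SL2_pow[of a b c d k] M c1 c2 k by simp
qed

text \<open>A quarter turn that passes a letter exchanges the two letters; hence the alternating
  product times \<open>quarter_turn [^] p\<close> equals
  \<open>(x0 \<otimes> quarter_turn) [^] p\<close>. The result is the same whichever generator is
  called \<open>x0\<close>, and this is the braid relation.\<close>

lemma dih_alternating:
  assumes p: "p \<ge> 2" and x0: "x0 = dih_a p \<and> x1 = dih_b p \<or> x0 = dih_b p \<and> x1 = dih_a p"
    and "s \<noteq> t" "f s = x0" "f t = x1"
  shows "gw_eval SL2 f (alternating_word s t p) \<otimes>\<^bsub>SL2\<^esub> quarter_turn [^]\<^bsub>SL2\<^esub> p = (- 1, 0, 0, - 1)"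
proof -
  define X where "X k = (if even k then x0 else x1)" for k :: nat
  have Xc: "X k \<in> carrier SL2" for k using x0 by (auto simp: X_def)
  have fc: "f \<in> {s, t} \<rightarrow> carrier SL2" using assms by auto
  let ?J = quarter_turn
  have XJ: "X (Suc k) \<otimes>\<^bsub>SL2\<^esub> ?J = ?J \<otimes>\<^bsub>SL2\<^esub> X k" for k
    using x0 quarter_turn_swap[of p] by (auto simp: X_def)
  have XJk: "X k \<otimes>\<^bsub>SL2\<^esub> ?J [^]\<^bsub>SL2\<^esub> k = ?J [^]\<^bsub>SL2\<^esub> k \<otimes>\<^bsub>SL2\<^esub> x0" for k
  proof (induction k)
    case 0
    then show ?case using Xc[of 0] by (simp add: X_def del: SL2_simps(3))
  next
    case (Suc k)
    have x0c: "x0 \<in> carrier SL2" using Xc[of 0] by (simp add: X_def)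
    have "X (Suc k) \<otimes>\<^bsub>SL2\<^esub> ?J [^]\<^bsub>SL2\<^esub> Suc k = (X (Suc k) \<otimes>\<^bsub>SL2\<^esub> ?J) \<otimes>\<^bsub>SL2\<^esub> ?J [^]\<^bsub>SL2\<^esub> k"
      using Xc SL2.nat_pow_Suc2[of ?J k] by (simp add: SL2.m_assoc del: SL2.nat_pow_Suc)
    also have "\<dots> = ?J \<otimes>\<^bsub>SL2\<^esub> (X k \<otimes>\<^bsub>SL2\<^esub> ?J [^]\<^bsub>SL2\<^esub> k)"
      using Xc XJ by (simp add: SL2.m_assoc)
    also have "\<dots> = ?J [^]\<^bsub>SL2\<^esub> Suc k \<otimes>\<^bsub>SL2\<^esub> x0"
      using Suc x0c SL2.nat_pow_Suc2[of ?J k] by (simp add: SL2.m_assoc del: SL2.nat_pow_Suc)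
    finally show ?case .
  qed
  have x0c: "x0 \<in> carrier SL2" using Xc[of 0] by (simp add: X_def)
  define q where "q = x0 \<otimes>\<^bsub>SL2\<^esub> ?J"
  have qc: "q \<in> carrier SL2" using x0c by (simp add: q_def)
  have alt: "alternating_word s t k \<in> gwords {s, t}" for k
    by (auto simp: gwords_iff alternating_word_def)
  have "gw_eval SL2 f (alternating_word s t k) \<otimes>\<^bsub>SL2\<^esub> ?J [^]\<^bsub>SL2\<^esub> k = q [^]\<^bsub>SL2\<^esub> k" for k
  proof (induction k)
    case 0
    then show ?case by (simp add: alternating_word_def)
  next
    case (Suc k)
    have w: "alternating_word s t (Suc k) = alternating_word s t k @ [(if even k then s else t, True)]"
      by (simp add: alternating_word_def)
    have ec: "gw_eval SL2 f (alternating_word s t k) \<in> carrier SL2"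
      using SL2.gw_eval_closed[OF alt fc] .
    have "gw_eval SL2 f [(if even k then s else t, True)] = X k \<otimes>\<^bsub>SL2\<^esub> \<one>\<^bsub>SL2\<^esub>"
      using assms by (simp only: gw_eval_Cons gw_eval_Nil) (simp add: X_def del: SL2_simps)
    then have "gw_eval SL2 f [(if even k then s else t, True)] = X k"
      using Xc by (simp only: SL2.r_one)
    then have "gw_eval SL2 f (alternating_word s t (Suc k))
        = gw_eval SL2 f (alternating_word s t k) \<otimes>\<^bsub>SL2\<^esub> X k"
      unfolding w by (subst SL2.gw_eval_append[OF alt _ fc]) auto
    then have "gw_eval SL2 f (alternating_word s t (Suc k)) \<otimes>\<^bsub>SL2\<^esub> ?J [^]\<^bsub>SL2\<^esub> Suc k
        = gw_eval SL2 f (alternating_word s t k) \<otimes>\<^bsub>SL2\<^esub> (X k \<otimes>\<^bsub>SL2\<^esub> ?J [^]\<^bsub>SL2\<^esub> k) \<otimes>\<^bsub>SL2\<^esub> ?J"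
      using ec Xc by (simp add: SL2.m_assoc)
    also have "\<dots> = (gw_eval SL2 f (alternating_word s t k) \<otimes>\<^bsub>SL2\<^esub> ?J [^]\<^bsub>SL2\<^esub> k) \<otimes>\<^bsub>SL2\<^esub> q"
      using ec x0c by (simp add: XJk q_def SL2.m_assoc)
    finally show ?case using Suc by simp
  qed
  moreover have "q [^]\<^bsub>SL2\<^esub> p = (- 1, 0, 0, - 1)"
  proof -
    obtain a b c d where q: "q = (a, b, c, d)" by (metis prod_cases4)
    have "a + d = [:2 * cos (pi / p):]"
      using x0 q by (auto simp: q_def dih_a_def dih_b_def quarter_turn_def Let_def)
    then show ?thesis using trace_cos_pow[OF p qc q] by blast
  qed
  ultimately show ?thesis by simp
qed

lemma dih_braid:
  assumes "p \<ge> 2" "s \<noteq> t" "f s = dih_a p" "f t = dih_b p"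
  shows "gw_eval SL2 f (alternating_word s t p) = gw_eval SL2 f (alternating_word t s p)"
proof -
  have fc: "f \<in> {s, t} \<rightarrow> carrier SL2" using assms by auto
  have alt: "alternating_word s t p \<in> gwords {s, t}" "alternating_word t s p \<in> gwords {s, t}"
    by (auto simp: gwords_iff alternating_word_def)
  have "gw_eval SL2 f (alternating_word s t p) \<otimes>\<^bsub>SL2\<^esub> quarter_turn [^]\<^bsub>SL2\<^esub> p
      = gw_eval SL2 f (alternating_word t s p) \<otimes>\<^bsub>SL2\<^esub> quarter_turn [^]\<^bsub>SL2\<^esub> p"
    using dih_alternating[of p "dih_a p" "dih_b p" s t f] dih_alternating[of p "dih_b p" "dih_a p" t s f] assms
    by simp
  then show ?thesis
    using SL2.gw_eval_closed[OF alt(1) fc] SL2.gw_eval_closed[OF alt(2) fc] SL2.right_cancel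
    by (simp add: SL2.right_cancel)
qed

definition esum :: "'a gword \<Rightarrow> int" where
  "esum w = (\<Sum>a\<leftarrow>w. if snd a then 1 else - 1)"

lemma esum_simps [simp]:
  "esum [] = 0" "esum (a # w) = (if snd a then 1 else - 1) + esum w" "esum (u @ v) = esum u + esum v"
  by (simp_all add: esum_def)

lemma esum_gw_inv [simp]: "esum (gw_inv w) = - esum w"
  by (induction w) (auto simp: gw_inv_Cons)

lemma esum_wpow [simp]: "esum (wpow n w) = int n * esum w"
  by (induction n) (auto simp: algebra_simps)

definition letter_pow :: "'a \<Rightarrow> int \<Rightarrow> 'a gword" where
  "letter_pow t e = replicate (nat \<bar>e\<bar>) (t, e \<ge> 0)"

lemma letter_pow_gwords [simp]: "letter_pow t e \<in> gwords X \<longleftrightarrow> e = 0 \<or> t \<in> X"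
  by (cases "e = 0") (auto simp: letter_pow_def gwords_iff)

lemma esum_letter_pow [simp]: "esum (letter_pow t e) = e"
  by (auto simp: letter_pow_def esum_def sum_list_replicate)

lemma (in group) gw_eval_esum:
  assumes "w \<in> gwords {x}" "f x \<in> carrier G"
  shows "gw_eval G f w = f x [^] esum w"
  using gw_eval_single[of w x f] assms by (simp add: esum_def)

text \<open>Every letter other than \<open>s\<close> goes to \<open>dih_b p\<close>, so that only
  one end of an edge has to be named.\<close>

definition dih_eval :: "nat \<Rightarrow> 'v \<Rightarrow> 'v gword \<Rightarrow> real poly mat2" where
  "dih_eval p s w = gw_eval SL2 (\<lambda>v. if v = s then dih_a p else dih_b p) w"

lemma dih_gens_closed: "(\<lambda>v. if v = s then dih_a p else dih_b p) \<in> X \<rightarrow> carrier SL2"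
  by auto

lemma dih_eval_closed [simp]: "dih_eval p s w \<in> carrier SL2"
  unfolding dih_eval_def
  by (rule SL2.gw_eval_closed[of w UNIV]) (auto simp: gwords_iff)

lemma dih_eval_append: "dih_eval p s (u @ v) = dih_eval p s u \<otimes>\<^bsub>SL2\<^esub> dih_eval p s v"
  unfolding dih_eval_def
  by (rule SL2.gw_eval_append[of u UNIV]) (auto simp: gwords_iff)

lemma dih_eval_gw_inv: "dih_eval p s (gw_inv w) = inv\<^bsub>SL2\<^esub> (dih_eval p s w)"
  unfolding dih_eval_def
  by (rule SL2.gw_eval_inv[of w UNIV]) (auto simp: gwords_iff)

lemma dih_eval_Nil [simp]: "dih_eval p s [] = \<one>\<^bsub>SL2\<^esub>"
  by (simp add: dih_eval_def)

lemma dih_eval_wpow: "dih_eval p s (wpow n w) = dih_eval p s w [^]\<^bsub>SL2\<^esub> n"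
proof (induction n)
  case (Suc n)
  then show ?case
    using SL2.nat_pow_Suc2[of "dih_eval p s w" n]
    by (simp add: dih_eval_append del: SL2.nat_pow_Suc)
qed simp

lemma dih_eval_single:
  assumes "w \<in> gwords {t}" "s \<noteq> t"
  shows "dih_eval p s w = dih_b p [^]\<^bsub>SL2\<^esub> esum w"
  unfolding dih_eval_def using SL2.gw_eval_esum[OF assms(1), of "\<lambda>v. if v = s then dih_a p else dih_b p"] assms(2) by simp

lemma dih_eval_single':
  assumes "w \<in> gwords {s}"
  shows "dih_eval p s w = dih_a p [^]\<^bsub>SL2\<^esub> esum w"
  unfolding dih_eval_def using SL2.gw_eval_esum[OF assms(1), of "\<lambda>v. if v = s then dih_a p else dih_b p"] by simp

text \<open>Conjugation by the quarter turn exchanges the two generators. As edges are unordered,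
  this makes the relations independent of the end chosen as \<open>s\<close>.\<close>

lemma dih_eval_swap:
  assumes "w \<in> gwords {s, t}" "s \<noteq> t"
  shows "dih_eval p t w = \<one>\<^bsub>SL2\<^esub> \<longleftrightarrow> dih_eval p s w = \<one>\<^bsub>SL2\<^esub>"
proof -
  let ?J = quarter_turn
  let ?h = "SL2.conj_by (inv\<^bsub>SL2\<^esub> ?J)"
  have hom: "?h \<in> hom SL2 SL2" by (auto simp: hom_def SL2.conj_by_mult)
  have "?h (dih_a p) = (?J \<otimes>\<^bsub>SL2\<^esub> dih_a p) \<otimes>\<^bsub>SL2\<^esub> inv\<^bsub>SL2\<^esub> ?J"
    "?h (dih_b p) = (?J \<otimes>\<^bsub>SL2\<^esub> dih_b p) \<otimes>\<^bsub>SL2\<^esub> inv\<^bsub>SL2\<^esub> ?J"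
    by (simp_all add: SL2.conj_by_def)
  then have h: "?h (dih_a p) = dih_b p" "?h (dih_b p) = dih_a p"
    unfolding quarter_turn_swap[symmetric] by (simp_all add: SL2.m_assoc)
  have "dih_eval p t w = gw_eval SL2 (\<lambda>v. ?h (if v = s then dih_a p else dih_b p)) w"
    unfolding dih_eval_def using assms h by (intro gw_eval_cong[OF assms(1)]) auto
  also have "\<dots> = ?h (dih_eval p s w)"
    unfolding dih_eval_def by (rule SL2.gw_eval_hom[OF group_SL2 hom assms(1) dih_gens_closed])
  finally have e: "dih_eval p t w = ?h (dih_eval p s w)" .
  have "?h g = \<one>\<^bsub>SL2\<^esub> \<longleftrightarrow> g = \<one>\<^bsub>SL2\<^esub>" if "g \<in> carrier SL2" for g
  proof
    assume "?h g = \<one>\<^bsub>SL2\<^esub>"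
    then have "SL2.conj_by ?J (?h g) = SL2.conj_by ?J \<one>\<^bsub>SL2\<^esub>" by simp
    also have "\<dots> = \<one>\<^bsub>SL2\<^esub>" using SL2.l_inv[of ?J] SL2.r_one[of "inv\<^bsub>SL2\<^esub> ?J"]
      by (simp only: SL2.conj_by_def SL2.inv_closed quarter_turn_closed)
    finally show "g = \<one>\<^bsub>SL2\<^esub>" using SL2.conj_by_inv_cancel(2)[of ?J g] that by simp
  next
    assume "g = \<one>\<^bsub>SL2\<^esub>"
    then show "?h g = \<one>\<^bsub>SL2\<^esub>" by (simp only: SL2.conj_by_def SL2.inv_closed quarter_turn_closed
        SL2.inv_inv SL2.r_one SL2.r_inv)
  qed
  then show ?thesis using e by simp
qed

fun mat_poly :: "real \<Rightarrow> real poly mat2 \<Rightarrow> real mat2" where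
  "mat_poly x (a, b, c, d) = (poly a x, poly b x, poly c x, poly d x)"

lemma mat_poly_mult: "mat_poly x (M \<otimes>\<^bsub>SL2\<^esub> N) = mat_poly x M \<otimes>\<^bsub>SL2\<^esub> mat_poly x N"
  by (cases M; cases N) auto

lemma dih_at_0:
  assumes "\<beta> = pi / real p - pi / 2"
  shows "mat_poly 0 (dih_a p) = (cos \<beta>, - sin \<beta>, sin \<beta>, cos \<beta>)"
    "mat_poly 0 (dih_b p) = (cos \<beta>, - sin \<beta>, sin \<beta>, cos \<beta>)"
    "mat_poly 0 (inv\<^bsub>SL2\<^esub> (dih_a p)) = (cos \<beta>, sin \<beta>, - sin \<beta>, cos \<beta>)"
    "mat_poly 0 (inv\<^bsub>SL2\<^esub> (dih_b p)) = (cos \<beta>, sin \<beta>, - sin \<beta>, cos \<beta>)"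
proof -
  have b: "cos \<beta> = sin (pi / real p)" "sin \<beta> = - cos (pi / real p)"
    by (simp_all add: assms cos_diff sin_diff)
  show "mat_poly 0 (dih_a p) = (cos \<beta>, - sin \<beta>, sin \<beta>, cos \<beta>)"
    "mat_poly 0 (dih_b p) = (cos \<beta>, - sin \<beta>, sin \<beta>, cos \<beta>)"
    by (simp_all add: dih_a_def dih_b_def Let_def b)
  have "inv\<^bsub>SL2\<^esub> (dih_a p) = (let s = sin (pi / p); c = cos (pi / p) in ([:s:], - [:c, s:], - [:- c, s:], [:s, 0, s:]))"
    "inv\<^bsub>SL2\<^esub> (dih_b p) = (let s = sin (pi / p); c = cos (pi / p) in ([:s, 0, s:], - [:c, - s:], - [:- c, - s:], [:s:]))"
    using inv_SL2 dih_closed[of p] unfolding dih_a_def dih_b_def Let_def by blast+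
  then show "mat_poly 0 (inv\<^bsub>SL2\<^esub> (dih_a p)) = (cos \<beta>, sin \<beta>, - sin \<beta>, cos \<beta>)"
    "mat_poly 0 (inv\<^bsub>SL2\<^esub> (dih_b p)) = (cos \<beta>, sin \<beta>, - sin \<beta>, cos \<beta>)"
    by (simp_all add: Let_def b)
qed

text \<open>At the parameter 0 both generators become the rotation by \<open>\<beta>\<close>, so
  only the exponent sum survives. For exponent sum 0 the trace there is 2, as required by
  \<open>SL2_torsion_trivial\<close>.\<close>

lemma dih_eval_at_0:
  fixes \<beta> :: real
  assumes "\<beta> = pi / real p - pi / 2"
  shows "mat_poly 0 (dih_eval p s w) =
    (cos (esum w * \<beta>), - sin (esum w * \<beta>), sin (esum w * \<beta>), cos (esum w * \<beta>))"
proof (induction w)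
  case Nil
  then show ?case by (simp add: dih_eval_def)
next
  case (Cons a w)
  obtain x b where a: "a = (x, b)" by force
  let ?g = "if x = s then dih_a p else dih_b p"
  have "dih_eval p s (a # w) = (if b then ?g else inv\<^bsub>SL2\<^esub> ?g) \<otimes>\<^bsub>SL2\<^esub> dih_eval p s w"
    by (simp add: a dih_eval_def)
  then have e: "mat_poly 0 (dih_eval p s (a # w)) = mat_poly 0 (if b then ?g else inv\<^bsub>SL2\<^esub> ?g) \<otimes>\<^bsub>SL2\<^esub>
     (cos (esum w * \<beta>), - sin (esum w * \<beta>), sin (esum w * \<beta>), cos (esum w * \<beta>))"
    using Cons by (simp add: mat_poly_mult)
  show ?case
  proof (cases b)
    case True
    have s: "esum (a # w) * \<beta> = \<beta> + esum w * \<beta>" using True a by (simp add: algebra_simps)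
    have "mat_poly 0 ?g = (cos \<beta>, - sin \<beta>, sin \<beta>, cos \<beta>)" using dih_at_0[OF assms] by simp
    then show ?thesis using e True unfolding s by (simp add: cos_add sin_add algebra_simps)
  next
    case False
    have s: "esum (a # w) * \<beta> = esum w * \<beta> - \<beta>" using False a by (simp add: algebra_simps)
    have "mat_poly 0 (inv\<^bsub>SL2\<^esub> ?g) = (cos \<beta>, sin \<beta>, - sin \<beta>, cos \<beta>)" using dih_at_0[OF assms] by simp
    then show ?thesis using e False unfolding s by (simp add: cos_diff sin_diff algebra_simps)
  qed
qed

lemma dih_eval_torsion:
  assumes "esum w = 0" "n \<ge> 1" "dih_eval p s w [^]\<^bsub>SL2\<^esub> (n::nat) = \<one>\<^bsub>SL2\<^esub>"
  shows "dih_eval p s w = \<one>\<^bsub>SL2\<^esub>"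
proof -
  obtain a b c d where M: "dih_eval p s w = (a, b, c, d)" by (metis prod_cases4)
  have "poly (a + d) 0 = 2" using dih_eval_at_0[OF HOL.refl, of p s w] assms(1) M by simp
  then show ?thesis using SL2_torsion_trivial[OF dih_eval_closed M _ assms(2,3)] by simp
qed

lemma dih_b_trace:
  assumes "p \<ge> 2"
  obtains a b c d where "dih_b p = (a, b, c, d)" "degree (a + d) \<ge> 1"
proof -
  have "sin (pi / real p) \<noteq> 0" using sin_pi_div_pos[OF assms] by simp
  then show ?thesis using that[of "[:sin (pi / p):]" "[:cos (pi / p), - sin (pi / p):]"
      "[:- cos (pi / p), - sin (pi / p):]" "[:sin (pi / p), 0, sin (pi / p):]"]
    by (simp add: dih_b_def Let_def)
qed

text \<open>Unless \<open>esum w = 0\<close>, the element commutes with a non-trivial power of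
  \<open>dih_b p\<close> and hence with \<open>dih_b p\<close>, whose trace is not constant.
  Dividing by the power of \<open>dih_b p\<close> with the same exponent sum leaves a torsion
  element of exponent sum 0.\<close>

lemma dih_eval_isolated:
  assumes p: "p \<ge> 2" and st: "s \<noteq> t" and n: "n \<ge> 1"
    and pow: "dih_eval p s w [^]\<^bsub>SL2\<^esub> (n::nat) = dih_b p [^]\<^bsub>SL2\<^esub> (int n * esum w)"
  shows "dih_eval p s w = dih_b p [^]\<^bsub>SL2\<^esub> esum w"
proof -
  define g where "g = dih_eval p s w"
  define e where "e = esum w"
  have gc: "g \<in> carrier SL2" by (simp add: g_def)
  have comm: "g \<otimes>\<^bsub>SL2\<^esub> dih_b p [^]\<^bsub>SL2\<^esub> e = dih_b p [^]\<^bsub>SL2\<^esub> e \<otimes>\<^bsub>SL2\<^esub> g"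
  proof (cases "e = 0")
    case True
    then show ?thesis using gc SL2.l_one SL2.r_one by (simp del: SL2_simps)
  next
    case False
    define N where "N = nat \<bar>int n * e\<bar>"
    have N: "N \<ge> 1" using False n by (simp add: N_def Suc_le_eq)
    have c1: "g \<otimes>\<^bsub>SL2\<^esub> dih_b p [^]\<^bsub>SL2\<^esub> (int n * e) = dih_b p [^]\<^bsub>SL2\<^esub> (int n * e) \<otimes>\<^bsub>SL2\<^esub> g"
    proof -
      have "g \<otimes>\<^bsub>SL2\<^esub> g [^]\<^bsub>SL2\<^esub> n = g [^]\<^bsub>SL2\<^esub> n \<otimes>\<^bsub>SL2\<^esub> g"
        using gc SL2.nat_pow_Suc[of g n] SL2.nat_pow_Suc2[of g n] by simp
      then show ?thesis unfolding pow[folded g_def e_def] .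
    qed
    have "g \<otimes>\<^bsub>SL2\<^esub> dih_b p [^]\<^bsub>SL2\<^esub> N = dih_b p [^]\<^bsub>SL2\<^esub> N \<otimes>\<^bsub>SL2\<^esub> g"
    proof (cases "int n * e \<ge> 0")
      case True
      then have "int n * e = int N" unfolding N_def by linarith
      then have "dih_b p [^]\<^bsub>SL2\<^esub> (int n * e) = dih_b p [^]\<^bsub>SL2\<^esub> N" by (simp only: int_pow_int)
      then show ?thesis using c1 by simp
    next
      case False
      then have "int n * e = - int N" unfolding N_def by linarith
      then have "dih_b p [^]\<^bsub>SL2\<^esub> (int n * e) = inv\<^bsub>SL2\<^esub> (dih_b p [^]\<^bsub>SL2\<^esub> N)"
        by (simp only: SL2.int_pow_neg dih_closed int_pow_int)
      then have "inv\<^bsub>SL2\<^esub> (dih_b p [^]\<^bsub>SL2\<^esub> (int n * e)) = dih_b p [^]\<^bsub>SL2\<^esub> N" by simp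
      then show ?thesis using SL2.commute_inv[OF _ gc c1[symmetric]] by simp
    qed
    moreover obtain a b c d where "dih_b p = (a, b, c, d)" "degree (a + d) \<ge> 1"
      using dih_b_trace[OF p] by metis
    ultimately have "g \<otimes>\<^bsub>SL2\<^esub> dih_b p = dih_b p \<otimes>\<^bsub>SL2\<^esub> g"
      using SL2_commute_pow[OF dih_closed(2) _ _ gc N] by blast
    then have cp: "dih_b p [^]\<^bsub>SL2\<^esub> k \<otimes>\<^bsub>SL2\<^esub> g = g \<otimes>\<^bsub>SL2\<^esub> dih_b p [^]\<^bsub>SL2\<^esub> k" for k :: nat
      using SL2.group_commutes_pow[of "dih_b p" g k] gc by simp
    show ?thesis
    proof (cases e rule: int_cases2)
      case (nonneg k)
      then show ?thesis using cp[of k] by (simp only: int_pow_int)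
    next
      case (nonpos k)
      then show ?thesis using SL2.commute_inv[OF _ gc cp[of k]]
        by (simp only: SL2.int_pow_neg dih_closed int_pow_int SL2.nat_pow_closed)
    qed
  qed
  define u where "u = w @ gw_inv (letter_pow t e)"
  have lp: "dih_eval p s (letter_pow t e) = dih_b p [^]\<^bsub>SL2\<^esub> e"
    using dih_eval_single[of "letter_pow t e" t s p] st by simp
  have u: "dih_eval p s u = g \<otimes>\<^bsub>SL2\<^esub> inv\<^bsub>SL2\<^esub> (dih_b p [^]\<^bsub>SL2\<^esub> e)"
    by (simp add: u_def dih_eval_append dih_eval_gw_inv lp g_def)
  have bc: "dih_b p [^]\<^bsub>SL2\<^esub> e \<in> carrier SL2" by simp
  have "dih_eval p s u [^]\<^bsub>SL2\<^esub> n = g [^]\<^bsub>SL2\<^esub> n \<otimes>\<^bsub>SL2\<^esub> inv\<^bsub>SL2\<^esub> (dih_b p [^]\<^bsub>SL2\<^esub> e) [^]\<^bsub>SL2\<^esub> n"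
    unfolding u using SL2.commute_inv[OF bc gc comm[symmetric]] gc
    by (intro SL2.pow_mult_distrib) auto
  also have "inv\<^bsub>SL2\<^esub> (dih_b p [^]\<^bsub>SL2\<^esub> e) [^]\<^bsub>SL2\<^esub> n = inv\<^bsub>SL2\<^esub> (dih_b p [^]\<^bsub>SL2\<^esub> (int n * e))"
    using SL2.int_pow_pow[of "dih_b p" e "int n"] by (simp add: SL2.nat_pow_inv int_pow_int mult.commute)
  also have "g [^]\<^bsub>SL2\<^esub> n \<otimes>\<^bsub>SL2\<^esub> \<dots> = \<one>\<^bsub>SL2\<^esub>"
    using pow SL2.r_inv[of "dih_b p [^]\<^bsub>SL2\<^esub> (int n * e)"] by (simp add: g_def e_def del: SL2_simps)
  finally have "dih_eval p s u = \<one>\<^bsub>SL2\<^esub>"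
    by (intro dih_eval_torsion[OF _ n]) (simp_all add: u_def e_def)
  then have "g \<otimes>\<^bsub>SL2\<^esub> inv\<^bsub>SL2\<^esub> (dih_b p [^]\<^bsub>SL2\<^esub> e) = \<one>\<^bsub>SL2\<^esub>" using u by simp
  then have "g = dih_b p [^]\<^bsub>SL2\<^esub> e" using gc bc by (metis SL2.inv_closed SL2.inv_equality SL2.inv_inv)
  then show ?thesis by (simp add: g_def e_def)
qed

text \<open>By \<open>SL2_pow\<close> the upper right entries of positive powers are the same
  non-zero polynomial times \<open>c + s x\<close> and \<open>c - s x\<close>. One exponent on both
  sides is enough because exponent sums are compared separately.\<close>

lemma dih_pow_inter:
  assumes p: "p \<ge> 2" and eq: "dih_a p [^]\<^bsub>SL2\<^esub> (k::int) = dih_b p [^]\<^bsub>SL2\<^esub> k"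
  shows "k = 0"
proof (rule ccontr)
  assume "k \<noteq> 0"
  then obtain m where "k = int (Suc m) \<or> k = - int (Suc m)" by (metis int_cases2 not0_implies_Suc of_nat_0 neg_0_equal_iff_equal)
  then have pw: "dih_a p [^]\<^bsub>SL2\<^esub> Suc m = dih_b p [^]\<^bsub>SL2\<^esub> Suc m"
  proof
    assume "k = int (Suc m)"
    then show ?thesis using eq by (simp only: int_pow_int)
  next
    assume "k = - int (Suc m)"
    then have "inv\<^bsub>SL2\<^esub> (dih_a p [^]\<^bsub>SL2\<^esub> Suc m) = inv\<^bsub>SL2\<^esub> (dih_b p [^]\<^bsub>SL2\<^esub> Suc m)"
      using eq by (simp only: SL2.int_pow_neg dih_closed int_pow_int)
    then show ?thesis by (metis SL2.inv_inv SL2.nat_pow_closed dih_closed)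
  qed
  define s c where "s = sin (pi / p)" and "c = cos (pi / p)"
  have s: "s > 0" using sin_pi_div_pos[OF p] by (simp add: s_def)
  have d: "dih_a p = ([:s, 0, s:], [:c, s:], [:- c, s:], [:s:])"
    "dih_b p = ([:s:], [:c, - s:], [:- c, - s:], [:s, 0, s:])"
    by (simp_all add: dih_a_def dih_b_def s_def c_def Let_def)
  define t where "t = [:s, 0, s:] + [:s:]"
  have t: "degree t \<ge> 1" using s by (simp add: t_def)
  have tt: "[:s:] + [:s, 0, s:] = t" by (simp add: t_def)
  have "fst (snd (dih_a p [^]\<^bsub>SL2\<^esub> Suc m)) = cheb t (Suc m) * [:c, s:]"
    unfolding d(1) SL2_pow[OF dih_closed(1)[of p, unfolded d]] t_def[symmetric] by (simp only: fst_conv snd_conv)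
  moreover have "fst (snd (dih_b p [^]\<^bsub>SL2\<^esub> Suc m)) = cheb t (Suc m) * [:c, - s:]"
    unfolding d(2) SL2_pow[OF dih_closed(2)[of p, unfolded d]] tt by (simp only: fst_conv snd_conv)
  ultimately have "cheb t (Suc m) * [:c, s:] = cheb t (Suc m) * [:c, - s:]" using pw by simp
  then have "[:c, s:] = [:c, - s:]" using degree_cheb[OF t, of m] mult_left_cancel by blast
  then show False using s by simp
qed

text \<open>The evaluated matrix minus the identity squares to zero, so its powers are linear in the
  exponent.\<close>

lemma unipotent_pow:
  assumes M: "M \<in> carrier SL2" "mat_poly x M = (a, b, c, d)" "a + d = 2"
  shows "mat_poly x (M [^]\<^bsub>SL2\<^esub> (k::int)) = (1 + k * (a - 1), k * b, k * c, 1 + k * (d - 1))"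
proof -
  obtain a' b' c' d' where m: "M = (a', b', c', d')" by (metis prod_cases4)
  have pm: "poly a' x = a" "poly b' x = b" "poly c' x = c" "poly d' x = d" using M(2) m by auto
  have det: "a' * d' - b' * c' = 1" using M m by simp
  have t: "poly (cheb (a' + d') n) x = real n" for n
    using cheb_two[where 'a = real] M(3) pm by (simp add: poly_cheb)
  have nat: "mat_poly x (M [^]\<^bsub>SL2\<^esub> n) = (1 + real n * (a - 1), real n * b, real n * c, 1 + real n * (d - 1))"
    for n :: nat
  proof (cases n)
    case 0
    then show ?thesis by simp
  next
    case (Suc n')
    then show ?thesis using SL2_pow[of a' b' c' d' n'] M(1) pm
      unfolding m by (simp add: t algebra_simps del: cheb.simps)
  qed
  show ?thesis
  proof (cases k rule: int_cases2)
    case (nonneg n)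
    then show ?thesis using nat[of n] by (simp add: int_pow_int)
  next
    case (nonpos n)
    obtain e f g h where N: "M [^]\<^bsub>SL2\<^esub> n = (e, f, g, h)" by (metis prod_cases4)
    have "M [^]\<^bsub>SL2\<^esub> n \<in> carrier SL2" using M(1) by (rule SL2.nat_pow_closed)
    then have "inv\<^bsub>SL2\<^esub> (M [^]\<^bsub>SL2\<^esub> n) = (h, - f, - g, e)" using N inv_SL2 by metis
    then have i: "M [^]\<^bsub>SL2\<^esub> k = (h, - f, - g, e)"
      using nonpos M(1) by (simp only: SL2.int_pow_neg int_pow_int)
    have "real n = - real_of_int k" using nonpos by simp
    then have "poly e x = 1 - k * (a - 1)" "poly f x = - k * b" "poly g x = - k * c" "poly h x = 1 - k * (d - 1)"
      using nat[of n] N by simp_all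
    moreover have a: "a = 2 - d" using M(3) by simp
    ultimately show ?thesis using i unfolding a by (simp add: algebra_simps)
  qed
qed

text \<open>Three entries of the equation \<open>A^k B^j = B^l A^n\<close>, where
  \<open>A - 1\<close> has the rows \<open>(e, c + y)\<close> and \<open>(y - c, - e)\<close>, and
  \<open>B - 1\<close> the rows \<open>(- e, c - y)\<close> and \<open>(- c - y, e)\<close>;
  \<open>sum\<close> is the equality of exponent sums. The two solutions of sum and trace mean
  \<open>A^k B^j = B^j A^k\<close> or \<open>A^k B^j = B^k A^j\<close>, each impossible for
  \<open>k \<noteq> 0\<close>.\<close>

lemma separated_arith:
  fixes k j l n e c y :: real
  assumes "c > 0" "y > 0" and sum: "k + j = l + n" and j: "j \<noteq> 0"
    and e11: "(1 + k * e) * (1 - j * e) + k * (c + y) * (j * (- c - y)) = (1 - l * e) * (1 + n * e) + l * (c - y) * (n * (y - c))"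
    and e12: "(1 + k * e) * (j * (c - y)) + k * (c + y) * (1 + j * e) = (1 - l * e) * (n * (c + y)) + l * (c - y) * (1 - n * e)"
    and e22: "k * (y - c) * (j * (c - y)) + (1 - k * e) * (1 + j * e) = l * (- c - y) * (n * (c + y)) + (1 + l * e) * (1 - n * e)"
  shows "k = 0"
proof -
  \<comment> \<open>The sum of \<open>e11\<close> and \<open>e22\<close> is the equation of traces,
    in which the terms linear in \<open>e\<close> cancel.\<close>
  have "(k * j - l * n) * (2 * e\<^sup>2 + 2 * c\<^sup>2 + 2 * y\<^sup>2) = 0"
    using e11 e22 by (simp add: algebra_simps power2_eq_square)
  moreover have "2 * e\<^sup>2 + 2 * c\<^sup>2 + 2 * y\<^sup>2 > 0"
    using assms(1) by (simp add: add_nonneg_pos add_pos_nonneg)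
  ultimately have kj: "k * j = l * n" by simp
  \<comment> \<open>The pairs \<open>k, j\<close> and \<open>l, n\<close> have equal sums and equal
    products, so they are roots of the same quadratic polynomial.\<close>
  have "(k - n) * (k - l) = k * (k - (l + n)) + l * n" by (simp add: algebra_simps)
  also have "\<dots> = 0" using sum[symmetric] kj[symmetric] by (simp add: algebra_simps)
  finally consider "k = n" | "k = l" by auto
  then show ?thesis
  proof cases
    case 1
    then have "j = l" using sum by simp
    then have "k * j * (4 * c * y) = 0" using e11 1 by (simp add: algebra_simps)
    then show ?thesis using assms by simp
  next
    case 2
    then have jn: "n = j" using sum by simp
    have a: "(k - j) * e = 2 * (k * j * c * y)" using e11 unfolding jn 2[symmetric] by (simp add: algebra_simps)
    have b: "(k - j) * y = - 2 * (k * j * e * c)" using e12 unfolding jn 2[symmetric] by (simp add: algebra_simps)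
    have "(k - j) * (e\<^sup>2 + y\<^sup>2) = ((k - j) * e) * e + ((k - j) * y) * y"
      by (simp add: algebra_simps power2_eq_square)
    also have "\<dots> = 0" unfolding a b by (simp add: algebra_simps)
    finally have "k = j" using assms(2) by (auto simp: add_nonneg_pos sum_power2_eq_zero_iff)
    then show ?thesis using a assms by simp
  qed
qed

text \<open>At the parameter where the common trace is 2, both generators are unipotent.\<close>

lemma dih_separated:
  assumes p: "p \<ge> 3" and j: "j \<noteq> 0" and sum: "k + j + n = l"
    and eq: "dih_a p [^]\<^bsub>SL2\<^esub> k \<otimes>\<^bsub>SL2\<^esub> dih_b p [^]\<^bsub>SL2\<^esub> j \<otimes>\<^bsub>SL2\<^esub> dih_a p [^]\<^bsub>SL2\<^esub> (n::int)
        = dih_b p [^]\<^bsub>SL2\<^esub> (l::int)"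
  shows "k = 0"
proof -
  define s c where "s = sin (pi / p)" and "c = cos (pi / p)"
  have pp: "0 < pi / p" "pi / p < pi / 2" using p by (auto simp: field_simps)
  have s: "0 < s" using sin_pi_div_pos[of p] p by (simp add: s_def)
  have c: "0 < c" using pp by (simp add: c_def cos_gt_zero)
  have sc: "s\<^sup>2 + c\<^sup>2 = 1" by (simp add: s_def c_def)
  have "s < 1"
  proof (rule ccontr)
    assume "\<not> s < 1"
    then have "s\<^sup>2 \<ge> 1" by (simp add: one_le_power)
    then show False using sc c by (simp add: power2_eq_square) (smt (verit) mult_pos_pos)
  qed
  \<comment> \<open>The root of \<open>s * (2 + x * x) = 2\<close>, where the left side is the trace
    of both generators. It is positive because \<open>s < 1\<close>, which, like
    \<open>c > 0\<close>, rests on \<open>p \<ge> 3\<close>.\<close>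
  define x where "x = sqrt (2 / s - 2)"
  have "2 / s - 2 > 0" using s \<open>s < 1\<close> by (simp add: field_simps)
  then have x: "x > 0" "x * x = 2 / s - 2" by (simp_all add: x_def)
  define y where "y = s * x"
  have y: "y > 0" using s x by (simp add: y_def)
  have sx: "s * (x * x) = 2 - 2 * s" using x(2) s by (simp add: field_simps)
  have A: "mat_poly x (dih_a p) = (2 - s, c + y, y - c, s)"
    using sx by (simp add: dih_a_def Let_def y_def flip: s_def c_def) (simp add: algebra_simps)
  have B: "mat_poly x (dih_b p) = (s, c - y, - c - y, 2 - s)"
    using sx by (simp add: dih_b_def Let_def y_def flip: s_def c_def) (simp add: algebra_simps)
  have "dih_a p [^]\<^bsub>SL2\<^esub> k \<otimes>\<^bsub>SL2\<^esub> dih_b p [^]\<^bsub>SL2\<^esub> j = dih_b p [^]\<^bsub>SL2\<^esub> l \<otimes>\<^bsub>SL2\<^esub> dih_a p [^]\<^bsub>SL2\<^esub> (- n)"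
    unfolding eq[symmetric] by (simp add: SL2.m_assoc SL2.int_pow_neg)
  then have "mat_poly x (dih_a p [^]\<^bsub>SL2\<^esub> k) \<otimes>\<^bsub>SL2\<^esub> mat_poly x (dih_b p [^]\<^bsub>SL2\<^esub> j)
      = mat_poly x (dih_b p [^]\<^bsub>SL2\<^esub> l) \<otimes>\<^bsub>SL2\<^esub> mat_poly x (dih_a p [^]\<^bsub>SL2\<^esub> (- n))"
    by (metis mat_poly_mult)
  then have m: "(1 + k * (2 - s - 1), k * (c + y), k * (y - c), 1 + k * (s - 1)) \<otimes>\<^bsub>SL2\<^esub>
      (1 + j * (s - 1), j * (c - y), j * (- c - y), 1 + j * (2 - s - 1))
    = (1 + l * (s - 1), l * (c - y), l * (- c - y), 1 + l * (2 - s - 1)) \<otimes>\<^bsub>SL2\<^esub>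
      (1 + (- n) * (2 - s - 1), (- n) * (c + y), (- n) * (y - c), 1 + (- n) * (s - 1))"
    using unipotent_pow[OF dih_closed(1) A] unipotent_pow[OF dih_closed(2) B] by simp
  define e where "e = 1 - s"
  have "real_of_int k = 0"
  proof (rule separated_arith[OF c y, of k j l "- real_of_int n" e])
    show "real_of_int k + real_of_int j = real_of_int l + - real_of_int n" using sum by linarith
    show "real_of_int j \<noteq> 0" using j by simp
  qed (use m in \<open>simp_all add: e_def algebra_simps\<close>)
  then show ?thesis by simp
qed

text \<open>
  Imposing all relations of the matrices, not only the braid relation, makes the edge groups linear
  without a proof that the representation of the dihedral Artin group is faithful.
\<close>

definition edge_relations :: "'v set set \<Rightarrow> ('v set \<Rightarrow> nat) \<Rightarrow> ('v gword \<times> 'v gword) set" where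
  "edge_relations E lab = {(w, []) | w s t. {s, t} \<in> E \<and> s \<noteq> t \<and> w \<in> gwords {s, t} \<and>
     esum w = 0 \<and> dih_eval (lab {s, t}) s w = \<one>\<^bsub>SL2\<^esub>}"

section \<open>Parabolic subgroups of the quotient and their transfer between vertex sets\<close>

locale tf_graph =
  fixes E :: "'v set set" and lab :: "'v set \<Rightarrow> nat"
  assumes lab_ge_2: "\<And>e. e \<in> E \<Longrightarrow> lab e \<ge> 2" and card_edge: "\<And>e. e \<in> E \<Longrightarrow> card e = 2"
    and tf: "triangle_free E" and ttf: "two_two_free E lab"
begin

abbreviation R :: "('v gword \<times> 'v gword) set" where "R \<equiv> edge_relations E lab"

abbreviation Q :: "'v set \<Rightarrow> 'v gword set monoid" where "Q W \<equiv> presented_group W R"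

abbreviation cl :: "'v set \<Rightarrow> 'v gword \<Rightarrow> 'v gword set" where "cl W \<equiv> pres_class W R"

abbreviation par :: "'v set \<Rightarrow> 'v set \<Rightarrow> 'v gword set set" where "par \<equiv> parab R"

abbreviation emb :: "'v set \<Rightarrow> 'v set \<Rightarrow> bool" where "emb \<equiv> embeds R"

abbreviation isol :: "'v set \<Rightarrow> 'v set \<Rightarrow> bool" where
  "isol U W \<equiv> group.isolated_in (Q W) (carrier (Q W)) (par W U)"

lemma group_Q: "group (Q W)"
  by (rule group_presented_group)

lemma esum_cong: "pres_cong W R u v \<Longrightarrow> esum u = esum v"
  by (induction rule: pres_cong.induct) (auto simp: edge_relations_def)

lemma esum_cl: "u \<in> gwords W \<Longrightarrow> cl W u = cl W v \<Longrightarrow> esum u = esum v"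
  using esum_cong[of W u v] by (simp add: pres_class_eq_iff)

lemma cl_single:
  assumes "w \<in> gwords {a}" "a \<in> W"
  shows "cl W w = cl W [(a, True)] [^]\<^bsub>Q W\<^esub> esum w"
proof -
  interpret Q: group "Q W" by (rule group_Q)
  have "cl W [(a, True)] \<in> carrier (Q W)" using assms by simp
  then show ?thesis
    using Q.gw_eval_esum[OF assms(1), of "\<lambda>x. cl W [(x, True)]"] gw_eval_pres_class[OF assms(1), of W R] assms(2)
    by simp
qed

lemma cl_single_one:
  assumes "w \<in> gwords {a}" "a \<in> W" "esum w = 0"
  shows "cl W w = \<one>\<^bsub>Q W\<^esub>"
  using cl_single[OF assms(1,2)] assms(3) by simp

lemma embeds_single: "a \<in> W \<Longrightarrow> emb {a} W"
  using cl_single_one[of _ a "{a}"] esum_cong[of W]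
  by (fastforce simp: embeds_def one_presented pres_class_eq_iff)

lemma embeds_empty: "emb {} W"
  by (auto simp: embeds_def gwords_iff intro: pres_cong.refl)

lemma embeds_refl: "emb W W"
  by (simp add: embeds_def)

lemma rel_split:
  assumes W: "W = W1 \<union> W2"
    and edges: "\<And>s t. {s, t} \<in> E \<Longrightarrow> s \<noteq> t \<Longrightarrow> s \<in> W \<Longrightarrow> t \<in> W \<Longrightarrow> {s, t} \<subseteq> W1 \<or> {s, t} \<subseteq> W2"
    and uv: "(u, v) \<in> R" "u \<in> gwords W"
  shows "u \<in> gwords W1 \<and> v \<in> gwords W1 \<or> u \<in> gwords W2 \<and> v \<in> gwords W2"
proof -
  obtain s t where st: "v = []" "{s, t} \<in> E" "s \<noteq> t" "u \<in> gwords {s, t}"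
    using uv by (auto simp: edge_relations_def)
  \<comment> \<open>The edge need not lie in \<open>W\<close>: its relator may use only the end that
    does. Hence the intersection.\<close>
  have "{s, t} \<inter> W \<subseteq> W1 \<or> {s, t} \<inter> W \<subseteq> W2"
    using edges[OF st(2,3)] W by blast
  moreover have "fst ` set u \<subseteq> {s, t} \<inter> W" using uv st by (auto simp: gwords_iff)
  ultimately have "fst ` set u \<subseteq> W1 \<or> fst ` set u \<subseteq> W2" by blast
  then show ?thesis using st(1) by (simp add: gwords_iff)
qed

lemma amalgam_Q:
  assumes W: "W = W1 \<union> W2"
    and edges: "\<And>s t. {s, t} \<in> E \<Longrightarrow> s \<noteq> t \<Longrightarrow> s \<in> W \<Longrightarrow> t \<in> W \<Longrightarrow> {s, t} \<subseteq> W1 \<or> {s, t} \<subseteq> W2"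
    and emb: "emb (W1 \<inter> W2) W1" "emb (W1 \<inter> W2) W2"
  shows "amalgam (Q W) (\<lambda>i. par W (if i then W1 else W2)) (par W (W1 \<inter> W2))"
    and "emb W1 W" "emb W2 W"
  using amalgam_presented[OF W rel_split[OF W edges] emb] by blast+

lemma isolI:
  assumes "\<And>w n. w \<in> gwords W \<Longrightarrow> n \<ge> 1 \<Longrightarrow> cl W (wpow n w) \<in> par W U \<Longrightarrow> cl W w \<in> par W U"
  shows "isol U W"
proof -
  interpret Q: group "Q W" by (rule group_Q)
  show ?thesis unfolding Q.isolated_in_def
    using assms by (auto simp: carrier_presented pres_class_pow)
qed

lemma isolD:
  assumes "isol U W" "w \<in> gwords W" "n \<ge> 1" "cl W (wpow n w) \<in> par W U"
  shows "cl W w \<in> par W U"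
proof -
  interpret Q: group "Q W" by (rule group_Q)
  show ?thesis using Q.isolated_inD[OF assms(1), of "cl W w" n] assms by (simp add: pres_class_pow)
qed

text \<open>\<open>isol U W1\<close> concerns the group on \<open>W1\<close>; amalgams need the
  property inside the group on \<open>W\<close>, and \<open>emb W1 W\<close> permits pulling the
  equations back.\<close>

lemma isol_transfer:
  assumes "isol U W1" "emb W1 W" "U \<subseteq> W1" "W1 \<subseteq> W"
  shows "group.isolated_in (Q W) (par W W1) (par W U)"
proof -
  interpret Q: group "Q W" by (rule group_Q)
  show ?thesis unfolding Q.isolated_in_def
  proof (intro ballI allI impI)
    fix g and n :: nat assume g: "g \<in> par W W1" "n \<ge> 1" "g [^]\<^bsub>Q W\<^esub> n \<in> par W U"
    obtain w where w: "w \<in> gwords W1" "g = cl W w" using g by (auto simp: parab_def)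
    have wW: "w \<in> gwords W" using w gwords_mono[OF assms(4)] by blast
    obtain u where u: "u \<in> gwords U" "cl W (wpow n w) = cl W u"
      using g w pres_class_pow[OF wW] by (auto simp: parab_def)
    have uW1: "u \<in> gwords W1" using u gwords_mono[OF assms(3)] by blast
    have "cl W1 (wpow n w) = cl W1 u"
      using embedsD[OF assms(2,4) _ uW1 u(2)] w wpow_gwords by blast
    then have "cl W1 w \<in> par W1 U" using isolD[OF assms(1) w(1) g(2)] u by (simp add: parab_def)
    then obtain u' where u': "u' \<in> gwords U" "cl W1 w = cl W1 u'" by (auto simp: parab_def)
    then have "cl W w = cl W u'" using pres_class_mono[OF assms(4) w(1)] by blast
    then show "g \<in> par W U" using w u' by (simp add: parab_def)
  qed
qed

lemma isol_trans:
  assumes "isol U U'" "emb U' W" "isol U' W" "U \<subseteq> U'" "U' \<subseteq> W"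
  shows "isol U W"
proof -
  interpret Q: group "Q W" by (rule group_Q)
  show ?thesis
    using isol_transfer[OF assms(1,2,4,5)] assms(3) parab_mono[OF assms(4), of R W]
    unfolding Q.isolated_in_def by blast
qed

lemma inter_transfer:
  assumes "par W1 U \<inter> par W1 U' = {\<one>\<^bsub>Q W1\<^esub>}" "emb W1 W" "U \<subseteq> W1" "U' \<subseteq> W1" "W1 \<subseteq> W"
  shows "par W U \<inter> par W U' = {\<one>\<^bsub>Q W\<^esub>}"
proof
  show "par W U \<inter> par W U' \<subseteq> {\<one>\<^bsub>Q W\<^esub>}"
  proof
    fix g assume "g \<in> par W U \<inter> par W U'"
    then obtain u v where uv: "u \<in> gwords U" "v \<in> gwords U'" "g = cl W u" "cl W u = cl W v"
      by (auto simp: parab_def)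
    have w: "u \<in> gwords W1" "v \<in> gwords W1" using uv gwords_mono assms by blast+
    have "cl W1 u = cl W1 v" using embedsD[OF assms(2,5) w uv(4)] .
    then have "cl W1 u \<in> par W1 U \<inter> par W1 U'" using uv by (auto simp: parab_def)
    then have "cl W1 u = cl W1 []" using assms(1) by (simp add: one_presented)
    then have "cl W u = cl W []" using pres_class_mono[OF assms(5) w(1)] by blast
    then show "g \<in> {\<one>\<^bsub>Q W\<^esub>}" using uv by (simp add: one_presented)
  qed
  show "{\<one>\<^bsub>Q W\<^esub>} \<subseteq> par W U \<inter> par W U'"
    using assms subgroup.one_closed[OF parab_subgroup, of _ W R] by auto
qed

lemma separated_transfer:
  assumes "group.separated (Q W1) (par W1 Z) (par W1 U)" "emb W1 W" "Z \<subseteq> W1" "U \<subseteq> W1" "W1 \<subseteq> W"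
  shows "group.separated (Q W) (par W Z) (par W U)"
proof -
  interpret Q: group "Q W" by (rule group_Q)
  interpret Q1: group "Q W1" by (rule group_Q)
  show ?thesis unfolding Q.separated_def
  proof (intro ballI impI)
    fix z z' b assume z: "z \<in> par W Z" "z' \<in> par W Z" and b: "b \<in> par W U" "b \<noteq> \<one>\<^bsub>Q W\<^esub>"
      and zbz: "z \<otimes>\<^bsub>Q W\<^esub> b \<otimes>\<^bsub>Q W\<^esub> z' \<in> par W U"
    obtain u u' v where u: "u \<in> gwords Z" "z = cl W u" "u' \<in> gwords Z" "z' = cl W u'"
        "v \<in> gwords U" "b = cl W v" using z b by (auto simp: parab_def)
    have w1: "u \<in> gwords W1" "u' \<in> gwords W1" "v \<in> gwords W1"
      using u gwords_mono assms(3,4) by blast+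
    have w: "u \<in> gwords W" "u' \<in> gwords W" "v \<in> gwords W"
      using w1 gwords_mono[OF assms(5)] by blast+
    obtain v' where v': "v' \<in> gwords U" "cl W (u @ v @ u') = cl W v'"
      using zbz u w by (auto simp: parab_def presented_group_mult)
    have v'1: "v' \<in> gwords W1" using v' gwords_mono assms(4) by blast
    have "cl W1 (u @ v @ u') = cl W1 v'" using embedsD[OF assms(2,5) _ v'1 v'(2)] w1 by simp
    then have "cl W1 u \<otimes>\<^bsub>Q W1\<^esub> cl W1 v \<otimes>\<^bsub>Q W1\<^esub> cl W1 u' \<in> par W1 U"
      using w1 v' by (simp add: presented_group_mult parab_def)
    moreover have "cl W1 v \<noteq> \<one>\<^bsub>Q W1\<^esub>"
      using b u pres_class_mono[OF assms(5) w1(3), of R "[]"] by (auto simp: one_presented)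
    ultimately have "cl W1 u = \<one>\<^bsub>Q W1\<^esub>"
      using assms(1) u unfolding Q1.separated_def by (auto simp: parab_def)
    then show "z = \<one>\<^bsub>Q W\<^esub>"
      using u pres_class_mono[OF assms(5) w1(1), of R "[]"] by (simp add: one_presented)
  qed
qed

section \<open>The group of a single edge\<close>

lemma dih_eval_cong:
  assumes e: "{s, t} \<in> E" "s \<noteq> t" and "pres_cong {s, t} R u v"
  shows "dih_eval (lab {s, t}) s u = dih_eval (lab {s, t}) s v"
  unfolding dih_eval_def
proof (rule SL2.pres_cong_gw_eval[OF dih_gens_closed _ assms(3)])
  fix u v assume uv: "(u, v) \<in> R" "u \<in> gwords {s, t}"
  then obtain s' t' where st: "v = []" "{s', t'} \<in> E" "s' \<noteq> t'" "u \<in> gwords {s', t'}" "esum u = 0"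
      "dih_eval (lab {s', t'}) s' u = \<one>\<^bsub>SL2\<^esub>"
    by (auto simp: edge_relations_def)
  have "dih_eval (lab {s, t}) s u = \<one>\<^bsub>SL2\<^esub>"
  proof (cases "{s', t'} = {s, t}")
    case True
    then consider "s' = s" "t' = t" | "s' = t" "t' = s" by (auto simp: doubleton_eq_iff)
    then show ?thesis
    proof cases
      case 1
      then show ?thesis using st by simp
    next
      case 2
      then show ?thesis using st(6) dih_eval_swap[OF uv(2) e(2)] by (simp add: insert_commute)
    qed
  next
    case False
    \<comment> \<open>A different edge shares at most one vertex, so the relator is a word in one
      letter, and exponent sum 0 makes it trivial.\<close>
    have "fst ` set u \<subseteq> {s, t} \<inter> {s', t'}" using uv st by (auto simp: gwords_iff)
    then have "u \<in> gwords {s} \<or> u \<in> gwords {t}"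
      using False st(3) e(2) unfolding gwords_iff by blast
    then show ?thesis
    proof
      assume "u \<in> gwords {s}"
      then show ?thesis using dih_eval_single'[of u s] st(5) by simp
    next
      assume "u \<in> gwords {t}"
      then show ?thesis using dih_eval_single[of u t s] st(5) e(2) by simp
    qed
  qed
  then show "gw_eval SL2 (\<lambda>v. if v = s then dih_a (lab {s, t}) else dih_b (lab {s, t})) u
      = gw_eval SL2 (\<lambda>v. if v = s then dih_a (lab {s, t}) else dih_b (lab {s, t})) v"
    using st(1) by (simp add: dih_eval_def)
qed

lemma dih_eval_cl:
  assumes "{s, t} \<in> E" "s \<noteq> t" "u \<in> gwords {s, t}" "cl {s, t} u = cl {s, t} v"
  shows "dih_eval (lab {s, t}) s u = dih_eval (lab {s, t}) s v"
  using dih_eval_cong assms by (simp add: pres_class_eq_iff)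

text \<open>Holds by construction: every word over the edge with trivial matrix and exponent sum 0
  is a defining relator.\<close>

lemma dih_eval_faithful:
  assumes e: "{s, t} \<in> E" "s \<noteq> t" and uv: "u \<in> gwords {s, t}" "v \<in> gwords {s, t}"
    and "esum u = esum v" "dih_eval (lab {s, t}) s u = dih_eval (lab {s, t}) s v"
  shows "pres_cong {s, t} R u v"
proof -
  have "dih_eval (lab {s, t}) s (gw_inv v @ u) = \<one>\<^bsub>SL2\<^esub>"
    using assms(6) SL2.l_inv[OF dih_eval_closed] by (simp add: dih_eval_append dih_eval_gw_inv del: SL2_simps)
  moreover have "gw_inv v @ u \<in> gwords {s, t}" using uv by simp
  moreover have "esum (gw_inv v @ u) = 0" using assms(5) by simp
  ultimately have "(gw_inv v @ u, []) \<in> R" using e unfolding edge_relations_def by blast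
  then have "pres_cong {s, t} R (gw_inv v @ u) []" using uv by (intro pres_cong.relation) auto
  then show ?thesis using pres_cong_iff_inv[OF uv] by blast
qed

text \<open>A common element is a power of either letter, with one exponent by the exponent sum, so
  \<open>dih_pow_inter\<close> applies.\<close>

lemma edge_inter:
  assumes e: "{a, b} \<in> E" "a \<noteq> b"
  shows "par {a, b} {b} \<inter> par {a, b} {a} = {\<one>\<^bsub>Q {a, b}\<^esub>}"
proof
  show "par {a, b} {b} \<inter> par {a, b} {a} \<subseteq> {\<one>\<^bsub>Q {a, b}\<^esub>}"
  proof
    fix g assume "g \<in> par {a, b} {b} \<inter> par {a, b} {a}"
    then obtain u v where uv: "u \<in> gwords {b}" "v \<in> gwords {a}" "g = cl {a, b} u" "cl {a, b} u = cl {a, b} v"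
      by (auto simp: parab_def)
    have uw: "u \<in> gwords {a, b}" using uv(1) gwords_mono[of "{b}" "{a, b}"] by blast
    have es: "esum u = esum v" using esum_cl[OF uw uv(4)] .
    have "dih_b (lab {a, b}) [^]\<^bsub>SL2\<^esub> esum u = dih_a (lab {a, b}) [^]\<^bsub>SL2\<^esub> esum v"
      using dih_eval_cl[OF e uw uv(4)] dih_eval_single[OF uv(1) e(2)] dih_eval_single'[OF uv(2)] by simp
    then have "esum u = 0" using dih_pow_inter[OF lab_ge_2[OF e(1)]] es by simp
    then show "g \<in> {\<one>\<^bsub>Q {a, b}\<^esub>}" using cl_single_one[OF uv(1), of "{a, b}"] uv(3) by simp
  qed
  show "{\<one>\<^bsub>Q {a, b}\<^esub>} \<subseteq> par {a, b} {b} \<inter> par {a, b} {a}"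
    using subgroup.one_closed[OF parab_subgroup, of _ "{a, b}" R] by auto
qed

lemma edge_isol:
  assumes e: "{a, b} \<in> E" "a \<noteq> b"
  shows "isol {b} {a, b}"
proof (rule isolI)
  fix w and n :: nat assume w: "w \<in> gwords {a, b}" "n \<ge> 1" and "cl {a, b} (wpow n w) \<in> par {a, b} {b}"
  then obtain u where u: "u \<in> gwords {b}" "cl {a, b} (wpow n w) = cl {a, b} u" by (auto simp: parab_def)
  let ?p = "lab {a, b}"
  have ww: "wpow n w \<in> gwords {a, b}" using w wpow_gwords by blast
  have "int n * esum w = esum u" using esum_cl[OF ww u(2)] by simp
  then have "dih_eval ?p a w [^]\<^bsub>SL2\<^esub> n = dih_b ?p [^]\<^bsub>SL2\<^esub> (int n * esum w)"
    using dih_eval_cl[OF e ww u(2)] dih_eval_single[OF u(1) e(2)] by (simp add: dih_eval_wpow)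
  then have "dih_eval ?p a w = dih_b ?p [^]\<^bsub>SL2\<^esub> esum w"
    by (rule dih_eval_isolated[OF lab_ge_2[OF e(1)] e(2) w(2)])
  also have "\<dots> = dih_eval ?p a (letter_pow b (esum w))"
    using dih_eval_single[of "letter_pow b (esum w)" b a ?p] e(2) by simp
  finally have "cl {a, b} w = cl {a, b} (letter_pow b (esum w))"
    using dih_eval_faithful[OF e w(1), of "letter_pow b (esum w)"] w(1) by (simp add: pres_class_eq_iff)
  then show "cl {a, b} w \<in> par {a, b} {b}" by (auto simp: parab_def)
qed

lemma edge_separated:
  assumes e: "{a, b} \<in> E" "a \<noteq> b" and lab: "lab {a, b} \<ge> 3"
  shows "group.separated (Q {a, b}) (par {a, b} {a}) (par {a, b} {b})"
proof -
  let ?W = "{a, b}" and ?p = "lab {a, b}"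
  interpret Q: group "Q ?W" by (rule group_Q)
  show ?thesis unfolding Q.separated_def
  proof (intro ballI impI)
    fix z z' g assume z: "z \<in> par ?W {a}" "z' \<in> par ?W {a}" and g: "g \<in> par ?W {b}" "g \<noteq> \<one>\<^bsub>Q ?W\<^esub>"
      and zgz: "z \<otimes>\<^bsub>Q ?W\<^esub> g \<otimes>\<^bsub>Q ?W\<^esub> z' \<in> par ?W {b}"
    obtain u u' v where u: "u \<in> gwords {a}" "z = cl ?W u" "u' \<in> gwords {a}" "z' = cl ?W u'"
        "v \<in> gwords {b}" "g = cl ?W v" using z g by (auto simp: parab_def)
    have w: "u \<in> gwords ?W" "u' \<in> gwords ?W" "v \<in> gwords ?W"
      using u gwords_mono[of "{a}" ?W] gwords_mono[of "{b}" ?W] by blast+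
    obtain v' where v': "v' \<in> gwords {b}" "cl ?W (u @ v @ u') = cl ?W v'"
      using zgz u w by (auto simp: parab_def presented_group_mult)
    have ww: "u @ v @ u' \<in> gwords ?W" using w by simp
    have es: "esum u + esum v + esum u' = esum v'" using esum_cl[OF ww v'(2)] by simp
    have "esum v \<noteq> 0" using g(2) u cl_single_one[of v b ?W] by auto
    moreover have "dih_a ?p [^]\<^bsub>SL2\<^esub> esum u \<otimes>\<^bsub>SL2\<^esub> dih_b ?p [^]\<^bsub>SL2\<^esub> esum v \<otimes>\<^bsub>SL2\<^esub> dih_a ?p [^]\<^bsub>SL2\<^esub> esum u'
        = dih_b ?p [^]\<^bsub>SL2\<^esub> esum v'"
      using dih_eval_cl[OF e ww v'(2)] dih_eval_single[OF u(5) e(2)] dih_eval_single[OF v'(1) e(2)]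
        dih_eval_single'[OF u(1)] dih_eval_single'[OF u(3)]
      by (simp add: dih_eval_append SL2.m_assoc)
    ultimately have "esum u = 0" using dih_separated[OF lab _ es] by blast
    then show "z = \<one>\<^bsub>Q ?W\<^esub>" using u(2) cl_single_one[OF u(1)] by simp
  qed
qed

section \<open>Stars and the splitting at a vertex\<close>

lemma edge_subset_star:
  assumes "\<And>x y. x \<in> N \<Longrightarrow> y \<in> N \<Longrightarrow> {x, y} \<notin> E" "b \<in> N"
    and "{s, t} \<in> E" "s \<noteq> t" "s \<in> insert a N" "t \<in> insert a N"
  shows "{s, t} \<subseteq> insert a (N - {b}) \<or> {s, t} \<subseteq> {a, b}"
  using assms by blast

text \<open>Induction on the leaves: a new leaf \<open>b\<close> amalgamates the old star with the
  edge \<open>{a, b}\<close> over the group of \<open>a\<close>. The leaf groups of both parts meet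
  the group of \<open>a\<close> trivially, so alternating products of their elements are normal
  forms of the amalgam. Only separation depends on the labels, since two commuting letters are not
  separated.\<close>

lemma star:
  assumes "finite N" "a \<notin> N" "\<And>x y. x \<in> N \<Longrightarrow> y \<in> N \<Longrightarrow> {x, y} \<notin> E" "\<And>b. b \<in> N \<Longrightarrow> {a, b} \<in> E"
  shows "par (insert a N) N \<inter> par (insert a N) {a} = {\<one>\<^bsub>Q (insert a N)\<^esub>} \<and> emb N (insert a N) \<and>
    ((\<forall>b\<in>N. lab {a, b} \<ge> 3) \<longrightarrow>
      group.separated (Q (insert a N)) (par (insert a N) {a}) (par (insert a N) N))"
  using assms
proof (induction N rule: finite_induct)
  case empty
  interpret Q: group "Q {a}" by (rule group_Q)
  have "par {a} {} = {\<one>\<^bsub>Q {a}\<^esub>}"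
    by (auto simp: parab_def gwords_iff one_presented)
  moreover have "\<one>\<^bsub>Q {a}\<^esub> \<in> par {a} {a}" using parab_self[of R "{a}"] by simp
  ultimately show ?case using embeds_empty by (auto simp: Q.separated_def)
next
  case (insert b N)
  define W W1 W2 where "W = insert a (insert b N)" and "W1 = insert a N" and "W2 = {a, b}"
  have W: "W = W1 \<union> W2" "W1 \<inter> W2 = {a}" "W1 \<subseteq> W" "W2 \<subseteq> W"
    using insert by (auto simp: W_def W1_def W2_def)
  have ab: "{a, b} \<in> E" "a \<noteq> b" using insert by auto
  have IH: "par W1 N \<inter> par W1 {a} = {\<one>\<^bsub>Q W1\<^esub>}" "emb N W1"
    "(\<forall>b\<in>N. lab {a, b} \<ge> 3) \<longrightarrow> group.separated (Q W1) (par W1 {a}) (par W1 N)"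
    using insert by (auto simp: W1_def)
  have edges: "{s, t} \<subseteq> W1 \<or> {s, t} \<subseteq> W2" if "{s, t} \<in> E" "s \<noteq> t" "s \<in> W" "t \<in> W" for s t
    using edge_subset_star[of "insert b N" b s t a] that insert by (auto simp: W_def W1_def W2_def)
  have e1: "emb (W1 \<inter> W2) W1" "emb (W1 \<inter> W2) W2"
    unfolding W(2) using embeds_single by (auto simp: W1_def W2_def)
  note am = amalgam_Q[OF W(1) edges e1, unfolded W(2)]
  interpret A: amalgam "Q W" "\<lambda>i. par W (if i then W1 else W2)" "par W {a}" using am(1) .
  define B where "B i = par W (if i then N else {b})" for i
  have Bsub: "subgroup (B i) (Q W)" for i unfolding B_def by (rule parab_subgroup) (auto simp: W_def)
  have BP: "B i \<subseteq> par W (if i then W1 else W2)" for i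
    unfolding B_def by (rule parab_mono) (auto simp: W1_def W2_def)
  have "par W N \<inter> par W {a} = {\<one>\<^bsub>Q W\<^esub>}"
    by (rule inter_transfer[OF IH(1) am(2) _ _ W(3)]) (auto simp: W1_def)
  moreover have "par W {b} \<inter> par W {a} = {\<one>\<^bsub>Q W\<^esub>}"
    by (rule inter_transfer[OF edge_inter[OF ab, folded W2_def] am(3) _ _ W(4)]) (auto simp: W2_def)
  ultimately have BC: "B i \<inter> par W {a} = {\<one>\<^bsub>Q W\<^esub>}" for i by (simp add: B_def)
  have gen: "generate (Q W) (B True \<union> B False) = par W (insert b N)"
    using generate_parab[of N "{b}" W R] by (auto simp: B_def W_def)
  have S1: "par W (insert b N) \<inter> par W {a} = {\<one>\<^bsub>Q W\<^esub>}"
    using A.sub_inter_C[of B, OF Bsub BP BC] by (simp only: gen)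
  have S3: "group.separated (Q W) (par W {a}) (par W (insert b N))" if lab: "\<forall>x\<in>insert b N. lab {a, x} \<ge> 3"
  proof -
    have "group.separated (Q W) (par W {a}) (par W N)"
      using IH(3) lab by (intro separated_transfer[OF _ am(2) _ _ W(3)]) (auto simp: W1_def)
    moreover have "group.separated (Q W) (par W {a}) (par W {b})"
      using edge_separated[OF ab, folded W2_def] lab
      by (intro separated_transfer[OF _ am(3) _ _ W(4)]) (auto simp: W2_def)
    ultimately have "group.separated (Q W) (par W {a}) (B i)" for i by (simp add: B_def)
    from A.sub_separated[of B, OF Bsub BP BC this] show ?thesis by (simp only: gen)
  qed
  have S2: "emb (insert b N) W"
    unfolding embeds_def
  proof (intro ballI impI)
    fix w assume w: "w \<in> gwords (insert b N)" "pres_cong W R w []"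
    let ?M = "insert b N"
    interpret M: group "Q ?M" by (rule group_Q)
    have MW: "?M \<subseteq> W" by (auto simp: W_def)
    define P' where "P' i = par ?M (if i then N else {b})" for i
    have P': "subgroup (P' i) (Q ?M)" for i unfolding P'_def by (rule parab_subgroup) auto
    have one: "{\<one>\<^bsub>Q ?M\<^esub>} \<subseteq> P' i" for i using subgroup.one_closed[OF P'] by simp
    \<comment> \<open>A word over the leaves is decomposed in the group \<open>Q ?M\<close> on the
      leaves alone. The image of this decomposition in \<open>Q W\<close> is reduced in the amalgam,
      so it can be trivial only if it is empty.\<close>
    have "generate (Q ?M) (P' True \<union> P' False) = carrier (Q ?M)"
      using generate_parab[of N "{b}" ?M R] parab_self[of R ?M] by (simp add: P'_def)
    then have "cl ?M w \<in> generate (Q ?M) (P' True \<union> P' False)" using w(1) by simp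
    then obtain xs c where xs: "M.reduced P' {\<one>\<^bsub>Q ?M\<^esub>} xs" "c \<in> {\<one>\<^bsub>Q ?M\<^esub>}" "cl ?M w = M.wprod xs \<otimes>\<^bsub>Q ?M\<^esub> c"
      using M.reduced_decomposition[of P' "{\<one>\<^bsub>Q ?M\<^esub>}", OF P' M.triv_subgroup one] by metis
    have xc: "snd ` set xs \<subseteq> carrier (Q ?M)"
      using M.reduced_carrier[OF subgroup.subset[OF P'] xs(1)] .
    then have wx: "cl ?M w = M.wprod xs" using xs by simp
    obtain h where h: "h \<in> hom (Q ?M) (Q W)" "\<And>w. w \<in> gwords ?M \<Longrightarrow> h (cl ?M w) = cl W w"
      using incl_hom[OF MW] by metis
    have hx: "h x \<in> B i \<and> h x \<notin> par W {a}" if x: "x \<in> P' i" "x \<noteq> \<one>\<^bsub>Q ?M\<^esub>" for x i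
    proof -
      define U where "U = (if i then N else {b})"
      have U: "U \<subseteq> ?M" "U \<subseteq> W" by (auto simp: U_def W_def)
      have eU: "emb U W"
        using embeds_trans[OF IH(2) am(2)] embeds_single[of b W] by (auto simp: U_def W1_def W_def)
      obtain u where u: "u \<in> gwords U" "x = cl ?M u" using x by (auto simp: P'_def U_def parab_def)
      have uM: "u \<in> gwords ?M" using u gwords_mono[OF U(1)] by blast
      have hu: "h x = cl W u" using h(2)[OF uM] u by simp
      have "h x \<noteq> \<one>\<^bsub>Q W\<^esub>"
      proof
        assume "h x = \<one>\<^bsub>Q W\<^esub>"
        then have "cl U u = cl U []" using embedsD[OF eU U(2) u(1), of "[]"] hu by (simp add: one_presented)
        then show False using pres_class_mono[OF U(1) u(1)] x u by (simp add: one_presented)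
      qed
      moreover have "h x \<in> B i" using hu u by (simp add: B_def U_def parab_def)
      ultimately show ?thesis using BC[of i] by blast
    qed
    have "A.red (map (\<lambda>(i, x). (i, h x)) xs) \<and> A.wprod (map (\<lambda>(i, x). (i, h x)) xs) = h (M.wprod xs)"
      using xs(1) xc
    proof (induction xs)
      case Nil
      then show ?case using hom_one[OF h(1)] M.group_axioms A.group_axioms by simp
    next
      case (Cons y ys)
      obtain i x where y: "y = (i, x)" by force
      have r: "M.reduced P' {\<one>\<^bsub>Q ?M\<^esub>} ys" "x \<in> P' i" "x \<noteq> \<one>\<^bsub>Q ?M\<^esub>" "ys \<noteq> [] \<Longrightarrow> i \<noteq> fst (hd ys)"
        using Cons.prems y by (auto simp: M.reduced_Cons)
      have c: "x \<in> carrier (Q ?M)" "M.wprod ys \<in> carrier (Q ?M)" using Cons.prems y by auto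
      have "A.red (map (\<lambda>(i, x). (i, h x)) (y # ys))"
        using Cons hx[OF r(2,3)] r(1,4) BP[of i] y
        by (auto simp: A.reduced_Cons hd_map case_prod_unfold)
      moreover have "A.wprod (map (\<lambda>(i, x). (i, h x)) (y # ys)) = h (M.wprod (y # ys))"
        using Cons r(1) y hom_mult[OF h(1) c] by simp
      ultimately show ?case by blast
    qed
    moreover have "h (M.wprod xs) = \<one>\<^bsub>Q W\<^esub>"
      using h(2)[OF w(1)] wx w(2) pres_class_eq_iff[of w W R "[]"] pres_cong_gwords[OF w(2)]
      by (simp add: one_presented)
    ultimately have "xs = []" using A.normal_form[of "map (\<lambda>(i, x). (i, h x)) xs"] by auto
    then show "pres_cong ?M R w []" using wx w(1) pres_class_eq_iff[of w ?M R "[]"] by (simp add: one_presented)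
  qed
  show ?case using S1 S2 S3 by (auto simp: W_def)
qed

definition nbrs :: "'v set \<Rightarrow> 'v \<Rightarrow> 'v set" where
  "nbrs W a = {b \<in> W. b \<noteq> a \<and> {a, b} \<in> E}"

text \<open>Two adjacent neighbours would form a triangle with \<open>a\<close>; so a vertex and its
  neighbours span a star.\<close>

lemma nbrs_independent:
  assumes "x \<in> nbrs W a" "y \<in> nbrs W a"
  shows "{x, y} \<notin> E"
proof
  assume xy: "{x, y} \<in> E"
  then have "x \<noteq> y" using card_edge[OF xy] by auto
  then have "distinct [x, a, y] \<and> {x, a} \<in> E \<and> {a, y} \<in> E \<and> {x, y} \<in> E"
    using assms xy by (auto simp: nbrs_def insert_commute)
  then show False using tf unfolding triangle_free_def by blast
qed

lemma star_nbrs: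
  assumes "finite W"
  shows "par (insert a (nbrs W a)) (nbrs W a) \<inter> par (insert a (nbrs W a)) {a} = {\<one>\<^bsub>Q (insert a (nbrs W a))\<^esub>}"
    and "emb (nbrs W a) (insert a (nbrs W a))"
proof -
  let ?N = "nbrs W a"
  have nb: "finite ?N" "a \<notin> ?N" "\<And>b. b \<in> ?N \<Longrightarrow> {a, b} \<in> E"
    using assms by (auto simp: nbrs_def)
  have ind: "\<And>x y. x \<in> ?N \<Longrightarrow> y \<in> ?N \<Longrightarrow> {x, y} \<notin> E" by (rule nbrs_independent)
  note s = star[of ?N a, OF nb(1,2) ind nb(3), simplified]
  show "par (insert a (nbrs W a)) (nbrs W a) \<inter> par (insert a (nbrs W a)) {a} = {\<one>\<^bsub>Q (insert a (nbrs W a))\<^esub>}"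
    and "emb (nbrs W a) (insert a (nbrs W a))" using s by blast+
qed

text \<open>Every edge at \<open>a\<close> stays in the star of \<open>a\<close>, and every other
  edge avoids \<open>a\<close>; the two parts overlap in the neighbours.\<close>

lemma vertex_amalgam:
  assumes W: "finite W" "a \<in> W" and e: "emb (nbrs W a) (W - {a})"
  shows "amalgam (Q W) (\<lambda>i. par W (if i then insert a (nbrs W a) else W - {a})) (par W (nbrs W a))"
    and "emb (insert a (nbrs W a)) W" "emb (W - {a}) W"
proof -
  let ?N = "nbrs W a"
  have eq: "W = insert a ?N \<union> (W - {a})" "insert a ?N \<inter> (W - {a}) = ?N"
    using W by (auto simp: nbrs_def)
  have edges: "{s, t} \<subseteq> insert a ?N \<or> {s, t} \<subseteq> W - {a}"
    if "{s, t} \<in> E" "s \<noteq> t" "s \<in> W" "t \<in> W" for s t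
    using that by (cases "s = a"; cases "t = a") (auto simp: nbrs_def insert_commute)
  note am = amalgam_Q[OF eq(1) edges, unfolded eq(2), OF _ _ _ _ star_nbrs(2)[OF W(1)] e]
  show "amalgam (Q W) (\<lambda>i. par W (if i then insert a ?N else W - {a})) (par W ?N)"
    and "emb (insert a ?N) W" "emb (W - {a}) W" using am by blast+
qed

text \<open>With at least two leaves the star is cut at its centre into two proper substars.
  Isolation inside these comes from \<open>IH\<close>, and \<open>sub_isolated\<close> combines the
  leaf groups of the two pieces.\<close>

lemma star_isol:
  assumes N: "finite N" "a \<notin> N" "\<And>b. b \<in> N \<Longrightarrow> {a, b} \<in> E"
    and IH: "\<And>U W'. W' \<subset> insert a N \<Longrightarrow> U \<subseteq> W' \<Longrightarrow> isol U W'"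
  shows "isol N (insert a N)"
proof -
  define W where "W = insert a N"
  have ind: "{x, y} \<notin> E" if "x \<in> N" "y \<in> N" for x y
    using nbrs_independent[of x W a y] that N by (auto simp: nbrs_def W_def)
  consider "N = {}" | b where "N = {b}" | b0 b1 where "b0 \<in> N" "b1 \<in> N" "b0 \<noteq> b1" by blast
  then show ?thesis
  proof cases
    case 1
    have "isol {} {a}"
    proof (rule isolI)
      fix w and n :: nat assume w: "w \<in> gwords {a}" "n \<ge> 1" "cl {a} (wpow n w) \<in> par {a} {}"
      then have "cl {a} (wpow n w) = cl {a} []" by (auto simp: parab_def gwords_iff)
      then have "esum (wpow n w) = esum ([] :: 'v gword)" using esum_cl[OF wpow_gwords[OF w(1)]] by blast
      then have "esum w = 0" using w(2) by simp
      then have "cl {a} w = cl {a} []" using cl_single_one[OF w(1)] by (simp add: one_presented)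
      then show "cl {a} w \<in> par {a} {}" by (auto simp: parab_def gwords_iff)
    qed
    then show ?thesis using 1 by simp
  next
    case (2 b)
    then show ?thesis using edge_isol[of a b] N by auto
  next
    case (3 b0 b1)
    \<comment> \<open>By (2,2)-freeness at most one leaf has label 2. Chosen as \<open>b\<close>, it
      is alone in the second factor, for which \<open>sub_isolated\<close> does not demand
      separation.\<close>
    have "\<exists>b\<in>N. \<forall>x\<in>N - {b}. lab {a, x} \<ge> 3"
    proof (cases "\<exists>b\<in>N. lab {a, b} = 2")
      case True
      then obtain b where b: "b \<in> N" "lab {a, b} = 2" by blast
      have "lab {a, x} \<ge> 3" if x: "x \<in> N - {b}" for x
      proof (rule ccontr)
        assume "\<not> lab {a, x} \<ge> 3"
        then have "lab {a, x} = 2" using lab_ge_2[of "{a, x}"] N(3) x by force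
        moreover have "{a, x} \<noteq> {a, b}" "{a, x} \<inter> {a, b} \<noteq> {}" using x by (auto simp: doubleton_eq_iff)
        ultimately have "\<exists>e\<in>E. \<exists>e'\<in>E. e \<noteq> e' \<and> e \<inter> e' \<noteq> {} \<and> lab e = 2 \<and> lab e' = 2"
          using b(2) N(3)[of x] N(3)[OF b(1)] x
          by (intro bexI[of _ "{a, x}"] bexI[of _ "{a, b}"]) auto
        then show False using ttf unfolding two_two_free_def by contradiction
      qed
      then show ?thesis using b(1) by blast
    next
      case False
      then have "lab {a, x} \<ge> 3" if "x \<in> N" for x using lab_ge_2[OF N(3)[OF that]] that by force
      then show ?thesis using 3 by blast
    qed
    then obtain b where b: "b \<in> N" "\<forall>x\<in>N - {b}. lab {a, x} \<ge> 3" by blast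
    define N' W1 W2 where "N' = N - {b}" and "W1 = insert a N'" and "W2 = {a, b}"
    have W12: "W1 \<subseteq> W" "W2 \<subseteq> W" using b(1) by (auto simp: W_def N'_def W1_def W2_def)
    obtain d where "d \<in> N" "d \<noteq> b" using 3 by metis
    then have ne: "b \<in> W - W1" "d \<in> W - W2" using N(2) b(1) by (auto simp: W_def N'_def W1_def W2_def)
    have W: "W = W1 \<union> W2" "W1 \<inter> W2 = {a}" "W1 \<subset> W" "W2 \<subset> W"
      using N(2) b(1) W12 ne by (auto simp: W_def N'_def W1_def W2_def)
    have ab: "{a, b} \<in> E" "a \<noteq> b" using N b by auto
    have edges: "{s, t} \<subseteq> W1 \<or> {s, t} \<subseteq> W2" if "{s, t} \<in> E" "s \<noteq> t" "s \<in> W" "t \<in> W" for s t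
      using edge_subset_star[of N b s t a] ind b(1) that by (auto simp: W_def W1_def W2_def N'_def)
    have e1: "emb (W1 \<inter> W2) W1" "emb (W1 \<inter> W2) W2"
      unfolding W(2) using embeds_single by (auto simp: W1_def W2_def)
    note am = amalgam_Q[OF W(1) edges e1, unfolded W(2)]
    interpret A: amalgam "Q W" "\<lambda>i. par W (if i then W1 else W2)" "par W {a}" using am(1) .
    have st: "par W1 N' \<inter> par W1 {a} = {\<one>\<^bsub>Q W1\<^esub>}" "group.separated (Q W1) (par W1 {a}) (par W1 N')"
      using star[of N' a] N ind b(2) unfolding W1_def N'_def by auto
    define B where "B i = par W (if i then N' else {b})" for i
    have Bsub: "subgroup (B i) (Q W)" for i
      unfolding B_def using b(1) by (intro parab_subgroup) (auto simp: W_def N'_def)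
    have BP: "B i \<subseteq> par W (if i then W1 else W2)" for i
      unfolding B_def by (rule parab_mono) (auto simp: W1_def W2_def)
    have "par W N' \<inter> par W {a} = {\<one>\<^bsub>Q W\<^esub>}"
      by (rule inter_transfer[OF st(1) am(2) _ _ W12(1)]) (auto simp: W1_def)
    moreover have "par W {b} \<inter> par W {a} = {\<one>\<^bsub>Q W\<^esub>}"
      by (rule inter_transfer[OF edge_inter[OF ab, folded W2_def] am(3) _ _ W12(2)]) (auto simp: W2_def)
    ultimately have BC: "B i \<inter> par W {a} = {\<one>\<^bsub>Q W\<^esub>}" for i by (simp add: B_def)
    have gen: "generate (Q W) (B True \<union> B False) = par W N"
      using generate_parab[of N' "{b}" W R] b(1) by (auto simp: B_def W_def N'_def insert_absorb)
    have i1: "A.isolated_in (par W W1) (par W {a})"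
      using IH[of W1 "{a}"] W(3) by (intro isol_transfer[OF _ am(2) _ W12(1)]) (auto simp: W_def W1_def)
    have i2: "A.isolated_in (par W W2) (par W {a})"
      using IH[of W2 "{a}"] W(4) by (intro isol_transfer[OF _ am(3) _ W12(2)]) (auto simp: W_def W2_def)
    have iso: "A.isolated_in (par W (if i then W1 else W2)) (par W {a})" for i
      using i1 i2 by simp
    have j1: "A.isolated_in (par W W1) (par W N')"
      using IH[of W1 N'] W(3) by (intro isol_transfer[OF _ am(2) _ W12(1)]) (auto simp: W_def W1_def)
    have j2: "A.isolated_in (par W W2) (par W {b})"
      using IH[of W2 "{b}"] W(4) by (intro isol_transfer[OF _ am(3) _ W12(2)]) (auto simp: W_def W2_def)
    have isoB: "A.isolated_in (par W (if i then W1 else W2)) (B i)" for i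
      using j1 j2 by (simp add: B_def)
    have sep: "A.separated (par W {a}) (B True)"
      unfolding B_def if_True by (rule separated_transfer[OF st(2) am(2) _ _ W12(1)]) (auto simp: W1_def)
    show ?thesis
      using A.sub_isolated[of B, OF Bsub BP BC iso isoB sep] unfolding gen unfolding W_def .
  qed
qed

text \<open>By transitivity it suffices to remove one vertex \<open>a\<close>. If \<open>a\<close>
  is adjacent to all the others, \<open>W\<close> is a star. Otherwise both parts of the splitting
  at \<open>a\<close> are proper, the edge group is isolated in them by induction, and
  \<open>P_isolated\<close> passes to the whole group.\<close>

theorem parabolic_embeds_isolated:
  assumes "finite W" "U \<subseteq> W"
  shows "emb U W \<and> isol U W"
  using assms
proof (induction "card W" arbitrary: W U rule: less_induct)
  case less
  have IH: "emb U W'" "isol U W'" if "W' \<subset> W" "U \<subseteq> W'" for U W'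
    using less.hyps[OF psubset_card_mono[OF less.prems(1) that(1)] finite_subset[OF _ less.prems(1)] that(2)] that(1)
    by auto
  have step: "emb (W - {a}) W \<and> isol (W - {a}) W" if a: "a \<in> W" for a
  proof (cases "nbrs W a = W - {a}")
    case True
    have W: "W = insert a (nbrs W a)" using a True by auto
    have nb: "finite (nbrs W a)" "a \<notin> nbrs W a" "\<And>b. b \<in> nbrs W a \<Longrightarrow> {a, b} \<in> E"
      using less.prems(1) by (auto simp: nbrs_def)
    have "isol (nbrs W a) (insert a (nbrs W a))"
      using star_isol[OF nb] IH(2) W by simp
    then show ?thesis using star_nbrs(2)[OF less.prems(1), of a] True W by simp
  next
    case False
    let ?N = "nbrs W a"
    have sub: "?N \<subseteq> W - {a}" by (auto simp: nbrs_def)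
    have s1: "insert a ?N \<subset> W" "W - {a} \<subset> W" using a sub False by auto
    note am = vertex_amalgam[OF less.prems(1) a IH(1)[OF s1(2) sub]]
    interpret A: amalgam "Q W" "\<lambda>i. par W (if i then insert a ?N else W - {a})" "par W ?N" using am(1) .
    have i1: "A.isolated_in (par W (insert a ?N)) (par W ?N)"
      using IH(2)[OF s1(1), of ?N] s1 by (intro isol_transfer[OF _ am(2)]) auto
    have i2: "A.isolated_in (par W (W - {a})) (par W ?N)"
      using IH(2)[OF s1(2) sub] s1 sub by (intro isol_transfer[OF _ am(3)]) auto
    have "A.isolated_in (par W (if i then insert a ?N else W - {a})) (par W ?N)" for i
      using i1 i2 by simp
    from A.P_isolated[OF this, of False] show ?thesis using am(3) by simp
  qed
  show ?case
  proof (cases "U = W")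
    case True
    then show ?thesis using embeds_refl parab_self[of R W] group.isolated_in_def[OF group_Q] by auto
  next
    case False
    then obtain a where a: "a \<in> W" "U \<subseteq> W - {a}" using less.prems(2) by blast
    have s: "W - {a} \<subset> W" using a by blast
    show ?thesis
      using embeds_trans[OF IH(1)[OF s a(2)] _ a(2)] isol_trans[OF IH(2)[OF s a(2)] _ _ a(2)] step[OF a(1)] by auto
  qed
qed

text \<open>Otherwise the letter would lie in both factors of the splitting at \<open>x\<close>,
  hence in the edge group. In the star of \<open>x\<close> the edge group meets the group of
  \<open>x\<close> trivially, but the letter has exponent sum 1.\<close>

lemma letter_notin_par:
  assumes W: "finite W" "x \<in> W" "y \<in> W" "x \<noteq> y" "{x, y} \<notin> E"
  shows "cl W [(x, True)] \<notin> par W (W - {x})"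
proof
  let ?N = "nbrs W x"
  have "emb ?N (W - {x})"
    using parabolic_embeds_isolated[of "W - {x}" ?N] W by (auto simp: nbrs_def)
  note am = vertex_amalgam[OF W(1,2) this]
  interpret A: amalgam "Q W" "\<lambda>i. par W (if i then insert x ?N else W - {x})" "par W ?N" using am(1) .
  assume "cl W [(x, True)] \<in> par W (W - {x})"
  moreover have "cl W [(x, True)] \<in> par W (insert x ?N)" by (auto simp: parab_def)
  ultimately have "cl W [(x, True)] \<in> par W ?N" using A.P_inter by auto
  then obtain u where u: "u \<in> gwords ?N" "cl W [(x, True)] = cl W u" by (auto simp: parab_def)
  have s: "insert x ?N \<subseteq> W" using W by (auto simp: nbrs_def)
  have "cl (insert x ?N) [(x, True)] = cl (insert x ?N) u"
    using embedsD[OF am(2) s _ _ u(2)] u(1) gwords_mono[of ?N "insert x ?N"] by auto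
  then have "cl (insert x ?N) [(x, True)] \<in> par (insert x ?N) ?N \<inter> par (insert x ?N) {x}"
    using u(1) by (auto simp: parab_def)
  then have "cl (insert x ?N) [(x, True)] = cl (insert x ?N) []"
    using star_nbrs(1)[OF W(1), of x] by (simp add: one_presented)
  then have "esum [(x, True)] = esum ([] :: 'v gword)"
    by (intro esum_cl[of _ "insert x ?N"]) auto
  then show False by simp
qed

text \<open>The splitting at \<open>a\<close> has proper factors: the letter \<open>c\<close> is
  missing from the star of \<open>a\<close>, and \<open>a\<close> from the other factor. Each letter
  lies in one of the factors, so the letters are the elliptic generators required.\<close>

theorem Q_no_commuting_powers:
  assumes V: "finite V" "a \<in> V" "c \<in> V" "a \<noteq> c" "{a, c} \<notin> E"
    and S: "finite S" "S \<subseteq> carrier (Q V)" "generate (Q V) S = carrier (Q V)" and m: "m \<ge> 1"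
  obtains s t where "s \<in> S" "t \<in> S"
    "s [^]\<^bsub>Q V\<^esub> (m::nat) \<otimes>\<^bsub>Q V\<^esub> t [^]\<^bsub>Q V\<^esub> m \<noteq> t [^]\<^bsub>Q V\<^esub> m \<otimes>\<^bsub>Q V\<^esub> s [^]\<^bsub>Q V\<^esub> m"
proof -
  let ?N = "nbrs V a"
  have sub: "?N \<subseteq> V - {a}" "insert a ?N \<subseteq> V" using V by (auto simp: nbrs_def)
  have fin: "finite (V - {a})" "finite (insert a ?N)" using V finite_subset sub by auto
  note am = vertex_amalgam[OF V(1,2)] and pe = parabolic_embeds_isolated
  have e: "emb ?N (V - {a})" using pe[OF fin(1) sub(1)] by blast
  interpret A: amalgam "Q V" "\<lambda>i. par V (if i then insert a ?N else V - {a})" "par V ?N" using am(1)[OF e] .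
  have i1: "A.isolated_in (par V (insert a ?N)) (par V ?N)"
    using pe[OF fin(2), of ?N] sub by (intro isol_transfer[OF _ am(2)[OF e]]) auto
  have i2: "A.isolated_in (par V (V - {a})) (par V ?N)"
    using pe[OF fin(1) sub(1)] sub by (intro isol_transfer[OF _ am(3)[OF e]]) auto
  have iso: "A.isolated_in (par V (if i then insert a ?N else V - {a})) (par V ?N)" for i
    using i1 i2 by simp
  have cc: "cl V [(x, True)] \<in> carrier (Q V)" if "x \<in> V" for x using that by simp
  have "cl V [(a, True)] \<notin> par V (V - {a})" using letter_notin_par[OF V] .
  then have p2: "par V (V - {a}) \<noteq> carrier (Q V)" using cc[OF V(2)] by metis
  have "cl V [(c, True)] \<notin> par V (V - {c})"
    using letter_notin_par[of V c a] V by (simp add: insert_commute)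
  moreover have "insert a ?N \<subseteq> V - {c}" using V by (auto simp: nbrs_def)
  ultimately have "cl V [(c, True)] \<notin> par V (insert a ?N)" using parab_mono[of "insert a ?N" "V - {c}" R V] by blast
  then have p1: "par V (insert a ?N) \<noteq> carrier (Q V)" using cc[OF V(3)] by metis
  have proper: "par V (if i then insert a ?N else V - {a}) \<noteq> carrier (Q V)" for i
    using p1 p2 by simp
  let ?V = "(\<lambda>x. cl V [(x, True)]) ` V"
  have gV: "generate (Q V) ?V = carrier (Q V)" using generate_letters[of V V R] parab_self[of R V] by simp
  have "cl V [(x, True)] \<in> par V (insert a ?N) \<union> par V (V - {a})" if "x \<in> V" for x
    using that by (cases "x = a") (simp_all add: parab_def)
  then have sV: "?V \<subseteq> par V (if True then insert a ?N else V - {a}) \<union> par V (if False then insert a ?N else V - {a})"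
    by (simp add: image_subset_iff)
  show ?thesis
    using A.no_generating_set_with_commuting_powers[OF iso proper finite_imageI[OF V(1)] sV gV S m] that by metis
qed

end

subsection \<open>From the Artin group to its quotient\<close>

lemma alternating_word_Suc:
  "alternating_word s t (Suc k) = (s, True) # alternating_word t s k"
  unfolding alternating_word_def
  by (simp add: upt_conv_Cons map_Suc_upt[symmetric] del: upt_Suc map_Suc_upt)

lemma esum_alternating_word [simp]: "esum (alternating_word s t k) = int k"
  by (induction k arbitrary: s t) (simp_all add: alternating_word_Suc, simp add: alternating_word_def)

lemma alternating_word_gwords: "alternating_word s t k \<in> gwords {s, t}"
  by (auto simp: gwords_iff alternating_word_def)

lemma alternating_word_letters:
  assumes "k \<ge> 2" "alternating_word s t k \<in> gwords X"
  shows "s \<in> X" "t \<in> X"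
proof -
  obtain j where "k = Suc (Suc j)" using assms(1) by (metis add_2_eq_Suc le_Suc_ex)
  then show "s \<in> X" "t \<in> X" using assms(2) by (simp_all add: alternating_word_Suc)
qed

context tf_graph
begin

text \<open>The two sides of a braid relation have the same matrix by \<open>dih_braid\<close>, and
  the same exponent sum, so they agree in the quotient.\<close>

lemma artin_hom:
  obtains h where "h \<in> hom (artin_group V E lab) (Q V)"
    "\<And>w. w \<in> gwords V \<Longrightarrow> h (pres_class V (artin_relations E lab) w) = cl V w"
proof (rule presented_lift[OF group_Q, of "\<lambda>x. cl V [(x, True)]" V V "artin_relations E lab"])
  show "(\<lambda>x. cl V [(x, True)]) \<in> V \<rightarrow> carrier (Q V)" by auto
next
  fix u v assume uv: "(u, v) \<in> artin_relations E lab" "u \<in> gwords V" "v \<in> gwords V"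
  then obtain s t where st: "{s, t} \<in> E" "u = alternating_word s t (lab {s, t})"
      "v = alternating_word t s (lab {s, t})"
    by (auto simp: artin_relations_def)
  have "s \<noteq> t" using card_edge[OF st(1)] by auto
  have p: "lab {s, t} \<ge> 2" using lab_ge_2[OF st(1)] .
  \<comment> \<open>A label of at least 2 makes both letters occur in the relator, so the whole edge
    lies in \<open>V\<close>.\<close>
  have sub: "{s, t} \<subseteq> V" using alternating_word_letters[OF p] uv(2) st(2) by auto
  have w: "u \<in> gwords {s, t}" "v \<in> gwords {s, t}"
    using alternating_word_gwords[of s t] alternating_word_gwords[of t s] st by (simp_all add: insert_commute)
  have "dih_eval (lab {s, t}) s u = dih_eval (lab {s, t}) s v"
    unfolding dih_eval_def st(2,3) using p \<open>s \<noteq> t\<close> by (intro dih_braid) auto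
  then have "pres_cong {s, t} R u v"
    using dih_eval_faithful[OF st(1) \<open>s \<noteq> t\<close> w] st by simp
  then have "pres_cong V R u v" using pres_cong_mono sub by blast
  then show "gw_eval (Q V) (\<lambda>x. cl V [(x, True)]) u = gw_eval (Q V) (\<lambda>x. cl V [(x, True)]) v"
    using uv by (simp add: gw_eval_pres_class pres_class_eq_iff)
next
  fix h assume "h \<in> hom (presented_group V (artin_relations E lab)) (Q V)"
    "\<And>w. w \<in> gwords V \<Longrightarrow> h (pres_class V (artin_relations E lab) w) = gw_eval (Q V) (\<lambda>x. cl V [(x, True)]) w"
  then show thesis using that by (simp add: artin_group_def gw_eval_pres_class)
qed

end

lemma (in group) generate_finite_subset:
  assumes "x \<in> generate G S"
  shows "\<exists>F. finite F \<and> F \<subseteq> S \<and> x \<in> generate G F"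
  using assms
proof (induction rule: generate.induct)
  case one
  show ?case by (intro exI[of _ "{}"]) (auto intro: generate.one)
next
  case (incl h)
  then show ?case by (intro exI[of _ "{h}"]) (auto intro: generate.incl)
next
  case (inv h)
  then show ?case by (intro exI[of _ "{h}"]) (auto intro: generate.inv)
next
  case (eng h1 h2)
  then obtain F1 F2 where F: "finite F1" "F1 \<subseteq> S" "h1 \<in> generate G F1" "finite F2" "F2 \<subseteq> S" "h2 \<in> generate G F2"
    by blast
  have "h1 \<in> generate G (F1 \<union> F2)" "h2 \<in> generate G (F1 \<union> F2)"
    using F mono_generate[of F1 "F1 \<union> F2"] mono_generate[of F2 "F1 \<union> F2"] by auto
  then show ?case using F by (intro exI[of _ "F1 \<union> F2"]) (auto intro: generate.eng)
qed

lemma (in group) finite_generating_subset: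
  assumes "finite T" "T \<subseteq> generate G S"
  shows "\<exists>F. finite F \<and> F \<subseteq> S \<and> T \<subseteq> generate G F"
proof -
  have "\<forall>x\<in>T. \<exists>F. finite F \<and> F \<subseteq> S \<and> x \<in> generate G F" using generate_finite_subset assms(2) by blast
  then obtain F where F: "\<And>x. x \<in> T \<Longrightarrow> finite (F x) \<and> F x \<subseteq> S \<and> x \<in> generate G (F x)" by metis
  have "x \<in> generate G (\<Union>x\<in>T. F x)" if "x \<in> T" for x
    using F[OF that] mono_generate[of "F x" "\<Union>x\<in>T. F x"] that by blast
  then show ?thesis using F assms(1) by (intro exI[of _ "\<Union>x\<in>T. F x"]) auto
qed

lemma generate_artin_gens:
  "generate (artin_group V E lab) ((\<lambda>x. pres_class V (artin_relations E lab) [(x, True)]) ` V)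
    = carrier (artin_group V E lab)"
  using generate_letters[of V V "artin_relations E lab"] parab_self[of "artin_relations E lab" V]
  by (simp add: artin_group_def)

text \<open>\<open>S\<close> may be infinite, but it contains a finite generating set because the
  group is finitely generated. The image of this set generates the quotient, and non-commuting
  images come from non-commuting elements.\<close>

lemma artin_noncommuting_powers:
  fixes E :: "'v set set"
  assumes g: "presentation_graph V E lab" "triangle_free E" "two_two_free E lab"
    and ac: "a \<in> V" "c \<in> V" "a \<noteq> c" "{a, c} \<notin> E"
    and S: "generates (artin_group V E lab) S" and m: "m \<ge> 1"
  obtains s t where "s \<in> S" "t \<in> S"
    "s [^]\<^bsub>artin_group V E lab\<^esub> (m::nat) \<otimes>\<^bsub>artin_group V E lab\<^esub> t [^]\<^bsub>artin_group V E lab\<^esub> m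
      \<noteq> t [^]\<^bsub>artin_group V E lab\<^esub> m \<otimes>\<^bsub>artin_group V E lab\<^esub> s [^]\<^bsub>artin_group V E lab\<^esub> m"
proof -
  define A where "A = artin_group V E lab"
  interpret A: group A unfolding A_def by (rule group_artin_group)
  interpret T: tf_graph E lab using g by unfold_locales (auto simp: presentation_graph_def)
  have fin: "finite V" using g by (simp add: presentation_graph_def)
  let ?X = "(\<lambda>x. pres_class V (artin_relations E lab) [(x, True)]) ` V"
  have SA: "S \<subseteq> carrier A" "generate A S = carrier A" using S by (auto simp: generates_def A_def)
  have X: "generate A ?X = carrier A" unfolding A_def by (rule generate_artin_gens)
  have "?X \<subseteq> carrier A" by (auto simp: A_def artin_group_def)
  then obtain F where F: "finite F" "F \<subseteq> S" "?X \<subseteq> generate A F"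
    using A.finite_generating_subset[of ?X S] fin SA by auto
  have Fc: "F \<subseteq> carrier A" using F SA by blast
  have "generate A ?X \<subseteq> generate A F"
    using A.generate_subgroup_incl[OF F(3) A.generate_is_subgroup[OF Fc]] .
  then have GF: "generate A F = carrier A" using X A.generate_incl[OF Fc] by auto
  obtain h where h: "h \<in> hom A (T.Q V)" "\<And>w. w \<in> gwords V \<Longrightarrow> h (pres_class V (artin_relations E lab) w) = T.cl V w"
    using T.artin_hom[of V] unfolding A_def by metis
  interpret h: group_hom A "T.Q V" h
    using h(1) A.group_axioms T.group_Q by (simp add: group_hom_def group_hom_axioms_def)
  have surj: "h ` carrier A = carrier (T.Q V)"
    using h(2) by (force simp: A_def artin_group_def carrier_presented image_image)
  have hF: "h ` F \<subseteq> carrier (T.Q V)" using Fc by auto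
  have gF: "generate (T.Q V) (h ` F) = carrier (T.Q V)" using h.generate_img[OF Fc] GF surj by simp
  obtain s' t' where st: "s' \<in> h ` F" "t' \<in> h ` F"
    "s' [^]\<^bsub>T.Q V\<^esub> m \<otimes>\<^bsub>T.Q V\<^esub> t' [^]\<^bsub>T.Q V\<^esub> m \<noteq> t' [^]\<^bsub>T.Q V\<^esub> m \<otimes>\<^bsub>T.Q V\<^esub> s' [^]\<^bsub>T.Q V\<^esub> m"
    using T.Q_no_commuting_powers[OF fin ac finite_imageI[OF F(1)] hF gF m] by metis
  then obtain s t where s: "s \<in> F" "t \<in> F" "s' = h s" "t' = h t" by blast
  have sc: "s \<in> carrier A" "t \<in> carrier A" using s Fc by auto
  have "h (s [^]\<^bsub>A\<^esub> m \<otimes>\<^bsub>A\<^esub> t [^]\<^bsub>A\<^esub> m) \<noteq> h (t [^]\<^bsub>A\<^esub> m \<otimes>\<^bsub>A\<^esub> s [^]\<^bsub>A\<^esub> m)"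
    using st(3) s sc by (simp add: h.hom_nat_pow)
  then have "s [^]\<^bsub>A\<^esub> m \<otimes>\<^bsub>A\<^esub> t [^]\<^bsub>A\<^esub> m \<noteq> t [^]\<^bsub>A\<^esub> m \<otimes>\<^bsub>A\<^esub> s [^]\<^bsub>A\<^esub> m" by metis
  then show ?thesis using that[OF subsetD[OF F(2) s(1)] subsetD[OF F(2) s(2)]] unfolding A_def by blast
qed

subsection \<open>Finiteness of dihedral Coxeter groups\<close>

context group
begin

fun alt_prod :: "'a \<Rightarrow> 'a \<Rightarrow> nat \<Rightarrow> 'a" where
  "alt_prod x y 0 = \<one>"
| "alt_prod x y (Suc k) = x \<otimes> alt_prod y x k"

lemma alt_prod_closed [simp]:
  "x \<in> carrier G \<Longrightarrow> y \<in> carrier G \<Longrightarrow> alt_prod x y k \<in> carrier G"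
  by (induction k arbitrary: x y) auto

lemma gw_eval_alternating_word:
  "gw_eval G f (alternating_word s t k) = alt_prod (f s) (f t) k"
  by (induction k arbitrary: s t) (simp_all add: alternating_word_Suc, simp add: alternating_word_def)

text \<open>Multiplication by \<open>x\<close> shortens products that start with \<open>x\<close>
  and lengthens those that start with \<open>y\<close>. A longest product starting with
  \<open>y\<close> is rewritten by \<open>rel\<close> to start with \<open>x\<close>, so the length
  never exceeds \<open>p\<close>.\<close>

lemma alt_prod_mult_left:
  assumes "x \<in> carrier G" "y \<in> carrier G" "x \<otimes> x = \<one>" "p \<ge> 1"
    and rel: "alt_prod x y p = alt_prod y x p"
    and g: "g \<in> alt_prod x y ` {..p} \<union> alt_prod y x ` {..p}"
  shows "x \<otimes> g \<in> alt_prod x y ` {..p} \<union> alt_prod y x ` {..p}"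
proof -
  have xx: "x \<otimes> (x \<otimes> z) = z" if "z \<in> carrier G" for z
    using assms that by (simp flip: m_assoc)
  obtain j where j: "j \<le> p" "g = alt_prod x y j \<or> g = alt_prod y x j" using g by blast
  have "(\<exists>k\<le>p. g = alt_prod x y k) \<or> (\<exists>k<p. g = alt_prod y x k)"
  proof (cases "j = p")
    case True
    then show ?thesis using j rel by auto
  next
    case False
    then show ?thesis using j le_neq_implies_less by blast
  qed
  then consider k where "k \<le> p" "g = alt_prod x y k" | k where "k < p" "g = alt_prod y x k" by blast
  then show ?thesis
  proof cases
    case 1
    show ?thesis
    proof (cases k)
      case 0
      then have "x \<otimes> g = alt_prod x y 1" using 1 assms by simp
      then show ?thesis using assms(4) by blast
    next
      case (Suc j)
      then have "x \<otimes> g = alt_prod y x j" using 1 assms xx by simp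
      then show ?thesis using 1 Suc by auto
    qed
  next
    case 2
    then have "x \<otimes> g = alt_prod x y (Suc k)" by simp
    then show ?thesis using 2 by (metis Suc_leI UnI1 atMost_iff imageI)
  qed
qed

lemma finite_dihedral:
  assumes xy: "x \<in> carrier G" "y \<in> carrier G" "x \<otimes> x = \<one>" "y \<otimes> y = \<one>" "p \<ge> 1"
    and rel: "alt_prod x y p = alt_prod y x p"
  shows "finite (generate G {x, y})"
proof -
  let ?F = "alt_prod x y ` {..p} \<union> alt_prod y x ` {..p}"
  have sx: "x \<otimes> g \<in> ?F" if "g \<in> ?F" for g using alt_prod_mult_left[OF xy(1,2,3,5) rel that] .
  have sy: "y \<otimes> g \<in> ?F" if "g \<in> ?F" for g
    using alt_prod_mult_left[OF xy(2,1,4,5) rel[symmetric], of g] that by (simp add: Un_commute)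
  have self_inv: "inv h = h" if "h \<in> {x, y}" for h using xy that by (auto intro: inv_equality)
  have Fc: "?F \<subseteq> carrier G" using xy by auto
  have "g \<otimes> f \<in> ?F" if "g \<in> generate G {x, y}" "f \<in> ?F" for g f
    using that
  proof (induction arbitrary: f rule: generate.induct)
    case one
    then show ?case using Fc by auto
  next
    case (incl h)
    then show ?case using sx sy by blast
  next
    case (inv h)
    then show ?case using sx sy unfolding self_inv[OF inv.hyps] by blast
  next
    case (eng h1 h2)
    have "h1 \<in> carrier G" "h2 \<in> carrier G" using generate_in_carrier[of "{x, y}"] xy eng by auto
    then have "h1 \<otimes> h2 \<otimes> f = h1 \<otimes> (h2 \<otimes> f)" using eng Fc by (auto simp: m_assoc)
    then show ?case using eng by simp
  qed
  moreover have one: "\<one> \<in> ?F" by (metis UnI1 alt_prod.simps(1) atMost_iff imageI le0)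
  ultimately have "g \<in> ?F" if "g \<in> generate G {x, y}" for g
    using that generate_in_carrier[of "{x, y}" g] xy by (metis empty_subsetI insert_subset r_one)
  then have "generate G {x, y} \<subseteq> ?F" by blast
  then show ?thesis by (rule finite_subset) simp
qed

lemma normal_closure_normal: "S \<subseteq> carrier G \<Longrightarrow> normal_closure G S \<lhd> G"
proof -
  assume S: "S \<subseteq> carrier G"
  have c: "carrier G \<lhd> G" using normal_inv_iff subgroup_self by auto
  have "subgroup (\<Inter>{N. N \<lhd> G \<and> S \<subseteq> N}) G"
    using c S by (intro subgroups_Inter) (auto simp: normal_inv_iff)
  then show ?thesis unfolding normal_closure_def by (auto simp: normal_inv_iff)
qed

end

lemma complete_graph_spherical:
  fixes E :: "'v set set"
  assumes g: "presentation_graph V E lab" "triangle_free E"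
    and complete: "\<And>x y. x \<in> V \<Longrightarrow> y \<in> V \<Longrightarrow> x \<noteq> y \<Longrightarrow> {x, y} \<in> E"
  shows "spherical_type V E lab"
proof -
  define A where "A = artin_group V E lab"
  interpret A: group A unfolding A_def by (rule group_artin_group)
  define gen where "gen s = pres_class V (artin_relations E lab) [(s, True)]" for s
  have gen: "gen s \<in> carrier A" if "s \<in> V" for s using that by (simp add: gen_def A_def artin_group_def)
  define N where "N = normal_closure A {gen s [^]\<^bsub>A\<^esub> (2 :: nat) | s. s \<in> V}"
  have "{gen s [^]\<^bsub>A\<^esub> (2 :: nat) | s. s \<in> V} \<subseteq> carrier A" using gen by auto
  then have N: "N \<lhd> A" unfolding N_def by (rule A.normal_closure_normal)
  have sq: "gen s [^]\<^bsub>A\<^esub> (2 :: nat) \<in> N" if "s \<in> V" for s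
    using that by (auto simp: N_def normal_closure_def)
  interpret N: normal N A by (rule N)
  interpret W: group "A Mod N" by (rule N.factorgroup_is_group)
  define r where "r x = N #>\<^bsub>A\<^esub> x" for x
  interpret r: group_hom A "A Mod N" r
    using N.r_coset_hom_Mod A.group_axioms W.group_axioms
    by (simp add: group_hom_def group_hom_axioms_def r_def[abs_def])
  have surj: "r ` carrier A = carrier (A Mod N)" by (auto simp: r_def FactGroup_def RCOSETS_def)
  have car: "carrier (A Mod N) = generate (A Mod N) (r ` gen ` V)"
    using r.generate_img[of "gen ` V"] generate_artin_gens[of V E lab] surj gen
    by (auto simp: gen_def A_def image_subset_iff)
  have rsq: "r (gen s) \<otimes>\<^bsub>A Mod N\<^esub> r (gen s) = \<one>\<^bsub>A Mod N\<^esub>" if "s \<in> V" for s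
  proof -
    have "r (gen s [^]\<^bsub>A\<^esub> (2::nat)) = N" using sq[OF that] gen[OF that] by (simp add: r_def A.coset_join2 N.subgroup_axioms)
    then show ?thesis using gen[OF that] by (simp add: numeral_2_eq_2 FactGroup_def)
  qed
  have "finite (carrier (A Mod N))"
  proof (cases "V = {}")
    case True
    then have "carrier (A Mod N) = {\<one>\<^bsub>A Mod N\<^esub>}" using car W.generate_empty by simp
    then show ?thesis by simp
  next
    case False
    then obtain a where a: "a \<in> V" by blast
    show ?thesis
    proof (cases "V = {a}")
      case True
      \<comment> \<open>A single involution, treated as a degenerate dihedral group with equal
        generators and \<open>p = 1\<close>.\<close>
      have "finite (generate (A Mod N) {r (gen a), r (gen a)})"
        by (rule W.finite_dihedral[of _ _ 1]) (use rsq[OF a] gen[OF a] in auto)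
      then show ?thesis using car True by simp
    next
      case False
      then obtain b where b: "b \<in> V" "b \<noteq> a" using a by blast
      have e: "{a, b} \<in> E" using complete a b by blast
      have V: "V = {a, b}"
      proof (rule ccontr)
        assume "V \<noteq> {a, b}"
        then obtain c where c: "c \<in> V" "c \<noteq> a" "c \<noteq> b" using a b by blast
        then have "distinct [a, b, c] \<and> {a, b} \<in> E \<and> {b, c} \<in> E \<and> {a, c} \<in> E"
          using a b complete by auto
        then show False using g(2) unfolding triangle_free_def by blast
      qed
      define p where "p = lab {a, b}"
      have p: "p \<ge> 1" using g(1) e by (auto simp: presentation_graph_def p_def)
      have w: "alternating_word a b p \<in> gwords V" "alternating_word b a p \<in> gwords V"
        using alternating_word_gwords[of a b] alternating_word_gwords[of b a] V by (auto simp: insert_commute)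
      have "(alternating_word a b p, alternating_word b a p) \<in> artin_relations E lab"
        using e by (auto simp: artin_relations_def p_def)
      then have "pres_class V (artin_relations E lab) (alternating_word a b p)
          = pres_class V (artin_relations E lab) (alternating_word b a p)"
        using w by (simp add: pres_class_eq_iff pres_cong.relation)
      then have eq: "gw_eval A gen (alternating_word a b p) = gw_eval A gen (alternating_word b a p)"
        using gw_eval_pres_class[of _ V V "artin_relations E lab"] w by (simp add: A_def artin_group_def gen_def[abs_def])
      have gf: "gen \<in> V \<rightarrow> carrier A" using gen by blast
      have "gw_eval (A Mod N) (\<lambda>x. r (gen x)) (alternating_word a b p)
          = gw_eval (A Mod N) (\<lambda>x. r (gen x)) (alternating_word b a p)"
        using A.gw_eval_hom[OF W.group_axioms r.homh w(1) gf] A.gw_eval_hom[OF W.group_axioms r.homh w(2) gf] eq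
        by simp
      then have "W.alt_prod (r (gen a)) (r (gen b)) p = W.alt_prod (r (gen b)) (r (gen a)) p"
        by (simp only: W.gw_eval_alternating_word)
      then have "finite (generate (A Mod N) {r (gen a), r (gen b)})"
        using rsq gen a b p by (intro W.finite_dihedral[of _ _ p]) auto
      then show ?thesis using car V by simp
    qed
  qed
  then show ?thesis
    unfolding spherical_type_def coxeter_group_def artin_gen_def N_def A_def gen_def .
qed

subsection \<open>Free groups of rank two\<close>

lemma free_lift:
  assumes "group G" "f \<in> X \<rightarrow> carrier G"
  obtains h where "h \<in> hom (free_group X) G" "\<And>w. w \<in> gwords X \<Longrightarrow> h (pres_class X {} w) = gw_eval G f w"
  using presented_lift[OF assms, of "{}"] unfolding free_group_def by blast

text \<open>\<open>is_free_group\<close> asks for an index set in the type underlying the group,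
  while the power alternative provides the index set \<open>bool\<close>.\<close>

lemma free_group_rename:
  assumes f: "bij_betw f X Y"
  shows "free_group X \<cong> free_group Y"
proof -
  define g where "g = inv_into X f"
  have fg: "\<And>x. x \<in> X \<Longrightarrow> f x \<in> Y" "\<And>y. y \<in> Y \<Longrightarrow> g y \<in> X" "\<And>x. x \<in> X \<Longrightarrow> g (f x) = x" "\<And>y. y \<in> Y \<Longrightarrow> f (g y) = y"
    using f unfolding g_def bij_betw_def by (auto simp: inv_into_into f_inv_into_f)
  interpret FX: group "free_group X" unfolding free_group_def by (rule group_presented_group)
  interpret FY: group "free_group Y" unfolding free_group_def by (rule group_presented_group)
  have c: "(\<lambda>x. pres_class Y {} [(f x, True)]) \<in> X \<rightarrow> carrier (free_group Y)"
    "(\<lambda>y. pres_class X {} [(g y, True)]) \<in> Y \<rightarrow> carrier (free_group X)"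
    using fg by (auto simp: free_group_def)
  obtain h where h: "h \<in> hom (free_group X) (free_group Y)"
    "\<And>w. w \<in> gwords X \<Longrightarrow> h (pres_class X {} w) = gw_eval (free_group Y) (\<lambda>x. pres_class Y {} [(f x, True)]) w"
    using free_lift[OF FY.group_axioms c(1)] by metis
  obtain k where k: "k \<in> hom (free_group Y) (free_group X)"
    "\<And>w. w \<in> gwords Y \<Longrightarrow> k (pres_class Y {} w) = gw_eval (free_group X) (\<lambda>y. pres_class X {} [(g y, True)]) w"
    using free_lift[OF FX.group_axioms c(2)] by metis
  have kh: "k (h a) = a" if a: "a \<in> carrier (free_group X)" for a
  proof -
    obtain w where w: "w \<in> gwords X" "a = pres_class X {} w"
      using a by (auto simp: free_group_def carrier_presented)
    have "k (h a) = gw_eval (free_group X) (\<lambda>x. k (pres_class Y {} [(f x, True)])) w"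
      using FY.gw_eval_hom[OF FX.group_axioms k(1) w(1) c(1)] h(2)[OF w(1)] w(2) by simp
    also have "\<dots> = gw_eval (free_group X) (\<lambda>x. pres_class X {} [(x, True)]) w"
    proof (rule gw_eval_cong[OF w(1)])
      fix x assume x: "x \<in> X"
      then have "pres_class X {} [(x, True)] \<in> carrier (free_group X)" by (simp add: free_group_def)
      then show "k (pres_class Y {} [(f x, True)]) = pres_class X {} [(x, True)]"
        using k(2)[of "[(f x, True)]"] fg x by simp
    qed
    finally show ?thesis using gw_eval_pres_class[OF w(1), of X "{}"] w(2) by (simp add: free_group_def)
  qed
  have hk: "h (k a) = a" if a: "a \<in> carrier (free_group Y)" for a
  proof -
    obtain w where w: "w \<in> gwords Y" "a = pres_class Y {} w"
      using a by (auto simp: free_group_def carrier_presented)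
    have "h (k a) = gw_eval (free_group Y) (\<lambda>y. h (pres_class X {} [(g y, True)])) w"
      using FX.gw_eval_hom[OF FY.group_axioms h(1) w(1) c(2)] k(2)[OF w(1)] w(2) by simp
    also have "\<dots> = gw_eval (free_group Y) (\<lambda>y. pres_class Y {} [(y, True)]) w"
    proof (rule gw_eval_cong[OF w(1)])
      fix y assume y: "y \<in> Y"
      then have "pres_class Y {} [(y, True)] \<in> carrier (free_group Y)" by (simp add: free_group_def)
      then show "h (pres_class X {} [(g y, True)]) = pres_class Y {} [(y, True)]"
        using h(2)[of "[(g y, True)]"] fg y by simp
    qed
    finally show ?thesis using gw_eval_pres_class[OF w(1), of Y "{}"] w(2) by (simp add: free_group_def)
  qed
  have "bij_betw h (carrier (free_group X)) (carrier (free_group Y))"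
    using kh hk h(1) k(1) by (intro bij_betw_byWitness[of _ k]) (auto simp: hom_def)
  then have "h \<in> iso (free_group X) (free_group Y)" using h(1) by (simp add: iso_def)
  then show ?thesis by (auto simp: is_iso_def)
qed

text \<open>Prepending is defined on lists shorter than \<open>n\<close> only; an injection on part
  of a finite set extends to a permutation, with arbitrary values on the remaining lists.\<close>

lemma prepend_permutation:
  fixes b :: bool
  defines "L n \<equiv> {l :: bool list. length l \<le> n}"
  obtains \<sigma> where "\<sigma> \<in> Bij (L n)" "\<And>l. length l < n \<Longrightarrow> \<sigma> l = b # l"
proof -
  define A where "A = {l :: bool list. length l < n}"
  have fin: "finite (L n)" using finite_lists_length_le[of "UNIV :: bool set" n] by (simp add: L_def)
  have A: "A \<subseteq> L n" "(#) b ` A \<subseteq> L n" by (auto simp: A_def L_def)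
  have inj: "inj_on ((#) b) A" by (auto simp: inj_on_def)
  have "card (L n - A) = card (L n - (#) b ` A)"
    using A fin card_image[OF inj] by (simp add: card_Diff_subset finite_subset[OF _ fin])
  then obtain g where g: "bij_betw g (L n - A) (L n - (#) b ` A)"
    using finite_same_card_bij fin by (metis finite_Diff)
  define \<sigma> where "\<sigma> = (\<lambda>l\<in>L n. if l \<in> A then b # l else g l)"
  have b1: "bij_betw \<sigma> A ((#) b ` A)"
    using A by (intro bij_betw_cong[THEN iffD1, OF _ inj_on_imp_bij_betw[OF inj]]) (auto simp: \<sigma>_def)
  have b2: "bij_betw \<sigma> (L n - A) (L n - (#) b ` A)"
    by (rule bij_betw_cong[THEN iffD1, OF _ g]) (auto simp: \<sigma>_def)
  have "bij_betw \<sigma> (A \<union> (L n - A)) ((#) b ` A \<union> (L n - (#) b ` A))"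
    by (rule bij_betw_combine[OF b1 b2]) auto
  moreover have "A \<union> (L n - A) = L n" "(#) b ` A \<union> (L n - (#) b ` A) = L n" using A by auto
  ultimately have "\<sigma> \<in> Bij (L n)" by (simp add: Bij_def \<sigma>_def)
  moreover have "\<sigma> l = b # l" if "length l < n" for l using that by (simp add: \<sigma>_def A_def L_def)
  ultimately show ?thesis using that by blast
qed

lemma hom_eq_on_generate:
  assumes "group G" "group H" "h \<in> hom G H" "k \<in> hom G H" "S \<subseteq> carrier G"
    and eq: "\<And>s. s \<in> S \<Longrightarrow> h s = k s" and x: "x \<in> generate G S"
  shows "h x = k x"
proof -
  interpret h: group_hom G H h using assms by (simp add: group_hom_def group_hom_axioms_def)
  interpret k: group_hom G H k using assms by (simp add: group_hom_def group_hom_axioms_def)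
  show ?thesis using x
  proof (induction rule: generate.induct)
    case (eng h1 h2)
    then have "h1 \<in> carrier G" "h2 \<in> carrier G" using h.G.generate_in_carrier[OF assms(5)] by auto
    then show ?case using eng by simp
  qed (use eq assms(5) in auto)
qed

text \<open>
  A generating pair of a free group of rank two satisfies no positive relation.  As in the proof that
  finitely generated residually finite groups are Hopfian, for a finite group \<open>\<Gamma>\<close> the map sending a
  homomorphism \<open>F\<^sub>2 \<rightarrow> \<Gamma>\<close> to its values on the pair is an injection of \<open>\<Gamma> \<times> \<Gamma>\<close> into itself,
  hence onto, so the pair can be sent to any two permutations.
\<close>

lemma free_generating_pair:
  assumes H: "group H" "x \<in> carrier H" "y \<in> carrier H" "generate H {x, y} = carrier H"
    and iso: "H \<cong> free_group (UNIV :: bool set)"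
  shows "inj (\<lambda>u. foldr (\<lambda>b z. (if b then x else y) \<otimes>\<^bsub>H\<^esub> z) u \<one>\<^bsub>H\<^esub>)"
proof (rule injI)
  let ?F = "free_group (UNIV :: bool set)"
  let ?p = "\<lambda>u. foldr (\<lambda>b z. (if b then x else y) \<otimes>\<^bsub>H\<^esub> z) u \<one>\<^bsub>H\<^esub>"
  fix u v :: "bool list" assume uv: "?p u = ?p v"
  interpret H: group H by fact
  interpret F: group ?F unfolding free_group_def by (rule group_presented_group)
  obtain \<phi> where \<phi>: "\<phi> \<in> iso H ?F" using iso by (auto simp: is_iso_def)
  then have \<phi>h: "\<phi> \<in> hom H ?F" and \<phi>b: "bij_betw \<phi> (carrier H) (carrier ?F)" by (auto simp: iso_def)
  interpret \<phi>: group_hom H ?F \<phi>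
    using \<phi>h H.group_axioms F.group_axioms by (simp add: group_hom_def group_hom_axioms_def)
  have gen: "generate ?F {\<phi> x, \<phi> y} = carrier ?F"
    using \<phi>.generate_img[of "{x, y}"] H \<phi>b by (simp add: bij_betw_imp_surj_on)
  obtain wx where wx: "\<phi> x = pres_class UNIV {} wx"
    using \<phi>.hom_closed[OF H(2)] by (auto simp: free_group_def carrier_presented)
  obtain wy where wy: "\<phi> y = pres_class UNIV {} wy"
    using \<phi>.hom_closed[OF H(3)] by (auto simp: free_group_def carrier_presented)
  have all: "w \<in> gwords UNIV" for w :: "bool gword" by (simp add: gwords_iff)
  \<comment> \<open>Lists up to this length suffice to read off both words without meeting the
    arbitrary values of the permutations.\<close>
  define n where "n = max (length u) (length v)"
  define L where "L = {l :: bool list. length l \<le> n}"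
  define \<Gamma> where "\<Gamma> = BijGroup L"
  interpret \<Gamma>: group \<Gamma> unfolding \<Gamma>_def by (rule group_BijGroup)
  have "finite L" using finite_lists_length_le[of "UNIV :: bool set" n] by (simp add: L_def)
  moreover have "carrier \<Gamma> \<subseteq> L \<rightarrow>\<^sub>E L"
  proof
    fix a assume "a \<in> carrier \<Gamma>"
    then have "a \<in> Bij L" by (simp add: \<Gamma>_def BijGroup_def)
    then show "a \<in> L \<rightarrow>\<^sub>E L" using Bij_imp_funcset[of a L] Bij_imp_extensional[of a L] by (simp add: PiE_def)
  qed
  ultimately have fin: "finite (carrier \<Gamma>)" using finite_subset[OF _ finite_PiE[of L "\<lambda>_. L"]] by blast
  define ev where "ev g w = gw_eval \<Gamma> (\<lambda>b. if b then fst g else snd g) w" for g and w :: "bool gword"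
  have lift: "\<exists>\<theta>. \<theta> \<in> hom ?F \<Gamma> \<and> (\<forall>w. \<theta> (pres_class UNIV {} w) = ev g w)"
    if g: "g \<in> carrier \<Gamma> \<times> carrier \<Gamma>" for g
  proof -
    have f: "(\<lambda>b. if b then fst g else snd g) \<in> UNIV \<rightarrow> carrier \<Gamma>" using g by auto
    obtain \<theta> where "\<theta> \<in> hom ?F \<Gamma>"
        "\<And>w. w \<in> gwords UNIV \<Longrightarrow> \<theta> (pres_class UNIV {} w) = gw_eval \<Gamma> (\<lambda>b. if b then fst g else snd g) w"
      using free_lift[OF \<Gamma>.group_axioms f] by blast
    then show ?thesis using all unfolding ev_def by blast
  qed
  define M where "M g = (ev g wx, ev g wy)" for g
  have evc: "ev g w \<in> carrier \<Gamma>" if "g \<in> carrier \<Gamma> \<times> carrier \<Gamma>" for g w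
    unfolding ev_def using that by (intro \<Gamma>.gw_eval_closed[OF all]) auto
  have "inj_on M (carrier \<Gamma> \<times> carrier \<Gamma>)"
  proof (rule inj_onI)
    fix g g' assume g: "g \<in> carrier \<Gamma> \<times> carrier \<Gamma>" "g' \<in> carrier \<Gamma> \<times> carrier \<Gamma>" "M g = M g'"
    obtain \<theta> where \<theta>: "\<theta> \<in> hom ?F \<Gamma>" "\<And>w. \<theta> (pres_class UNIV {} w) = ev g w" using lift[OF g(1)] by blast
    obtain \<theta>' where \<theta>': "\<theta>' \<in> hom ?F \<Gamma>" "\<And>w. \<theta>' (pres_class UNIV {} w) = ev g' w" using lift[OF g(2)] by blast
    have eq: "\<theta> a = \<theta>' a" if "a \<in> carrier ?F" for a
    proof (rule hom_eq_on_generate[OF F.group_axioms \<Gamma>.group_axioms \<theta>(1) \<theta>'(1), of "{\<phi> x, \<phi> y}"])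
      show "{\<phi> x, \<phi> y} \<subseteq> carrier ?F" using H by auto
      show "\<theta> s = \<theta>' s" if "s \<in> {\<phi> x, \<phi> y}" for s
        using that g(3) \<theta>(2) \<theta>'(2) by (auto simp: M_def wx wy)
    qed (use that gen in simp)
    have "ev g [(b, True)] = ev g' [(b, True)]" for b
      using eq[of "pres_class UNIV {} [(b, True)]"] \<theta>(2) \<theta>'(2) all by (simp add: free_group_def)
    from this[of True] this[of False] have "fst g = fst g'" "snd g = snd g'"
      using g by (auto simp: ev_def)
    then show "g = g'" by (rule prod_eqI)
  qed
  moreover have "M ` (carrier \<Gamma> \<times> carrier \<Gamma>) \<subseteq> carrier \<Gamma> \<times> carrier \<Gamma>" using evc by (auto simp: M_def)
  ultimately have surj: "M ` (carrier \<Gamma> \<times> carrier \<Gamma>) = carrier \<Gamma> \<times> carrier \<Gamma>"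
    using fin by (intro endo_inj_surj) auto
  obtain s1 where s1: "s1 \<in> Bij L" "\<And>l. length l < n \<Longrightarrow> s1 l = True # l"
    using prepend_permutation[of n True] unfolding L_def by metis
  obtain s2 where s2: "s2 \<in> Bij L" "\<And>l. length l < n \<Longrightarrow> s2 l = False # l"
    using prepend_permutation[of n False] unfolding L_def by metis
  have "(s1, s2) \<in> M ` (carrier \<Gamma> \<times> carrier \<Gamma>)"
    unfolding surj using s1 s2 by (simp add: \<Gamma>_def BijGroup_def)
  then obtain g where g: "g \<in> carrier \<Gamma> \<times> carrier \<Gamma>" "ev g wx = s1" "ev g wy = s2" by (auto simp: M_def)
  obtain \<theta> where \<theta>: "\<theta> \<in> hom ?F \<Gamma>" "\<And>w. \<theta> (pres_class UNIV {} w) = ev g w" using lift[OF g(1)] by blast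
  interpret \<theta>: group_hom ?F \<Gamma> \<theta>
    using \<theta>(1) F.group_axioms \<Gamma>.group_axioms by (simp add: group_hom_def group_hom_axioms_def)
  have tx: "\<theta> (\<phi> x) = s1" "\<theta> (\<phi> y) = s2" using \<theta>(2) g wx wy by auto
  have nil: "[] \<in> L" by (simp add: L_def)
  have pc: "?p w \<in> carrier H" for w by (induction w) (use H in auto)
  \<comment> \<open>The permutations assigned to \<open>x\<close> and \<open>y\<close> prepend a
    letter each, so a positive word can be read off from the image of the empty list.\<close>
  have main: "\<theta> (\<phi> (?p w)) [] = w" if "length w \<le> n" for w
    using that
  proof (induction w)
    case Nil
    then show ?case using nil by (simp add: \<Gamma>_def BijGroup_def)
  next
    case (Cons b w)
    have "\<theta> (\<phi> (?p (b # w))) = (if b then s1 else s2) \<otimes>\<^bsub>\<Gamma>\<^esub> \<theta> (\<phi> (?p w))"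
      using H pc[of w] tx by simp
    moreover have "\<theta> (\<phi> (?p w)) \<in> Bij L" using \<theta>.hom_closed[of "\<phi> (?p w)"] pc[of w] by (simp add: \<Gamma>_def BijGroup_def)
    ultimately have "\<theta> (\<phi> (?p (b # w))) [] = (if b then s1 else s2) w"
      using Cons s1(1) s2(1) nil by (simp add: \<Gamma>_def BijGroup_def compose_def)
    then show ?case using Cons.prems s1(2)[of w] s2(2)[of w] by simp
  qed
  have "u = \<theta> (\<phi> (?p u)) []" by (rule main[symmetric]) (simp add: n_def)
  also have "\<dots> = \<theta> (\<phi> (?p v)) []" unfolding uv ..
  also have "\<dots> = v" by (rule main) (simp add: n_def)
  finally show "u = v" .
qed

subsection \<open>Growth\<close>

lemma (in group) foldr_replicate_append:
  assumes "s \<in> carrier G" "set ws \<subseteq> carrier G"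
  shows "foldr (\<otimes>) (replicate m s @ ws) \<one> = s [^] m \<otimes> foldr (\<otimes>) ws \<one>"
proof -
  have c: "foldr (\<otimes>) ws \<one> \<in> carrier G" using assms(2) by (induction ws) auto
  show ?thesis
  proof (induction m)
    case 0
    then show ?case using c by simp
  next
    case (Suc m)
    then show ?case using assms(1) c nat_pow_Suc2[of s m] by (simp add: m_assoc del: nat_pow_Suc)
  qed
qed

text \<open>The positive words of length \<open>n div m\<close> in the two powers have length at
  most \<open>n\<close> in \<open>s\<close> and \<open>t\<close>, and by \<open>inj\<close> they
  represent distinct elements.\<close>

lemma (in group) word_ball_card_ge:
  assumes S: "finite S" "S \<subseteq> carrier G" and st: "s \<in> S" "t \<in> S" and m: "m \<ge> 1"
    and inj: "inj (\<lambda>u. foldr (\<lambda>b z. (if b then s [^] (m::nat) else t [^] m) \<otimes> z) u \<one>)"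
  shows "2 ^ (n div m) \<le> card (word_ball G S n)"
proof -
  let ?p = "\<lambda>u. foldr (\<lambda>b z. (if b then s [^] m else t [^] m) \<otimes> z) u \<one>"
  let ?U = "{u :: bool list. length u = n div m}"
  define ex where "ex u = concat (map (\<lambda>b. replicate m (if b then s else t)) u)" for u :: "bool list"
  have exS: "set (ex u) \<subseteq> S" for u using st by (auto simp: ex_def split: if_splits)
  have exl: "length (ex u) = m * length u" for u by (induction u) (auto simp: ex_def)
  have exp: "foldr (\<otimes>) (ex u) \<one> = ?p u" for u
  proof (induction u)
    case Nil
    then show ?case by (simp add: ex_def)
  next
    case (Cons b u)
    have "ex (b # u) = replicate m (if b then s else t) @ ex u" by (simp add: ex_def)
    moreover have "(if b then s else t) \<in> carrier G" using st S by auto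
    moreover have "set (ex u) \<subseteq> carrier G" using exS S by blast
    ultimately have "foldr (\<otimes>) (ex (b # u)) \<one> = (if b then s else t) [^] m \<otimes> foldr (\<otimes>) (ex u) \<one>"
      using foldr_replicate_append by metis
    then show ?case using Cons by simp
  qed
  let ?B = "{ws \<in> lists (S \<union> m_inv G ` S). length ws \<le> n}"
  have "finite (S \<union> m_inv G ` S)" using S by simp
  from finite_lists_length_le[OF this, of n] have finB: "finite ?B"
    by (rule rev_finite_subset) auto
  have "?p ` ?U \<subseteq> word_ball G S n"
  proof
    fix g assume "g \<in> ?p ` ?U"
    then obtain u where u: "length u = n div m" "g = ?p u" by blast
    have "ex u \<in> ?B" using exS[of u] exl[of u] u by (auto simp: lists_eq_set)
    moreover have "g = foldr (\<otimes>) (ex u) \<one>" unfolding exp u(2) ..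
    ultimately show "g \<in> word_ball G S n" unfolding word_ball_def by (rule image_eqI[rotated])
  qed
  then have "card (?p ` ?U) \<le> card (word_ball G S n)"
    unfolding word_ball_def by (intro card_mono finite_imageI finB) auto
  moreover have "card (?p ` ?U) = card ?U" by (rule card_image) (rule inj_on_subset[OF inj], simp)
  moreover have "card ?U = 2 ^ (n div m)"
    using card_lists_length_eq[of "UNIV :: bool set" "n div m"] by simp
  ultimately show ?thesis by simp
qed

text \<open>The exponent comes from \<open>n div m \<ge> n / (2 * m)\<close>, valid for
  \<open>n \<ge> m\<close>; finitely many smaller \<open>n\<close> do not affect the upper
  limit.\<close>

lemma exp_growth_rate_ge:
  assumes m: "m \<ge> 1" and ball: "\<And>n. 2 ^ (n div m) \<le> card (word_ball G S n)"
  shows "ereal (2 powr (1 / (2 * real m))) \<le> exp_growth_rate G S"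
proof -
  have "2 powr (1 / (2 * real m)) \<le> root n (real (card (word_ball G S n)))" if n: "n \<ge> m" for n
  proof -
    have n0: "n > 0" using n m by simp
    define d where "d = n div m"
    have d1: "d \<ge> 1" using n m by (simp add: d_def div_greater_zero_iff Suc_le_eq)
    have "n < m * d + m" using m unfolding d_def by (metis add.commute div_mult_mod_eq mod_less_divisor mult.commute nat_add_left_cancel_less Suc_le_eq One_nat_def add_less_cancel_right)
    also have "m * d + m \<le> 2 * m * d" using d1 by simp
    finally have "real n \<le> 2 * real m * real d" by (metis less_imp_le of_nat_le_iff of_nat_mult of_nat_numeral)
    then have "1 / (2 * real m) \<le> real d / real n" using n0 m by (simp add: field_simps)
    then have "2 powr (1 / (2 * real m)) \<le> 2 powr (real d / real n)" by simp
    also have "\<dots> = root n (2 ^ d)"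
      using n0 by (simp add: root_powr_inverse powr_powr flip: powr_realpow)
    also have "\<dots> \<le> root n (real (card (word_ball G S n)))"
      using ball[of n] n0 by (simp add: d_def)
    finally show ?thesis .
  qed
  then have "\<forall>\<^sub>F n in sequentially. ereal (2 powr (1 / (2 * real m))) \<le> ereal (root n (real (card (word_ball G S n))))"
    by (auto simp: eventually_sequentially intro!: exI[of _ m])
  then show ?thesis unfolding exp_growth_rate_def by (intro le_Limsup) auto
qed

theorem corollary4:
  fixes V :: "'v set" and E :: "'v set set" and lab :: "'v set \<Rightarrow> nat" and m :: nat
  assumes "presentation_graph V E lab"
    and "triangle_free E"
    and "two_two_free E lab"
    and "\<not> spherical_type V E lab"
    and "m \<ge> 1"
    and "uniform_power_exponent (artin_group V E lab) m"
  shows "(\<forall>S. generates (artin_group V E lab) S \<longrightarrow>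
           (\<exists>s\<in>S. \<exists>t\<in>S.
              is_free_group (subgroup_generated (artin_group V E lab)
                {s [^]\<^bsub>artin_group V E lab\<^esub> m, t [^]\<^bsub>artin_group V E lab\<^esub> m}) \<and>
              \<not> comm_group (subgroup_generated (artin_group V E lab)
                {s [^]\<^bsub>artin_group V E lab\<^esub> m, t [^]\<^bsub>artin_group V E lab\<^esub> m})))
         \<and> uniform_exponential_growth (artin_group V E lab)"
proof -
  define A where "A = artin_group V E lab"
  interpret A: group A unfolding A_def by (rule group_artin_group)
  obtain a c where ac: "a \<in> V" "c \<in> V" "a \<noteq> c" "{a, c} \<notin> E"
    using complete_graph_spherical[OF assms(1,2)] assms(4) by blast
  \<comment> \<open>Non-commuting powers rule out the first case of the power alternative, leaving
    the free group.\<close>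
  have key: "\<exists>s\<in>S. \<exists>t\<in>S. s \<in> carrier A \<and> t \<in> carrier A \<and>
      s [^]\<^bsub>A\<^esub> m \<otimes>\<^bsub>A\<^esub> t [^]\<^bsub>A\<^esub> m \<noteq> t [^]\<^bsub>A\<^esub> m \<otimes>\<^bsub>A\<^esub> s [^]\<^bsub>A\<^esub> m \<and>
      subgroup_generated A {s [^]\<^bsub>A\<^esub> m, t [^]\<^bsub>A\<^esub> m} \<cong> free_group (UNIV :: bool set)"
    if S: "generates A S" for S
  proof -
    obtain s t where st: "s \<in> S" "t \<in> S"
        "s [^]\<^bsub>A\<^esub> m \<otimes>\<^bsub>A\<^esub> t [^]\<^bsub>A\<^esub> m \<noteq> t [^]\<^bsub>A\<^esub> m \<otimes>\<^bsub>A\<^esub> s [^]\<^bsub>A\<^esub> m"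
      using artin_noncommuting_powers[OF assms(1-3) ac S[unfolded A_def] assms(5)] unfolding A_def by metis
    have "s \<in> carrier A" "t \<in> carrier A" using st S by (auto simp: generates_def)
    moreover from this have "subgroup_generated A {s [^]\<^bsub>A\<^esub> m, t [^]\<^bsub>A\<^esub> m} \<cong> free_group (UNIV :: bool set)"
      using assms(6) st(3) unfolding uniform_power_exponent_def A_def by blast
    ultimately show ?thesis using st by blast
  qed
  have "\<exists>s\<in>S. \<exists>t\<in>S. is_free_group (subgroup_generated A {s [^]\<^bsub>A\<^esub> m, t [^]\<^bsub>A\<^esub> m}) \<and>
      \<not> comm_group (subgroup_generated A {s [^]\<^bsub>A\<^esub> m, t [^]\<^bsub>A\<^esub> m})" if S: "generates A S" for S
  proof -
    obtain s t where st: "s \<in> S" "t \<in> S" "s \<in> carrier A" "t \<in> carrier A"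
        "s [^]\<^bsub>A\<^esub> m \<otimes>\<^bsub>A\<^esub> t [^]\<^bsub>A\<^esub> m \<noteq> t [^]\<^bsub>A\<^esub> m \<otimes>\<^bsub>A\<^esub> s [^]\<^bsub>A\<^esub> m"
        "subgroup_generated A {s [^]\<^bsub>A\<^esub> m, t [^]\<^bsub>A\<^esub> m} \<cong> free_group (UNIV :: bool set)"
      using key[OF S] by blast
    define x y where "x = s [^]\<^bsub>A\<^esub> m" and "y = t [^]\<^bsub>A\<^esub> m"
    have xy: "x \<in> carrier A" "y \<in> carrier A" "x \<otimes>\<^bsub>A\<^esub> y \<noteq> y \<otimes>\<^bsub>A\<^esub> x"
      using st by (auto simp: x_def y_def)
    \<comment> \<open>The set \<open>{x, y}\<close> serves as an index set with two elements of the
      right type; that the pair itself is a basis is not claimed.\<close>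
    then have "x \<noteq> y" by auto
    then have "bij_betw (\<lambda>b. if b then x else y) UNIV {x, y}"
      by (auto simp: bij_betw_def inj_def UNIV_bool split: if_splits)
    then have "subgroup_generated A {x, y} \<cong> free_group {x, y}"
      using free_group_rename st(6) iso_trans unfolding x_def y_def by blast
    then have "is_free_group (subgroup_generated A {x, y})" unfolding is_free_group_def by blast
    moreover have "\<not> comm_group (subgroup_generated A {x, y})"
    proof
      assume "comm_group (subgroup_generated A {x, y})"
      then interpret H: comm_group "subgroup_generated A {x, y}" .
      have "x \<in> carrier (subgroup_generated A {x, y})" "y \<in> carrier (subgroup_generated A {x, y})"
        using xy by (auto simp: carrier_subgroup_generated intro: generate.incl)
      from H.m_comm[OF this] show False using xy(3) by simp
    qed
    ultimately show ?thesis using st(1,2) unfolding x_def y_def by blast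
  qed
  moreover have "uniform_exponential_growth A"
  proof -
    let ?X = "(\<lambda>x. pres_class V (artin_relations E lab) [(x, True)]) ` V"
    have "finite ?X" using assms(1) by (simp add: presentation_graph_def)
    moreover have "?X \<subseteq> carrier A" by (auto simp: A_def artin_group_def)
    then have "generates A ?X"
      unfolding generates_def A_def using generate_artin_gens[of V E lab] by blast
    ultimately have ex: "\<exists>S. finite S \<and> generates A S" by blast
    have "ereal (2 powr (1 / (2 * real m))) \<le> exp_growth_rate A S" if S: "finite S" "generates A S" for S
    proof -
      obtain s t where st: "s \<in> S" "t \<in> S" "s \<in> carrier A" "t \<in> carrier A"
          "subgroup_generated A {s [^]\<^bsub>A\<^esub> m, t [^]\<^bsub>A\<^esub> m} \<cong> free_group (UNIV :: bool set)"
        using key[OF S(2)] by metis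
      define x y where "x = s [^]\<^bsub>A\<^esub> m" and "y = t [^]\<^bsub>A\<^esub> m"
      have xy: "x \<in> carrier A" "y \<in> carrier A" using st by (auto simp: x_def y_def)
      let ?H = "subgroup_generated A {x, y}"
      interpret H: group ?H by (rule A.group_subgroup_generated)
      have xyH: "x \<in> carrier ?H" "y \<in> carrier ?H"
        using xy by (auto simp: carrier_subgroup_generated intro: generate.incl)
      have "carrier ?H = generate A {x, y}" using xy by (simp add: carrier_subgroup_generated)
      also have "\<dots> \<subseteq> generate ?H {x, y}"
      proof
        fix g assume "g \<in> generate A {x, y}"
        then show "g \<in> generate ?H {x, y}"
        proof (induction rule: generate.induct)
          case one
          then show ?case using generate.one[of ?H "{x, y}"] by simp
        next
          case (incl h)
          then show ?case by (rule generate.incl)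
        next
          case (inv h)
          then have "inv\<^bsub>?H\<^esub> h = inv\<^bsub>A\<^esub> h" using xyH by (auto simp: A.inv_subgroup_generated)
          then show ?case using generate.inv[OF inv, of ?H] by simp
        next
          case (eng h1 h2)
          then show ?case using generate.eng[OF eng.IH] by simp
        qed
      qed
      finally have "generate ?H {x, y} = carrier ?H"
        using H.generate_incl[of "{x, y}"] xyH by auto
      then have "inj (\<lambda>u. foldr (\<lambda>b z. (if b then x else y) \<otimes>\<^bsub>?H\<^esub> z) u \<one>\<^bsub>?H\<^esub>)"
        using free_generating_pair[OF H.group_axioms xyH] st(5) unfolding x_def y_def by blast
      then have "inj (\<lambda>u. foldr (\<lambda>b z. (if b then x else y) \<otimes>\<^bsub>A\<^esub> z) u \<one>\<^bsub>A\<^esub>)" by simp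
      then have "2 ^ (n div m) \<le> card (word_ball A S n)" for n
        using A.word_ball_card_ge[OF S(1) _ st(1,2) assms(5)] S(2) unfolding x_def y_def generates_def by blast
      then show ?thesis using exp_growth_rate_ge[OF assms(5)] by blast
    qed
    \<comment> \<open>The bound depends on \<open>m\<close> alone and not on \<open>S\<close>, so it
      passes to the infimum.\<close>
    then have "ereal (2 powr (1 / (2 * real m))) \<le> (INF S\<in>{S. finite S \<and> generates A S}. exp_growth_rate A S)"
      by (intro INF_greatest) auto
    moreover have "1 < ereal (2 powr (1 / (2 * real m)))" using assms(5) by (simp add: one_ereal_def)
    ultimately have "1 < (INF S\<in>{S. finite S \<and> generates A S}. exp_growth_rate A S)" by (rule less_le_trans[rotated])
    then show ?thesis using ex by (simp add: uniform_exponential_growth_def)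
  qed
  ultimately show ?thesis unfolding A_def by blast
qed

end
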